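(* Let the feasibility, type and measurement-noise assumptions (all stated in the context) hold. For all $\gamma\in[\frac12,1)$, the type estimates $\{\hat\Theta(\tau)\}_{\tau=1}^t$ produced by Algorithm A (described in the context) with parameter $\gamma$ satisfy $$\|\hat\Theta(t)-\Theta^*\|_F^2=O(t^{-\gamma})\quad\text{a.s.}$$ Moreover, the planner's regret $\mathcal R_t=\sum_{\tau=1}^t\big(\Psi(\hat x(\tau),u(\tau))-\Psi(x^\dagger,u^\dagger)\big)^2$ satisfies $$\mathcal R_t=O(t^\gamma\log t)\quad\text{a.s.}$$
   Context: Game. There are $n$ agents. Agent $i\in[n]$ chooses $x_i\in\mathcal X_i$, with $\mathcal X_i\subset\mathbb R$ compact and convex; $\mathcal X=\prod_i\mathcal X_i$. For a fixed degree $d\in\mathbb N$, $\Phi:\mathbb R^n\to\mathbb R^D$, $D=\binom{n+d}{d}$, is the vector of all monomials $x^a$, $a\in\mathbb N^n$, of total degree at most $d$. Agent $i$'s nominal cost $\ell_i:\mathcal X\to\mathbb R$ satisfies $\frac{\partial\ell_i}{\partial x_i}(x)=\theta_i^{*\top}\Phi(x)$, and $\Theta^*=(\theta_1^*,\dots,\theta_n^* )^\top\in\mathbb R^{n\times D}$ is unknown to the planner. Feasibility assumption: the social cost $\Psi:\mathcal X\times\mathbb R^n\to\mathbb R$ is $L_\Psi$-Lipschitz, strictly convex in both arguments (jointly in $(x,u)$), and coercive in its second argument; $(x^\dagger,u^\dagger)$ is its unique minimizer over $\mathcal X\times\mathbb R^n$, and $x^\dagger\in\operatorname{int}\mathcal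 X$. For $p\in\mathbb R^n$ the incentive law is $\gamma_i(x,p)=p_ix_i+(u_i^\dagger-p_ix_i^\dagger)$, $i\in[n]$ (the law $\gamma(\cdot,\cdot)$ is distinct from the scalar parameter $\gamma$). Type assumption: there exist $m>0$ and a diagonal matrix $R$ with positive diagonal entries such that $\operatorname{Sym}(R\Theta^*\nabla\Phi(x))\succeq\frac12m\mathbb I$ for all $x\in\mathcal X$, where $\operatorname{Sym}(A)=\frac12(A+A^\top)$ and $\nabla\Phi$ is the Jacobian. Under it, for each $p\in\mathbb R^n$ the game in which agent $i$ minimizes $\ell_i(x)+\gamma_i(x,p)$ over $x_i\in\mathcal X_i$ has a unique Nash equilibrium, denoted $x^*(p)\in\mathcal X$. Data. At time $t\ge1$ the planner issues $p(t)$; the observed response is $\hat x(t)=x^*(p(t))$, the observed incentive is $\hat p(t)=p(t)+e(t)$, and the implemented incentive is $u(t)=\gamma(\hat x(t),p(t))$. Measurement-noise assumption: there is no endogenous noise (the response is exactly $x^*(p(t))$), and $\{e(t)\}_t$ is i.i.d., zero-mean, with $\mathbb E(e(t)e(t)^\top)=\sigma_e^2\mathbb I$ and $\sup_t\mathbb E\|e(t)\|_\infty^a<\infty$ for some $a>2$ and $\sigma_e>0$. Algorithm A (parameters $\gamma\in[\frac12,1)$, $\sigma_p^2>0$). Let $A(\tau)=\tau^\gamma\log\tau$ (with $A(1)^{-1}=+\infty$). Initialize a symmetric $S_1\succ0$, $p(1)\in\mathbb R^n$ and $\hat\Theta(1)\in\mathbb R^{n\times D}$. For $\tau=2,3,\dots$: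 - If $\operatorname{tr}(S_{\tau-1})>A(\tau-1)^{-1}$ (exploration): draw $p(\tau)\sim\mathcal N(0,\sigma_p^2\mathbb I)$, the draws being i.i.d. and independent of the noise; issue $\gamma(\cdot,p(\tau))$; observe $\hat x(\tau)=x^*(p(\tau))$ and $\hat p(\tau)$; with $\xi(\tau)=\Phi(\hat x(\tau))$ and $\delta(\tau)=\mathbf 1\{\hat x(\tau)\in\operatorname{int}\mathcal X\}$, set $$\hat\Theta(\tau)=\hat\Theta(\tau-1)-\delta(\tau)\big(\hat p(\tau)+\hat\Theta(\tau-1)\xi(\tau)\big)\frac{\xi(\tau)^\top S_{\tau-1}}{1+\delta(\tau)\xi(\tau)^\top S_{\tau-1}\xi(\tau)},$$ $$S_\tau=S_{\tau-1}-\delta(\tau)S_{\tau-1}\xi(\tau)\frac{\xi(\tau)^\top S_{\tau-1}}{1+\delta(\tau)\xi(\tau)^\top S_{\tau-1}\xi(\tau)}.$$ - Otherwise (exploitation): issue $\gamma(\cdot,p(\tau))$ with $p(\tau)=-\hat\Theta(\tau-1)\Phi(x^\dagger)$, and set $S_\tau=S_{\tau-1}$, $\hat\Theta(\tau)=\hat\Theta(\tau-1)$. $\|\cdot\|_F$ is the Frobenius norm. For random sequences, $f(t)=O(g(t))$ a.s. means that with probability one there are (sample-path dependent) $c,t_0>0$ with $|f(t)|\le c|g(t)|$ for $t\ge t_0$. *)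

theory Defs
  imports "HOL-Probability.Probability" "HOL-Library.Landau_Symbols"
begin

section \<open>Matrices\<close>

definition outer :: "real ^ 'a \<Rightarrow> real ^ 'b \<Rightarrow> real ^ 'b ^ 'a" where
  "outer a b = (\<chi> i j. a $ i * b $ j)"

definition sym_part :: "real ^ 'n ^ 'n \<Rightarrow> real ^ 'n ^ 'n" where
  "sym_part A = (1 / 2) *\<^sub>R (A + transpose A)"

definition psd :: "real ^ 'n ^ 'n \<Rightarrow> bool" where
  "psd A \<longleftrightarrow> transpose A = A \<and> (\<forall>v. 0 \<le> v \<bullet> (A *v v))"

definition loewner_ge :: "real ^ 'n ^ 'n \<Rightarrow> real ^ 'n ^ 'n \<Rightarrow> bool" where
  "loewner_ge A B \<longleftrightarrow> psd (A - B)"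

definition sym_pos_def :: "real ^ 'n ^ 'n \<Rightarrow> bool" where
  "sym_pos_def A \<longleftrightarrow> transpose A = A \<and> (\<forall>v. v \<noteq> 0 \<longrightarrow> 0 < v \<bullet> (A *v v))"

definition is_diagonal :: "real ^ 'n ^ 'n \<Rightarrow> bool" where
  "is_diagonal A \<longleftrightarrow> (\<forall>i j. i \<noteq> j \<longrightarrow> A $ i $ j = 0)"

text \<open>The norm that the library puts on a matrix, as a vector of row vectors, is the
  Frobenius norm.\<close>

lemma norm_matrix_frobenius:
  fixes A :: "real ^ 'm ^ 'n"
  shows "norm A = sqrt (\<Sum>i\<in>UNIV. \<Sum>j\<in>UNIV. (A $ i $ j)\<^sup>2)"
  by (simp add: norm_vec_def L2_set_def sum_nonneg)


section \<open>Monomial features\<close>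

text \<open>The type \<open>'n\<close> indexes the agents and the type \<open>'m\<close> the coordinates of the feature space.
  An enumeration \<open>mon\<close> assigns an exponent vector to each coordinate. That it is a bijection
  onto the exponents of total degree at most \<open>d\<close> forces \<open>CARD('m) = (CARD('n) + d) choose d\<close>.\<close>

definition enumerates_exponents :: "nat \<Rightarrow> ('m::finite \<Rightarrow> 'n::finite \<Rightarrow> nat) \<Rightarrow> bool" where
  "enumerates_exponents d mon \<longleftrightarrow> bij_betw mon UNIV {a. (\<Sum>i\<in>UNIV. a i) \<le> d}"

definition features :: "('m::finite \<Rightarrow> 'n::finite \<Rightarrow> nat) \<Rightarrow> real ^ 'n \<Rightarrow> real ^ 'm" where
  "features mon x = (\<chi> k. \<Prod>i\<in>UNIV. (x $ i) ^ mon k i)"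


section \<open>The game\<close>

definition action_profiles :: "('n::finite \<Rightarrow> real set) \<Rightarrow> (real ^ 'n) set" where
  "action_profiles Xs = {x. \<forall>i. x $ i \<in> Xs i}"

definition deviate :: "real ^ 'n \<Rightarrow> 'n \<Rightarrow> real \<Rightarrow> real ^ 'n" where
  "deviate x i s = (\<chi> j. if j = i then s else x $ j)"

text \<open>The derivative is taken within the action interval, hence one-sided at its end points;
  the nominal costs matter only on the action profiles.\<close>

definition has_marginal_costs ::
  "('n::finite \<Rightarrow> real set) \<Rightarrow> ('n \<Rightarrow> real ^ 'n \<Rightarrow> real) \<Rightarrow> ('m::finite \<Rightarrow> 'n \<Rightarrow> nat)
    \<Rightarrow> real ^ 'm ^ 'n \<Rightarrow> bool" where
  "has_marginal_costs Xs l mon Th \<longleftrightarrow>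
     (\<forall>i. \<forall>x\<in>action_profiles Xs.
        ((\<lambda>s. l i (deviate x i s)) has_real_derivative (Th $ i \<bullet> features mon x))
          (at (x $ i) within Xs i))"

definition nash_equilibrium ::
  "('n::finite \<Rightarrow> real set) \<Rightarrow> ('n \<Rightarrow> real ^ 'n \<Rightarrow> real) \<Rightarrow> real ^ 'n \<Rightarrow> bool" where
  "nash_equilibrium Xs cost x \<longleftrightarrow>
     x \<in> action_profiles Xs \<and> (\<forall>i. \<forall>s\<in>Xs i. cost i x \<le> cost i (deviate x i s))"

definition incentive :: "real ^ 'n \<Rightarrow> real ^ 'n \<Rightarrow> real ^ 'n \<Rightarrow> real ^ 'n \<Rightarrow> real ^ 'n" where
  "incentive xd ud x p = (\<chi> i. p $ i * x $ i + (ud $ i - p $ i * xd $ i))"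

definition nash_response ::
  "('n::finite \<Rightarrow> real set) \<Rightarrow> ('n \<Rightarrow> real ^ 'n \<Rightarrow> real) \<Rightarrow> real ^ 'n \<Rightarrow> real ^ 'n
    \<Rightarrow> real ^ 'n \<Rightarrow> real ^ 'n" where
  "nash_response Xs l xd ud p =
     (THE x. nash_equilibrium Xs (\<lambda>i y. l i y + incentive xd ud y p $ i) x)"


section \<open>Assumptions\<close>

definition strictly_convex_on :: "'a::real_vector set \<Rightarrow> ('a \<Rightarrow> real) \<Rightarrow> bool" where
  "strictly_convex_on S f \<longleftrightarrow> convex S \<and>
     (\<forall>x\<in>S. \<forall>y\<in>S. \<forall>t. x \<noteq> y \<and> 0 < t \<and> t < 1 \<longrightarrow>
        f ((1 - t) *\<^sub>R x + t *\<^sub>R y) < (1 - t) * f x + t * f y)"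

definition feasibility_assumption ::
  "(real ^ 'n::finite) set \<Rightarrow> ((real ^ 'n) \<times> (real ^ 'n) \<Rightarrow> real) \<Rightarrow> real \<Rightarrow> real ^ 'n \<Rightarrow> real ^ 'n
    \<Rightarrow> bool" where
  "feasibility_assumption X \<Psi> L xd ud \<longleftrightarrow>
     L-lipschitz_on (X \<times> UNIV) \<Psi> \<and>
     strictly_convex_on (X \<times> UNIV) \<Psi> \<and>
     (\<forall>x\<in>X. filterlim (\<lambda>u. \<Psi> (x, u)) at_top at_infinity) \<and>
     (\<forall>z\<in>X \<times> UNIV. z \<noteq> (xd, ud) \<longrightarrow> \<Psi> (xd, ud) < \<Psi> z) \<and>
     xd \<in> interior X"

definition type_assumption ::
  "(real ^ 'n::finite) set \<Rightarrow> ('m::finite \<Rightarrow> 'n \<Rightarrow> nat) \<Rightarrow> real ^ 'm ^ 'n \<Rightarrow> bool" where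
  "type_assumption X mon Th \<longleftrightarrow>
     (\<exists>m > 0. \<exists>R :: real ^ 'n ^ 'n. is_diagonal R \<and> (\<forall>i. 0 < R $ i $ i) \<and>
        (\<forall>x\<in>X. loewner_ge (sym_part (R ** Th ** jacobian (features mon) (at x)))
                  ((m / 2) *\<^sub>R mat 1)))"

definition noise_assumption :: "'w measure \<Rightarrow> (nat \<Rightarrow> 'w \<Rightarrow> real ^ 'n::finite) \<Rightarrow> bool" where
  "noise_assumption M e \<longleftrightarrow>
     prob_space.indep_vars M (\<lambda>_. borel) e {1..} \<and>
     (\<forall>t\<ge>1. distr M borel (e t) = distr M borel (e 1)) \<and>
     (\<forall>t\<ge>1. integrable M (e t) \<and> (\<integral>\<omega>. e t \<omega> \<partial>M) = 0) \<and>
     (\<exists>\<sigma>>0. \<forall>t\<ge>1. integrable M (\<lambda>\<omega>. outer (e t \<omega>) (e t \<omega>)) \<and>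
        (\<integral>\<omega>. outer (e t \<omega>) (e t \<omega>) \<partial>M) = \<sigma>\<^sup>2 *\<^sub>R mat 1) \<and>
     (\<exists>a>2. (SUP t\<in>{1..}. \<integral>\<^sup>+\<omega>. ennreal (infnorm (e t \<omega>) powr a) \<partial>M) < \<infinity>)"

text \<open>The draw \<open>w t\<close> is the Gaussian vector that the planner issues at time \<open>t\<close> if that round
  explores. Its density is that of independent coordinates of variance \<open>\<sigma>\<^sup>2\<close>; the second
  argument of \<^const>\<open>normal_density\<close> is the standard deviation. The joint independence of
  noise and draws is that of the family indexed by the disjoint union of their times.\<close>

definition exploration_draws ::
  "'w measure \<Rightarrow> (nat \<Rightarrow> 'w \<Rightarrow> real ^ 'n::finite) \<Rightarrow> real \<Rightarrow> (nat \<Rightarrow> 'w \<Rightarrow> real ^ 'n) \<Rightarrow> bool" where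
  "exploration_draws M e \<sigma> w \<longleftrightarrow>
     (\<forall>t\<ge>2. distributed M lborel (w t)
        (\<lambda>x. ennreal (\<Prod>i\<in>UNIV. normal_density 0 \<sigma> (x $ i)))) \<and>
     prob_space.indep_vars M (\<lambda>_. borel) (case_sum e w) ({1..} <+> {2..})"


section \<open>The algorithm\<close>

definition A_rate :: "real \<Rightarrow> nat \<Rightarrow> real" where
  "A_rate \<gamma> t = real t powr \<gamma> * ln (real t)"

text \<open>The inverse is taken in the extended reals, where \<open>inverse 0 = \<infinity>\<close>: as
  \<open>A_rate \<gamma> 1 = 0\<close>, round 2 never explores.\<close>

definition explores :: "real \<Rightarrow> real ^ 'm ^ 'm \<Rightarrow> nat \<Rightarrow> bool" where
  "explores \<gamma> S t \<longleftrightarrow> ereal (trace S) > inverse (ereal (A_rate \<gamma> t))"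

definition S_update :: "real \<Rightarrow> real ^ 'm \<Rightarrow> real ^ 'm ^ 'm \<Rightarrow> real ^ 'm ^ 'm" where
  "S_update \<delta> \<xi> S =
     S - (\<delta> / (1 + \<delta> * (\<xi> \<bullet> (S *v \<xi>)))) *\<^sub>R outer (S *v \<xi>) (\<xi> v* S)"

definition Theta_update ::
  "real \<Rightarrow> real ^ 'm \<Rightarrow> real ^ 'm ^ 'm \<Rightarrow> real ^ 'n \<Rightarrow> real ^ 'm ^ 'n \<Rightarrow> real ^ 'm ^ 'n" where
  "Theta_update \<delta> \<xi> S ph T =
     T - (\<delta> / (1 + \<delta> * (\<xi> \<bullet> (S *v \<xi>)))) *\<^sub>R outer (ph + T *v \<xi>) (\<xi> v* S)"

text \<open>One sample path of the algorithm: \<open>xs\<close> is the equilibrium map, \<open>\<gamma>\<close> the rate parameter,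
  \<open>S1\<close>, \<open>p1\<close>, \<open>T1\<close> the initial values, \<open>e\<close> and \<open>w\<close> the realized noise and draws, and \<open>p\<close>,
  \<open>S\<close>, \<open>T\<close> the resulting parameters, gain matrices and type estimates from time 1 on.\<close>

definition algorithm_path ::
  "(real ^ 'n::finite) set \<Rightarrow> ('m::finite \<Rightarrow> 'n \<Rightarrow> nat) \<Rightarrow> (real ^ 'n \<Rightarrow> real ^ 'n) \<Rightarrow> real ^ 'n
    \<Rightarrow> real \<Rightarrow> real ^ 'm ^ 'm \<Rightarrow> real ^ 'n \<Rightarrow> real ^ 'm ^ 'n
    \<Rightarrow> (nat \<Rightarrow> real ^ 'n) \<Rightarrow> (nat \<Rightarrow> real ^ 'n)
    \<Rightarrow> (nat \<Rightarrow> real ^ 'n) \<Rightarrow> (nat \<Rightarrow> real ^ 'm ^ 'm) \<Rightarrow> (nat \<Rightarrow> real ^ 'm ^ 'n) \<Rightarrow> bool" where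
  "algorithm_path X mon xs xd \<gamma> S1 p1 T1 e w p S T \<longleftrightarrow>
     S 1 = S1 \<and> p 1 = p1 \<and> T 1 = T1 \<and>
     (\<forall>\<tau>\<ge>2.
        if explores \<gamma> (S (\<tau> - 1)) (\<tau> - 1) then
          (let xh = xs (p \<tau>); ph = p \<tau> + e \<tau>; \<xi> = features mon xh;
               \<delta> = indicator (interior X) xh
           in p \<tau> = w \<tau> \<and>
              T \<tau> = Theta_update \<delta> \<xi> (S (\<tau> - 1)) ph (T (\<tau> - 1)) \<and>
              S \<tau> = S_update \<delta> \<xi> (S (\<tau> - 1)))
        else
          p \<tau> = - (T (\<tau> - 1) *v features mon xd) \<and>
          S \<tau> = S (\<tau> - 1) \<and> T \<tau> = T (\<tau> - 1))"

definition regret ::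
  "((real ^ 'n) \<times> (real ^ 'n) \<Rightarrow> real) \<Rightarrow> real ^ 'n \<Rightarrow> real ^ 'n \<Rightarrow> (real ^ 'n \<Rightarrow> real ^ 'n)
    \<Rightarrow> (nat \<Rightarrow> real ^ 'n) \<Rightarrow> nat \<Rightarrow> real" where
  "regret \<Psi> xd ud xs p t =
     (\<Sum>\<tau>=1..t. (\<Psi> (xs (p \<tau>), incentive xd ud (xs (p \<tau>)) (p \<tau>)) - \<Psi> (xd, ud))\<^sup>2)"

end

theory Submission
  imports Defs "HOL-Real_Asymp.Real_Asymp"
begin

text \<open>The proof rests on the growth of two quantities along the explored rounds.

  Where the equilibrium response \<open>x\<close> to \<open>p\<close> is interior, the first-order conditions read
  \<open>p = - \<Theta>\<^sup>* \<Phi>(x)\<close>. An explored round with an interior response is therefore a sample of a linear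
  regression for \<open>\<Theta>\<^sup>*\<close> with regressor \<open>\<Phi>(x)\<close> and noise \<open>e\<close>, and the updates are recursive least
  squares: the gain \<open>S\<close> is the inverse of the information matrix
  \<open>P = S\<^sub>1\<^sup>-\<^sup>1 + \<Sum> \<xi> \<xi>\<^sup>T\<close>, and the error times \<open>P\<close> is a constant minus the noise sum
  \<open>\<Sum> e \<xi>\<^sup>T\<close> (\<open>rls.invariant\<close>). Up to that constant, the error is thus at most the
  noise sum divided by the least eigenvalue of \<open>P\<close>.

  Let \<open>n\<close> be the number of explored rounds up to time \<open>t\<close>. Since a round is explored exactly if the
  trace of \<open>S\<close> exceeds the inverse of \<open>A = t\<^sup>\<gamma> log t\<close>, two-sided bounds of order \<open>n\<close> on the
  eigenvalues of \<open>P\<close> make \<open>n\<close> of order \<open>A\<close>. The regressors are bounded, which gives the lower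
  bound on \<open>n\<close> on every path (\<open>exploration_count_lower_bound\<close>). For the upper bound \<open>P\<close> has to grow in
  every direction (\<open>persistent_excitation\<close>): the equilibrium map is Lipschitz and attains every
  interior profile, no nonzero combination of the monomials vanishes on a nonempty open set,
  and the Gaussian draws charge every nonempty open set of parameters.

  The noise sum is \<open>O(\<surd>(n log t)) = O(t\<^sup>\<gamma>\<^sup>/\<^sup>2 log t)\<close> (\<open>noise_sum_growth\<close>), so the error is
  \<open>O(t\<^sup>-\<^sup>\<gamma>\<^sup>/\<^sup>2)\<close>. Almost sure bounds on sums over the explored rounds come from one device. Whether a
  round explores is decided before its draw and its noise are realised, so a suitably compensated
  sum has exponential moments at most one, and by the Borel--Cantelli lemma it is eventually below
  \<open>2 log t\<close>, which is negligible against \<open>n\<close>. For the noise this is a Chernoff bound at scale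
  \<open>t\<^sup>-\<^sup>\<gamma>\<^sup>/\<^sup>2\<close>, applied after truncation at \<open>t\<^sup>\<gamma>\<^sup>/\<^sup>2\<close>; the moment of order above two makes the
  truncation harmless.

  An explored round costs at most a constant times \<open>1 + |w|\<^sup>2\<close>, which sums to \<open>O(n)\<close>. An exploiting
  round costs at most a constant times the squared error, that is \<open>O(t\<^sup>-\<^sup>\<gamma>)\<close>, which sums to
  \<open>O(\<surd>t)\<close>, because \<open>\<gamma> \<ge> 1/2\<close>, and hence to \<open>O(t\<^sup>\<gamma>)\<close>.\<close>

section \<open>Independence of the monomials\<close>

text \<open>Induction on the set of variables: with all other variables frozen, the sum is a polynomial in the
  new one with infinitely many roots, so its coefficients vanish, and these are sums of the same
  kind over the monomials that share an exponent.\<close>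

lemma monomials_linearly_independent:
  fixes c :: "('n \<Rightarrow> nat) \<Rightarrow> real"
  assumes "finite I" "finite A"
    and "\<And>a b. a \<in> A \<Longrightarrow> b \<in> A \<Longrightarrow> (\<And>i. i \<in> I \<Longrightarrow> a i = b i) \<Longrightarrow> a = b"
    and "\<And>i. i \<in> I \<Longrightarrow> infinite (B i)"
    and "\<And>x. (\<And>i. i \<in> I \<Longrightarrow> x i \<in> B i) \<Longrightarrow> (\<Sum>a\<in>A. c a * (\<Prod>i\<in>I. x i ^ a i)) = 0"
    and "a \<in> A"
  shows "c a = 0"
  using assms
proof (induction I arbitrary: A a rule: finite_induct)
  case empty
  have "A = {a}" using empty.prems(2,5) by blast
  then show ?case using empty.prems(4) by simp
next
  case (insert i I)
  let ?Ak = "{b \<in> A. b i = a i}"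
  have "(\<Sum>b\<in>?Ak. c b * (\<Prod>j\<in>I. x j ^ b j)) = 0" if x: "\<And>j. j \<in> I \<Longrightarrow> x j \<in> B j" for x
  proof -
    define q where "q k = (\<Sum>b | b \<in> A \<and> b i = k. c b * (\<Prod>j\<in>I. x j ^ b j))" for k
    obtain N where N: "\<And>b. b \<in> A \<Longrightarrow> b i \<le> N"
      using finite_nat_set_iff_bounded_le[of "(\<lambda>b. b i) ` A"] \<open>finite A\<close> by auto
    have "(\<Sum>k\<le>N. q k * t ^ k) = 0" if t: "t \<in> B i" for t
    proof -
      have "(\<Sum>k\<le>N. q k * t ^ k)
          = (\<Sum>k\<le>N. \<Sum>b | b \<in> A \<and> b i = k. c b * (\<Prod>j\<in>insert i I. (x(i := t)) j ^ b j))"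
      proof (intro sum.cong refl)
        fix k
        have "(\<Prod>j\<in>insert i I. (x(i := t)) j ^ b j) = t ^ b i * (\<Prod>j\<in>I. x j ^ b j)" for b
        proof -
          have "(\<Prod>j\<in>I. (x(i := t)) j ^ b j) = (\<Prod>j\<in>I. x j ^ b j)"
            using insert.hyps by (intro prod.cong) auto
          then show ?thesis using insert.hyps by simp
        qed
        then show "q k * t ^ k
            = (\<Sum>b | b \<in> A \<and> b i = k. c b * (\<Prod>j\<in>insert i I. (x(i := t)) j ^ b j))"
          by (simp add: q_def sum_distrib_left sum_distrib_right algebra_simps)
      qed
      also have "\<dots> = (\<Sum>b\<in>A. c b * (\<Prod>j\<in>insert i I. (x(i := t)) j ^ b j))"
        using N \<open>finite A\<close> by (intro sum.group) auto
      also have "\<dots> = 0"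
        using x t insert.hyps by (intro insert.prems(4)) auto
      finally show ?thesis .
    qed
    then have "B i \<subseteq> {t. (\<Sum>k\<le>N. q k * t ^ k) = 0}" by auto
    moreover have "infinite (B i)" using insert.prems by auto
    ultimately have "infinite {t. (\<Sum>k\<le>N. q k * t ^ k) = 0}"
      using finite_subset by blast
    then have "\<forall>k\<le>N. q k = 0" using polyfun_finite_roots[of q N] by blast
    then have "q (a i) = 0" using N \<open>a \<in> A\<close> by blast
    then show ?thesis by (simp add: q_def)
  qed
  note zero = this
  show ?case
  proof (rule insert.IH[of ?Ak a])
    show "b = b'" if "b \<in> ?Ak" "b' \<in> ?Ak" "\<And>j. j \<in> I \<Longrightarrow> b j = b' j" for b b'
      using that by (intro insert.prems(2)) auto
    show "infinite (B j)" if "j \<in> I" for j using that insert.prems(3) by simp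
  qed (use zero insert.prems in auto)
qed

lemma features_span:
  fixes v :: "real ^ 'm::finite" and mon :: "'m \<Rightarrow> 'n::finite \<Rightarrow> nat"
  assumes "inj mon" "open U" "x0 \<in> U" and zero: "\<And>x. x \<in> U \<Longrightarrow> v \<bullet> features mon x = 0"
  shows "v = 0"
proof -
  obtain e where e: "e > 0" "ball x0 e \<subseteq> U"
    using \<open>open U\<close> \<open>x0 \<in> U\<close> openE by blast
  \<comment> \<open>a box of this half-width around \<open>x0\<close> lies in the ball\<close>
  define r where "r = e / (2 * real CARD('n))"
  have r: "r > 0" using e by (simp add: r_def)
  define B where "B i = {x0 $ i - r .. x0 $ i + r}" for i
  have "v $ inv mon a = 0" if "a \<in> range mon" for a
  proof (rule monomials_linearly_independent[where I=UNIV and A="range mon" and B=B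
      and c="\<lambda>a. v $ inv mon a"])
    show "infinite (B i)" for i using r by (simp add: B_def infinite_Icc)
    show "(\<Sum>a\<in>range mon. v $ inv mon a * (\<Prod>i\<in>UNIV. x i ^ a i)) = 0"
      if x: "\<And>i. i \<in> UNIV \<Longrightarrow> x i \<in> B i" for x
    proof -
      have "norm ((\<chi> i. x i) - x0) \<le> (\<Sum>i\<in>UNIV. \<bar>x i - x0 $ i\<bar>)"
        using norm_le_l1_cart[of "(\<chi> i. x i) - x0"] by simp
      also have "\<dots> \<le> (\<Sum>i\<in>(UNIV::'n set). r)"
        using x by (intro sum_mono) (auto simp: B_def abs_le_iff algebra_simps)
      also have "\<dots> < e" using e by (simp add: r_def)
      finally have "(\<chi> i. x i) \<in> U"
        using e by (auto simp: subset_eq dist_norm norm_minus_commute)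
      then have "v \<bullet> features mon (\<chi> i. x i) = 0" by (rule zero)
      then show ?thesis
        using \<open>inj mon\<close> by (simp add: sum.reindex inner_vec_def features_def)
    qed
  qed (use that in auto)
  then have "v $ inv mon (mon k) = 0" for k by blast
  then show ?thesis using \<open>inj mon\<close> by (simp add: vec_eq_iff)
qed

lemma continuous_on_features [continuous_intros]:
  assumes "continuous_on S f"
  shows "continuous_on S (\<lambda>x. features mon (f x))"
  unfolding features_def
  by (intro continuous_on_vec_lambda continuous_intros assms)

lemma differentiable_features:
  fixes x :: "real ^ 'n::finite" and mon :: "'m::finite \<Rightarrow> 'n \<Rightarrow> nat"
  shows "features mon differentiable (at x)"
proof -
  have "(\<lambda>x::real^'n. \<Prod>i\<in>UNIV. (x $ i) ^ mon k i) differentiable (at x)" for k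
  proof -
    have "(\<lambda>x::real^'n. (x $ i) ^ m) differentiable (at x)" for i m
      by (intro differentiable_power bounded_linear_imp_differentiable bounded_linear_vec_nth)
    then have "\<And>i. \<exists>D. ((\<lambda>x::real^'n. (x $ i) ^ mon k i) has_derivative D) (at x)"
      by (simp add: differentiable_def)
    then obtain D where "\<And>i. ((\<lambda>x::real^'n. (x $ i) ^ mon k i) has_derivative D i) (at x)"
      by metis
    from has_derivative_prod[of UNIV "\<lambda>i x. (x $ i) ^ mon k i" D x UNIV, OF this]
    show ?thesis unfolding differentiable_def by blast
  qed
  then show ?thesis
    unfolding features_def[abs_def]
    by (subst differentiable_componentwise_within)
       (auto simp: Basis_vec_def inner_axis)
qed

section \<open>The equilibrium map\<close>

lemma deviate_nth [simp]: "deviate x i s $ j = (if j = i then s else x $ j)"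
  by (simp add: deviate_def)

lemma deviate_self [simp]: "deviate x i (x $ i) = x"
  by (simp add: vec_eq_iff)

lemma deviate_in_action_profiles:
  "x \<in> action_profiles Xs \<Longrightarrow> s \<in> Xs i \<Longrightarrow> deviate x i s \<in> action_profiles Xs"
  by (simp add: action_profiles_def)

lemma closed_action_profiles:
  fixes Xs :: "'n::finite \<Rightarrow> real set"
  assumes "\<And>i. closed (Xs i)"
  shows "closed (action_profiles Xs)"
proof -
  have "action_profiles Xs = (\<Inter>i. (\<lambda>x. x $ i) -` Xs i)"
    by (auto simp: action_profiles_def)
  moreover have "closed ((\<lambda>x::real^'n. x $ i) -` Xs i)" for i
    by (intro continuous_closed_vimage assms continuous_component continuous_ident)
  ultimately show ?thesis by auto
qed

lemma bounded_action_profiles: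
  fixes Xs :: "'n::finite \<Rightarrow> real set"
  assumes "\<And>i. bounded (Xs i)"
  shows "bounded (action_profiles Xs)"
proof -
  have "\<exists>b. \<forall>s\<in>Xs i. \<bar>s\<bar> \<le> b" for i
    using assms[of i] by (auto simp: bounded_iff)
  then obtain b where b: "\<And>i s. s \<in> Xs i \<Longrightarrow> \<bar>s\<bar> \<le> b i" by metis
  have "norm x \<le> (\<Sum>i\<in>UNIV. b i)" if "x \<in> action_profiles Xs" for x
    using that b by (intro order_trans[OF norm_le_l1_cart] sum_mono)
      (auto simp: action_profiles_def)
  then show ?thesis by (auto simp: bounded_iff)
qed

lemma convex_action_profiles:
  assumes "\<And>i. convex (Xs i)"
  shows "convex (action_profiles Xs)"
  using assms by (auto simp: action_profiles_def convex_def)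

lemma quadratic_form_sym_part: "h \<bullet> (sym_part A *v h) = h \<bullet> (A *v h)"
proof -
  have "h \<bullet> (transpose A *v h) = h \<bullet> (A *v h)"
    by (simp add: dot_lmul_matrix[symmetric] inner_commute)
  moreover have "sym_part A *v h = (1 / 2) *\<^sub>R (A *v h + transpose A *v h)"
    by (simp add: sym_part_def scaleR_matrix_vector_assoc[symmetric] matrix_vector_mult_add_rdistrib)
  ultimately show ?thesis by (simp add: inner_add_right)
qed

locale polynomial_game =
  fixes Xs :: "'n::finite \<Rightarrow> real set"
    and l :: "'n \<Rightarrow> real ^ 'n \<Rightarrow> real"
    and mon :: "'m::finite \<Rightarrow> 'n \<Rightarrow> nat"
    and Th :: "real ^ 'm ^ 'n"
    and xd ud :: "real ^ 'n"
  assumes compact_actions: "\<And>i. compact (Xs i)"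
    and convex_actions: "\<And>i. convex (Xs i)"
    and marginal_costs: "has_marginal_costs Xs l mon Th"
    and types: "type_assumption (action_profiles Xs) mon Th"
    and target_interior: "xd \<in> interior (action_profiles Xs)"
begin

abbreviation X :: "(real ^ 'n) set" where "X \<equiv> action_profiles Xs"

abbreviation F :: "real ^ 'n \<Rightarrow> real ^ 'n" where "F x \<equiv> Th *v features mon x"

abbreviation xs :: "real ^ 'n \<Rightarrow> real ^ 'n" where "xs \<equiv> nash_response Xs l xd ud"

lemma compact_X: "compact X"
  using compact_actions closed_action_profiles[of Xs] bounded_action_profiles[of Xs]
  unfolding compact_eq_bounded_closed by blast

lemma convex_X: "convex X"
  using convex_actions by (rule convex_action_profiles)

lemma target_in_X: "xd \<in> X"
  using target_interior interior_subset by blast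

lemma continuous_on_F: "continuous_on S F"
  by (intro continuous_intros linear_continuous_on_compose[of S "features mon" "(*v) Th"]) auto

text \<open>The derivative of \<open>(x - y) \<bullet> R F\<close> along the segment from \<open>y\<close> to \<open>x\<close> is the quadratic form of
  the type assumption, so the mean value theorem applies. The positive weights \<open>r\<close> are the diagonal of \<open>R\<close>;
  because equilibrium conditions hold for each agent separately, they can be
  multiplied by these weights.\<close>

lemma weighted_strong_monotonicity:
  obtains m r where "0 < m" "\<And>i. 0 < r i"
    "\<And>x y. x \<in> X \<Longrightarrow> y \<in> X \<Longrightarrow>
       m * (norm (x - y))\<^sup>2 \<le> (\<Sum>i\<in>UNIV. r i * ((F x - F y) $ i * (x - y) $ i))"
proof -
  from types obtain m R where m: "0 < m" and R: "is_diagonal R" "\<And>i. 0 < R $ i $ i"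
    and J: "\<And>x. x \<in> X \<Longrightarrow>
      loewner_ge (sym_part (R ** Th ** jacobian (features mon) (at x))) ((m / 2) *\<^sub>R mat 1)"
    unfolding type_assumption_def by blast
  let ?J = "\<lambda>x. jacobian (features mon) (at x)"
  have Rv: "(R *v u) $ i = R $ i $ i * u $ i" for u i
  proof -
    have "(R *v u) $ i = (\<Sum>j\<in>UNIV. if j = i then R $ i $ i * u $ i else 0)"
      using R(1) unfolding matrix_vector_mult_def is_diagonal_def vec_lambda_beta
      by (intro sum.cong) auto
    then show ?thesis by simp
  qed
  have key: "m / 2 * (norm (x - y))\<^sup>2 \<le> (\<Sum>i\<in>UNIV. R $ i $ i * ((F x - F y) $ i * (x - y) $ i))"
    if x: "x \<in> X" and y: "y \<in> X" for x y
  proof -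
    define h where "h = x - y"
    define \<psi> where "\<psi> s = h \<bullet> ((R ** Th) *v features mon (y + s *\<^sub>R h))" for s
    define D where "D s = h \<bullet> ((R ** Th ** ?J (y + s *\<^sub>R h)) *v h)" for s
    have der: "(\<psi> has_real_derivative D s) (at s)" for s
    proof -
      have "(features mon has_derivative (\<lambda>h. ?J z *v h)) (at z)" for z
        using differentiable_features jacobian_works by blast
      then have "((\<lambda>s. features mon (y + s *\<^sub>R h)) has_derivative
          (\<lambda>t. ?J (y + s *\<^sub>R h) *v (t *\<^sub>R h))) (at s)"
        by (rule has_derivative_compose[rotated]) (auto intro!: derivative_eq_intros)
      then have "((\<lambda>s. (R ** Th) *v features mon (y + s *\<^sub>R h)) has_derivative
          (\<lambda>t. (R ** Th) *v (?J (y + s *\<^sub>R h) *v (t *\<^sub>R h)))) (at s)"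
        by (rule bounded_linear.has_derivative[OF matrix_vector_mul_bounded_linear])
      then have "(\<psi> has_derivative
          (\<lambda>t. h \<bullet> ((R ** Th) *v (?J (y + s *\<^sub>R h) *v (t *\<^sub>R h))))) (at s)"
        unfolding \<psi>_def by (rule bounded_linear.has_derivative[OF bounded_linear_inner_right])
      moreover have "h \<bullet> ((R ** Th) *v (?J (y + s *\<^sub>R h) *v (t *\<^sub>R h))) = D s * t" for t
        by (simp add: D_def matrix_vector_mul_assoc matrix_vector_mult_scaleR)
      ultimately show ?thesis by (simp add: has_field_derivative_def mult_commute_abs)
    qed
    obtain z where z: "0 < z" "z < 1" "\<psi> 1 - \<psi> 0 = (1 - 0) * D z"
      using MVT2[of 0 1 \<psi> D] der by auto
    have "y + z *\<^sub>R h = (1 - z) *\<^sub>R y + z *\<^sub>R x" by (simp add: h_def algebra_simps)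
    then have "y + z *\<^sub>R h \<in> X"
      using convexD[OF convex_X y x, of "1 - z" z] z by simp
    from J[OF this] have "0 \<le> h \<bullet> ((sym_part (R ** Th ** ?J (y + z *\<^sub>R h)) - (m / 2) *\<^sub>R mat 1) *v h)"
      by (auto simp: loewner_ge_def psd_def)
    then have "m / 2 * (h \<bullet> h) \<le> D z"
      by (simp add: D_def matrix_vector_mult_diff_rdistrib inner_diff_right
          quadratic_form_sym_part scaleR_matrix_vector_assoc[symmetric])
    moreover have "\<psi> 1 - \<psi> 0 = h \<bullet> (R *v (F x - F y))"
      by (simp add: \<psi>_def h_def matrix_vector_mul_assoc[symmetric] inner_diff_right
          matrix_vector_mult_diff_distrib)
    moreover have "h \<bullet> (R *v (F x - F y)) = (\<Sum>i\<in>UNIV. R $ i $ i * ((F x - F y) $ i * h $ i))"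
      by (simp add: inner_vec_def Rv mult_ac)
    ultimately show ?thesis using z by (simp add: h_def power2_norm_eq_inner)
  qed
  show ?thesis by (rule that[of "m / 2" "\<lambda>i. R $ i $ i"]) (use m R key in auto)
qed

text \<open>The first-order conditions of all agents, as a variational inequality on the product of the action
  intervals.\<close>

definition vi :: "real ^ 'n \<Rightarrow> real ^ 'n \<Rightarrow> bool" where
  "vi p x \<longleftrightarrow> x \<in> X \<and> (\<forall>i. \<forall>s\<in>Xs i. 0 \<le> (F x $ i + p $ i) * (s - x $ i))"

lemma marginal_increasing:
  assumes x: "x \<in> X" and s: "s \<in> Xs i"
  shows "0 \<le> (F (deviate x i s) $ i - F x $ i) * (s - x $ i)"
proof -
  obtain m r where m: "0 < m" and r: "\<And>i. 0 < r i"
    and mono: "\<And>x y. x \<in> X \<Longrightarrow> y \<in> X \<Longrightarrow>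
       m * (norm (x - y))\<^sup>2 \<le> (\<Sum>i\<in>UNIV. r i * ((F x - F y) $ i * (x - y) $ i))"
    by (rule weighted_strong_monotonicity) (rule that)
  let ?y = "deviate x i s"
  have "0 \<le> m * (norm (?y - x))\<^sup>2" using m by simp
  also have "\<dots> \<le> (\<Sum>j\<in>UNIV. r j * ((F ?y - F x) $ j * (?y - x) $ j))"
    using mono[OF deviate_in_action_profiles[OF x s] x] .
  also have "\<dots> = (\<Sum>j\<in>UNIV. if j = i then r i * ((F ?y $ i - F x $ i) * (s - x $ i)) else 0)"
    by (intro sum.cong) auto
  also have "\<dots> = r i * ((F ?y $ i - F x $ i) * (s - x $ i))" by simp
  finally show ?thesis using r[of i] by (simp add: zero_le_mult_iff)
qed

lemma cost_has_derivative:
  assumes x: "x \<in> X" and z: "z \<in> Xs i"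
  shows "((\<lambda>s. l i (deviate x i s) + incentive xd ud (deviate x i s) p $ i)
      has_real_derivative (F (deviate x i z) $ i + p $ i)) (at z within Xs i)"
proof -
  have "deviate (deviate x i z) i s = deviate x i s" for s by (simp add: vec_eq_iff)
  moreover have "((\<lambda>s. l i (deviate (deviate x i z) i s)) has_real_derivative
      (Th $ i \<bullet> features mon (deviate x i z))) (at (deviate x i z $ i) within Xs i)"
    using marginal_costs deviate_in_action_profiles[OF x z]
    unfolding has_marginal_costs_def by blast
  ultimately have "((\<lambda>s. l i (deviate x i s)) has_real_derivative F (deviate x i z) $ i)
      (at z within Xs i)"
    by (simp add: matrix_vector_mul_component)
  then show ?thesis
    by (auto simp: incentive_def intro!: derivative_eq_intros)
qed

text \<open>The incentive is affine in the own action with slope \<open>p i\<close>, and the own marginal cost increases in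
  the own action, so each agent faces a convex problem, for which the first-order
  condition is necessary and sufficient.\<close>

lemma nash_iff_vi:
  "nash_equilibrium Xs (\<lambda>i y. l i y + incentive xd ud y p $ i) x \<longleftrightarrow> vi p x"
proof (cases "x \<in> X")
  case x: True
  define c where "c i s = l i (deviate x i s) + incentive xd ud (deviate x i s) p $ i" for i s
  have der: "(c i has_real_derivative (F (deviate x i z) $ i + p $ i)) (at z within Xs i)"
    if "z \<in> Xs i" for i z
    using cost_has_derivative[OF x that] unfolding c_def .
  have xi: "x $ i \<in> Xs i" for i using x by (simp add: action_profiles_def)
  have seg: "closed_segment a b \<subseteq> Xs i" if "a \<in> Xs i" "b \<in> Xs i" for a b i
    using convex_actions that convex_contains_segment by blast
  have "(\<forall>s\<in>Xs i. c i (x $ i) \<le> c i s) \<longleftrightarrow> (\<forall>s\<in>Xs i. 0 \<le> (F x $ i + p $ i) * (s - x $ i))" for i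
  proof safe
    fix s assume min: "\<forall>s\<in>Xs i. c i (x $ i) \<le> c i s" and s: "s \<in> Xs i"
    show "0 \<le> (F x $ i + p $ i) * (s - x $ i)"
    proof (rule ccontr)
      assume neg: "\<not> ?thesis"
      \<comment> \<open>a one-sided derivative, since \<open>x i\<close> may be an end point of the action interval\<close>
      define \<phi> where "\<phi> t = c i (x $ i + t * (s - x $ i))" for t
      have inX: "x $ i + t * (s - x $ i) \<in> Xs i" if "t \<in> {0..1}" for t
      proof -
        have "x $ i + t * (s - x $ i) = (1 - t) *\<^sub>R x $ i + t *\<^sub>R s" by (simp add: algebra_simps)
        then show ?thesis
          using convexD[OF convex_actions xi s, of "1 - t" t] that by simp
      qed
      have "(c i has_real_derivative (F x $ i + p $ i)) (at (x $ i) within Xs i)"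
        using der[OF xi, of i] by simp
      then have 1: "(c i has_real_derivative (F x $ i + p $ i))
          (at (x $ i + 0 * (s - x $ i)) within (\<lambda>t. x $ i + t * (s - x $ i)) ` {0..1})"
        using DERIV_subset[of _ _ _ _ "(\<lambda>t. x $ i + t * (s - x $ i)) ` {0..1}"] inX
        by (simp add: image_subset_iff)
      have "(\<phi> has_real_derivative (F x $ i + p $ i) * (s - x $ i)) (at 0 within {0..1})"
      proof -
        have 2: "((\<lambda>t. x $ i + t * (s - x $ i)) has_real_derivative s - x $ i) (at 0 within {0..1})"
          by (auto intro!: derivative_eq_intros)
        show ?thesis
          using DERIV_image_chain[OF 1 2] by (simp add: \<phi>_def[abs_def] o_def)
      qed
      with neg obtain d where "d > 0"
        and d: "\<And>h. h > 0 \<Longrightarrow> 0 + h \<in> {0..1} \<Longrightarrow> h < d \<Longrightarrow> \<phi> 0 > \<phi> (0 + h)"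
        using has_real_derivative_neg_dec_right[of \<phi> _ 0 "{0..1}"] by force
      define h where "h = min 1 (d / 2)"
      have "\<phi> h < \<phi> 0" using d[of h] \<open>d > 0\<close> by (auto simp: h_def)
      moreover have "c i (x $ i) \<le> \<phi> h"
        unfolding \<phi>_def using min inX[of h] \<open>d > 0\<close> by (auto simp: h_def)
      ultimately show False by (simp add: \<phi>_def)
    qed
  next
    fix s assume vi: "\<forall>s\<in>Xs i. 0 \<le> (F x $ i + p $ i) * (s - x $ i)" and s: "s \<in> Xs i"
    have der_seg: "(c i has_real_derivative (F (deviate x i z) $ i + p $ i))
        (at z within closed_segment (x $ i) s)" if "z \<in> closed_segment (x $ i) s" for z
      using der seg[OF xi s] that by (intro DERIV_subset[OF der]) auto
    have grow: "0 \<le> (F (deviate x i z) $ i + p $ i) * (s - x $ i)"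
      if z: "z \<in> closed_segment (x $ i) s" "z \<noteq> x $ i" for z
    proof -
      from z obtain u where u: "0 < u" "u \<le> 1" and zu: "z = (1 - u) *\<^sub>R x $ i + u *\<^sub>R s"
        unfolding in_segment by (metis add.right_neutral diff_zero le_less scaleR_one scaleR_zero_left)
      have "z \<in> Xs i" using z seg[OF xi s] by blast
      from marginal_increasing[OF x this]
      have "0 \<le> u * ((F (deviate x i z) $ i - F x $ i) * (s - x $ i))"
        by (simp add: zu algebra_simps)
      then have "0 \<le> (F (deviate x i z) $ i - F x $ i) * (s - x $ i)"
        using u by (simp add: zero_le_mult_iff)
      moreover have "0 \<le> (F x $ i + p $ i) * (s - x $ i)" using vi s by blast
      ultimately show ?thesis by (simp add: algebra_simps)
    qed
    show "c i (x $ i) \<le> c i s"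
    proof (cases "s = x $ i")
      case False
      define a b where "a = min (x $ i) s" and "b = max (x $ i) s"
      have ab: "a < b" and segab: "closed_segment (x $ i) s = {a..b}"
        using False by (auto simp: a_def b_def closed_segment_eq_real_ivl)
      obtain z where z: "a < z" "z < b"
        "c i b - c i a = (b - a) * (F (deviate x i z) $ i + p $ i)"
      proof -
        have "\<exists>z\<in>{a<..<b}. c i b - c i a = (F (deviate x i z) $ i + p $ i) * (b - a)"
          using der_seg unfolding segab
          by (intro mvt_simple[OF ab, of "c i" "\<lambda>z t. (F (deviate x i z) $ i + p $ i) * t"])
             (auto simp: has_field_derivative_def)
        then show ?thesis using that by (auto simp: mult.commute)
      qed
      have "0 \<le> (F (deviate x i z) $ i + p $ i) * (s - x $ i)"
        using z segab by (intro grow) (auto simp: a_def b_def split: if_splits simp: min_def max_def)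
      then show ?thesis using z
        by (cases "s < x $ i") (auto simp: a_def b_def min_def max_def algebra_simps)
    qed simp
  qed
  then show ?thesis using x
    by (simp add: nash_equilibrium_def vi_def c_def)
qed (simp add: nash_equilibrium_def vi_def)

text \<open>A solution is a fixed point of the projected step \<open>x \<mapsto> \<pi>(x - (F x + p))\<close>, and the Brouwer fixed
  point theorem provides one.\<close>

lemma vi_exists: "\<exists>x. vi p x"
proof -
  have cl: "closed X" using compact_X compact_imp_closed by blast
  have ne: "X \<noteq> {}" using target_in_X by blast
  let ?f = "\<lambda>x. closest_point X (x - (F x + p))"
  have "continuous_on X ?f"
    by (rule continuous_on_compose2[OF continuous_on_closest_point[OF convex_X cl ne, of UNIV]])
       (auto intro!: continuous_intros continuous_on_F)
  moreover have "?f \<in> X \<rightarrow> X" using closest_point_in_set[OF cl ne] by auto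
  ultimately obtain x where x: "x \<in> X" "?f x = x"
    by (rule brouwer[OF compact_X convex_X ne])
  have ineq: "0 \<le> (F x + p) \<bullet> (y - x)" if "y \<in> X" for y
    using closest_point_dot[OF convex_X cl that, of "x - (F x + p)"] x(2)
    by (simp add: inner_diff_left inner_add_left)
  have "0 \<le> (F x $ i + p $ i) * (s - x $ i)" if s: "s \<in> Xs i" for i s
  proof -
    have "(F x + p) \<bullet> (deviate x i s - x)
        = (\<Sum>j\<in>UNIV. if j = i then (F x $ i + p $ i) * (s - x $ i) else 0)"
      unfolding inner_vec_def by (intro sum.cong) auto
    then show ?thesis using ineq[OF deviate_in_action_profiles[OF x(1) s]] by simp
  qed
  then show ?thesis using x by (auto simp: vi_def)
qed

text \<open>Testing each of the two inequalities with the other solution and adding the weighted results bounds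
  the strong monotonicity term by the difference of the parameters. The case \<open>p = q\<close> is uniqueness.\<close>

lemma vi_lipschitz: "\<exists>K\<ge>0. \<forall>p q x y. vi p x \<longrightarrow> vi q y \<longrightarrow> norm (x - y) \<le> K * norm (p - q)"
proof -
  obtain m r where m: "0 < m" and r: "\<And>i. 0 < r i"
    and mono: "\<And>x y. x \<in> X \<Longrightarrow> y \<in> X \<Longrightarrow>
       m * (norm (x - y))\<^sup>2 \<le> (\<Sum>i\<in>UNIV. r i * ((F x - F y) $ i * (x - y) $ i))"
    by (rule weighted_strong_monotonicity) (rule that)
  have "norm (x - y) \<le> (\<Sum>i\<in>UNIV. r i) / m * norm (p - q)" if x: "vi p x" and y: "vi q y" for p q x y
  proof (cases "x = y")
    case False
    have *: "(F x - F y) $ i * (x - y) $ i \<le> norm (p - q) * norm (x - y)" for i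
    proof -
      have "0 \<le> (F x $ i + p $ i) * (y $ i - x $ i)" "0 \<le> (F y $ i + q $ i) * (x $ i - y $ i)"
        using x y by (auto simp: vi_def action_profiles_def)
      then have "(F x - F y) $ i * (x - y) $ i \<le> (p - q) $ i * (y - x) $ i"
        by (simp add: algebra_simps)
      also have "\<dots> \<le> \<bar>(p - q) $ i\<bar> * \<bar>(y - x) $ i\<bar>"
        by (metis abs_ge_self abs_mult)
      also have "\<dots> \<le> norm (p - q) * norm (y - x)"
        by (intro mult_mono component_le_norm_cart) auto
      finally show ?thesis by (simp add: norm_minus_commute)
    qed
    have "m * (norm (x - y))\<^sup>2 \<le> (\<Sum>i\<in>UNIV. r i * ((F x - F y) $ i * (x - y) $ i))"
      using x y by (intro mono) (auto simp: vi_def)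
    also have "\<dots> \<le> (\<Sum>i\<in>UNIV. r i * (norm (p - q) * norm (x - y)))"
      using r * by (intro sum_mono mult_left_mono) (auto simp: less_imp_le)
    also have "\<dots> = (\<Sum>i\<in>UNIV. r i) * norm (p - q) * norm (x - y)"
      by (simp add: sum_distrib_right mult.assoc)
    finally have "m * norm (x - y) \<le> (\<Sum>i\<in>UNIV. r i) * norm (p - q)"
      using False by (simp add: power2_eq_square)
    then show ?thesis using m by (simp add: field_simps)
  qed (use m r in \<open>simp add: less_imp_le sum_nonneg\<close>)
  moreover have "0 \<le> (\<Sum>i\<in>UNIV. r i) / m" using m r by (simp add: less_imp_le sum_nonneg)
  ultimately show ?thesis by blast
qed

lemma vi_unique: "vi p x \<Longrightarrow> vi p y \<Longrightarrow> x = y"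
  using vi_lipschitz by fastforce

lemma vi_xs: "vi p (xs p)"
  unfolding nash_response_def nash_iff_vi
  using vi_exists[of p] vi_unique by (auto intro: theI2)

lemma xs_in_X: "xs p \<in> X"
  using vi_xs by (simp add: vi_def)

lemma xs_lipschitz: "\<exists>K\<ge>0. \<forall>p q. norm (xs p - xs q) \<le> K * norm (p - q)"
  using vi_lipschitz vi_xs by meson

lemma continuous_on_xs: "continuous_on S xs"
proof -
  obtain K where "K \<ge> 0" "\<And>p q. norm (xs p - xs q) \<le> K * norm (p - q)"
    using xs_lipschitz by blast
  then have "K-lipschitz_on S xs" by (intro lipschitz_onI) (auto simp: dist_norm)
  then show ?thesis by (rule lipschitz_on_continuous_on)
qed

text \<open>Every action profile is an equilibrium response, namely to the parameter that cancels all marginal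
  costs there.\<close>

lemma xs_implementation: "x \<in> X \<Longrightarrow> xs (- F x) = x"
  using vi_unique[OF vi_xs] by (auto simp: vi_def)

text \<open>The regression equation behind the estimator: at an interior response both signs of a
  deviation are feasible, so the marginal costs cancel.\<close>

lemma interior_response:
  assumes "xs p \<in> interior X"
  shows "p = - F (xs p)"
proof -
  let ?x = "xs p"
  obtain \<epsilon> where e: "\<epsilon> > 0" "cball ?x \<epsilon> \<subseteq> X"
    using assms mem_interior_cball by blast
  have "F ?x $ i + p $ i = 0" for i
  proof -
    have mem: "?x $ i + s \<in> Xs i" if "\<bar>s\<bar> \<le> \<epsilon>" for s
    proof -
      have "norm (axis i s :: real ^ 'n) \<le> \<epsilon>"
        using that norm_le_l1_cart[of "axis i s :: real ^ 'n"]
        by (simp add: axis_def if_distrib[of abs] cong: if_cong)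
      then have "?x + axis i s \<in> X" using e(2) by (auto simp: dist_norm)
      then show ?thesis by (auto simp: action_profiles_def dest: spec[of _ i])
    qed
    have "0 \<le> (F ?x $ i + p $ i) * s" if "\<bar>s\<bar> \<le> \<epsilon>" for s
      using vi_xs[of p] mem[OF that] by (auto simp: vi_def dest!: spec[of _ i])
    from this[of \<epsilon>] this[of "-\<epsilon>"] show ?thesis
      using e by (simp add: mult_le_0_iff zero_le_mult_iff)
  qed
  then show ?thesis by (simp add: vec_eq_iff eq_neg_iff_add_eq_0 add.commute)
qed

end

section \<open>Recursive least squares\<close>

lemma outer_mult_vec: "outer a b *v x = (b \<bullet> x) *\<^sub>R a"
  by (simp add: vec_eq_iff outer_def matrix_vector_mult_def inner_vec_def
      sum_distrib_left sum_distrib_right mult_ac)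

lemma transpose_outer: "transpose (outer a b) = outer b a"
  by (simp add: vec_eq_iff outer_def transpose_def mult.commute)

lemma outer_zero [simp]: "outer 0 a = 0" "outer a 0 = 0"
  by (simp_all add: outer_def vec_eq_iff)

lemma symmetric_vec_mult:
  fixes A :: "real ^ 'm::finite ^ 'm"
  shows "transpose A = A \<Longrightarrow> x v* A = A *v x"
  using transpose_matrix_vector[of A x] by simp

lemma symmetric_matrix_inner:
  fixes A :: "real ^ 'm::finite ^ 'm"
  shows "transpose A = A \<Longrightarrow> (A *v x) \<bullet> y = x \<bullet> (A *v y)"
  unfolding dot_lmul_matrix[symmetric] by (simp only: symmetric_vec_mult)

lemma left_inverse_mult_vec:
  fixes A B :: "real ^ 'm::finite ^ 'm"
  assumes "A ** B = mat 1"
  shows "A *v (B *v x) = x" "B *v (A *v x) = x"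
  using assms matrix_left_right_inverse[of A B] by (simp_all add: matrix_vector_mul_assoc)

text \<open>The recursion that the estimation error obeys when the observation is the regression equation for
  the regressor \<open>h\<close> with noise \<open>\<epsilon>\<close>. For \<open>h = 0\<close> it leaves the error unchanged,
  as \<open>S_update\<close> leaves the gain unchanged. Setting the regressor to zero thus describes
  both a response on the boundary and a round without exploration.\<close>

definition rls_error :: "real ^ 'm \<Rightarrow> real ^ 'm ^ 'm \<Rightarrow> real ^ 'n \<Rightarrow> real ^ 'm ^ 'n \<Rightarrow> real ^ 'm ^ 'n" where
  "rls_error h S \<epsilon> E = E - (1 / (1 + h \<bullet> (S *v h))) *\<^sub>R outer (\<epsilon> + E *v h) (h v* S)"

lemma S_update_gating:
  assumes "\<delta> = 0 \<or> \<delta> = 1"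
  shows "S_update \<delta> \<xi> S = S_update 1 (\<delta> *\<^sub>R \<xi>) S"
  using assms by (auto simp: S_update_def)

lemma Theta_update_gating:
  assumes "\<delta> = 0 \<or> \<delta> = 1" and "\<delta> = 1 \<Longrightarrow> ph + Th *v \<xi> = \<epsilon>"
  shows "Theta_update \<delta> \<xi> S ph T - Th = rls_error (\<delta> *\<^sub>R \<xi>) S \<epsilon> (T - Th)"
proof -
  have "ph + T *v \<xi> = \<epsilon> + (T - Th) *v \<xi>" if "\<delta> = 1"
    using assms(2)[OF that] by (simp add: matrix_vector_mult_diff_rdistrib algebra_simps)
  then show ?thesis
    using assms(1) by (auto simp: Theta_update_def rls_error_def)
qed

text \<open>The Sherman--Morrison formula: updating the gain is adding \<open>h h\<^sup>T\<close> to its inverse \<open>P\<close>. In the variable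
  \<open>E P\<close> the error recursion becomes a plain sum. Positivity of \<open>P\<close> keeps the
  denominator \<open>1 + h\<^sup>T S h\<close> away from zero.\<close>

lemma rls_step:
  fixes S P :: "real ^ 'm::finite ^ 'm" and E :: "real ^ 'm ^ 'n::finite"
  assumes inv: "P ** S = mat 1" and sym: "transpose S = S" and psd: "\<And>v. 0 \<le> v \<bullet> (P *v v)"
  shows "(P + outer h h) ** S_update 1 h S = mat 1"
    and "transpose (S_update 1 h S) = S_update 1 h S"
    and "\<And>v. 0 \<le> v \<bullet> ((P + outer h h) *v v)"
    and "rls_error h S \<epsilon> E ** (P + outer h h) = E ** P - outer \<epsilon> h"
proof -
  define q where "q = h \<bullet> (S *v h)"
  have PS: "P *v (S *v x) = x" for x
    using left_inverse_mult_vec(1)[OF inv] .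
  have SP: "S *v (P *v x) = x" for x
    using left_inverse_mult_vec(2)[OF inv] .
  have q: "0 \<le> q" using psd[of "S *v h"] by (simp add: PS q_def inner_commute)
  have hS: "h v* S = S *v h" by (rule symmetric_vec_mult[OF sym])
  have S': "S_update 1 h S = S - (1 / (1 + q)) *\<^sub>R outer (S *v h) (S *v h)"
    by (simp add: S_update_def q_def hS)
  have "(P + outer h h) *v (S_update 1 h S *v x) = x" for x
  proof -
    define y where "y = h \<bullet> (S *v x)"
    have "S_update 1 h S *v x = S *v x - (y / (1 + q)) *\<^sub>R (S *v h)"
      by (simp add: S' matrix_vector_mult_diff_rdistrib scaleR_matrix_vector_assoc[symmetric]
          outer_mult_vec symmetric_matrix_inner[OF sym] y_def)
    moreover have "P *v (S *v x - (y / (1 + q)) *\<^sub>R (S *v h)) = x - (y / (1 + q)) *\<^sub>R h"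
      by (simp add: matrix_vector_mult_diff_distrib matrix_vector_mult_scaleR PS)
    moreover have "h \<bullet> (S *v x - (y / (1 + q)) *\<^sub>R (S *v h)) = y / (1 + q)"
      using q by (simp add: inner_diff_right y_def[symmetric] q_def[symmetric] field_simps)
    ultimately show ?thesis
      by (simp add: matrix_vector_mult_add_rdistrib outer_mult_vec)
  qed
  then show "(P + outer h h) ** S_update 1 h S = mat 1"
    by (simp add: matrix_eq matrix_vector_mul_assoc[symmetric])
  have "transpose (A - c *\<^sub>R B) = transpose A - c *\<^sub>R transpose B" for A B :: "real ^ 'm ^ 'm" and c
    by (simp add: vec_eq_iff transpose_def)
  then show "transpose (S_update 1 h S) = S_update 1 h S"
    by (simp add: S' transpose_outer sym)
  show "0 \<le> v \<bullet> ((P + outer h h) *v v)" for v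
    using psd[of v] by (simp add: matrix_vector_mult_add_rdistrib outer_mult_vec inner_add_right
        inner_commute)
  have "rls_error h S \<epsilon> E *v ((P + outer h h) *v x) = (E ** P - outer \<epsilon> h) *v x" for x
  proof -
    define z where "z = h \<bullet> x"
    have Px: "(P + outer h h) *v x = P *v x + z *\<^sub>R h"
      by (simp add: matrix_vector_mult_add_rdistrib outer_mult_vec z_def)
    have "(S *v h) \<bullet> (P *v x + z *\<^sub>R h) = h \<bullet> (S *v (P *v x + z *\<^sub>R h))"
      by (rule symmetric_matrix_inner[OF sym])
    also have "\<dots> = (1 + q) * z"
      by (simp add: matrix_vector_right_distrib SP matrix_vector_mult_scaleR inner_add_right
          q_def z_def algebra_simps)
    finally have "rls_error h S \<epsilon> E *v (P *v x + z *\<^sub>R h)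
        = E *v (P *v x + z *\<^sub>R h) - z *\<^sub>R (\<epsilon> + E *v h)"
      using q by (simp add: rls_error_def matrix_vector_mult_diff_rdistrib
          scaleR_matrix_vector_assoc[symmetric] outer_mult_vec hS q_def[symmetric])
    then show ?thesis
      by (simp add: Px matrix_vector_mult_diff_rdistrib outer_mult_vec z_def matrix_vector_mul_assoc
          matrix_vector_right_distrib matrix_vector_mult_scaleR algebra_simps)
  qed
  then show "rls_error h S \<epsilon> E ** (P + outer h h) = E ** P - outer \<epsilon> h"
    by (simp add: matrix_eq matrix_vector_mul_assoc[symmetric])
qed

lemma sym_pos_def_inverse:
  fixes S :: "real ^ 'm::finite ^ 'm"
  assumes "sym_pos_def S"
  obtains P where "P ** S = mat 1" "\<And>v. 0 \<le> v \<bullet> (P *v v)"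
proof -
  have "x = 0" if "S *v x = 0" for x
  proof (rule ccontr)
    assume "x \<noteq> 0"
    then have "0 < x \<bullet> (S *v x)" using assms unfolding sym_pos_def_def by blast
    with that show False by simp
  qed
  then have "\<exists>P. P ** S = mat 1" unfolding matrix_left_invertible_ker by auto
  then obtain P where P: "P ** S = mat 1" ..
  have "0 \<le> v \<bullet> (P *v v)" for v
  proof -
    have "v = S *v (P *v v)" using left_inverse_mult_vec(2)[OF P] by simp
    moreover have "0 \<le> u \<bullet> (S *v u)" for u
      using assms by (cases "u = 0") (auto simp: sym_pos_def_def less_imp_le)
    ultimately show ?thesis using inner_commute[of v "P *v v"] by metis
  qed
  then show ?thesis by (rule that[OF P])
qed

locale rls =
  fixes S :: "nat \<Rightarrow> real ^ 'm::finite ^ 'm" and E :: "nat \<Rightarrow> real ^ 'm ^ 'n::finite"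
    and h :: "nat \<Rightarrow> real ^ 'm" and \<epsilon> :: "nat \<Rightarrow> real ^ 'n" and P1 :: "real ^ 'm ^ 'm"
  assumes S_step: "\<And>t. 2 \<le> t \<Longrightarrow> S t = S_update 1 (h t) (S (t - 1))"
    and E_step: "\<And>t. 2 \<le> t \<Longrightarrow> E t = rls_error (h t) (S (t - 1)) (\<epsilon> t) (E (t - 1))"
    and init_inverse: "P1 ** S 1 = mat 1"
    and init_sym: "transpose (S 1) = S 1"
    and init_psd: "\<And>v. 0 \<le> v \<bullet> (P1 *v v)"
begin

definition P :: "nat \<Rightarrow> real ^ 'm ^ 'm" where
  "P t = P1 + (\<Sum>s=2..t. outer (h s) (h s))"

definition N :: "nat \<Rightarrow> real ^ 'm ^ 'n" where
  "N t = E 1 ** P1 - (\<Sum>s=2..t. outer (\<epsilon> s) (h s))"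

lemma invariant:
  assumes "1 \<le> t"
  shows "P t ** S t = mat 1 \<and> transpose (S t) = S t \<and> (\<forall>v. 0 \<le> v \<bullet> (P t *v v)) \<and> E t ** P t = N t"
  using assms
proof (induction t rule: dec_induct)
  case base
  then show ?case 
    using init_inverse init_sym by (simp add: P_def N_def init_psd)
next
  case (step t)
  then have P: "P (Suc t) = P t + outer (h (Suc t)) (h (Suc t))"
    and N: "N (Suc t) = N t - outer (\<epsilon> (Suc t)) (h (Suc t))"
    by (simp_all add: P_def N_def)
  have "S (Suc t) = S_update 1 (h (Suc t)) (S t)"
    "E (Suc t) = rls_error (h (Suc t)) (S t) (\<epsilon> (Suc t)) (E t)"
    using S_step[of "Suc t"] E_step[of "Suc t"] step.hyps by auto
  moreover have inv: "P t ** S t = mat 1" "transpose (S t) = S t"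
    "\<And>v. 0 \<le> v \<bullet> (P t *v v)" "E t ** P t = N t"
    using step.IH by auto
  ultimately show ?case
    using rls_step(1)[OF inv(1-3), of "h (Suc t)"] rls_step(2)[OF inv(1-3), of "h (Suc t)"]
      rls_step(3)[OF inv(1-3), of _ "h (Suc t)"]
      rls_step(4)[OF inv(1-3), of "h (Suc t)" "\<epsilon> (Suc t)" "E t"]
    unfolding P N inv(4) by metis
qed

lemma quadratic_form_P: "v \<bullet> (P t *v v) = v \<bullet> (P1 *v v) + (\<Sum>s=2..t. (v \<bullet> h s)\<^sup>2)"
proof (induction t)
  case (Suc t)
  show ?case
  proof (cases "2 \<le> Suc t")
    case True
    then have "P (Suc t) = P t + outer (h (Suc t)) (h (Suc t))" by (simp add: P_def)
    then show ?thesis using Suc True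
      by (simp add: matrix_vector_mult_add_rdistrib outer_mult_vec inner_add_right inner_commute
          power2_eq_square)
  qed (simp add: P_def)
qed (simp add: P_def)

lemma S_nonneg: "1 \<le> t \<Longrightarrow> 0 \<le> u \<bullet> (S t *v u)"
proof -
  assume "1 \<le> t"
  then have "P t *v (S t *v u) = u" "\<And>v. 0 \<le> v \<bullet> (P t *v v)"
    using invariant[of t] by (auto simp: matrix_vector_mul_assoc)
  then show ?thesis by (metis inner_commute)
qed

lemma trace_axis: "trace A = (\<Sum>i\<in>UNIV. axis i 1 \<bullet> (A *v axis i (1::real)))"
  by (simp add: trace_def inner_axis' matrix_vector_mul_component inner_axis)

text \<open>For the unit vector \<open>a\<close> of a coordinate and \<open>u = S a\<close>, the form of \<open>P\<close> is nonnegative at \<open>u - a / K\<close>.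
  With \<open>a\<^sup>T P a \<le> K\<close> and \<open>P u = a\<close> this says that the diagonal entry \<open>a\<^sup>T S a\<close> is at least \<open>1 / K\<close>.\<close>

lemma trace_lower_bound:
  assumes t: "1 \<le> t" and K: "0 < K" "axis i 1 \<bullet> (P t *v axis i 1) \<le> K"
  shows "1 / K \<le> trace (S t)"
proof -
  let ?a = "axis i 1 :: real ^ 'm"
  define u where "u = S t *v ?a"
  have Pu: "P t *v u = ?a" using invariant[OF t] by (simp add: u_def matrix_vector_mul_assoc)
  have uP: "u \<bullet> (P t *v ?a) = 1"
  proof -
    have "u \<bullet> (P t *v ?a) = ?a \<bullet> (S t *v (P t *v ?a))"
      unfolding u_def using invariant[OF t] by (simp add: symmetric_matrix_inner)
    also have "S t *v (P t *v ?a) = ?a"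
      using left_inverse_mult_vec(2) invariant[OF t] by blast
    finally show ?thesis by simp
  qed
  have "0 \<le> (u - (1 / K) *\<^sub>R ?a) \<bullet> (P t *v (u - (1 / K) *\<^sub>R ?a))"
    using invariant[OF t] by blast
  also have "\<dots> = u \<bullet> ?a - 2 / K + (1 / K)\<^sup>2 * (?a \<bullet> (P t *v ?a))"
    by (simp add: matrix_vector_mult_diff_distrib matrix_vector_mult_scaleR Pu
        inner_diff_left inner_diff_right uP power2_eq_square algebra_simps)
  also have "\<dots> \<le> u \<bullet> ?a - 2 / K + (1 / K)\<^sup>2 * K"
    using K by (intro add_left_mono mult_left_mono) auto
  also have "\<dots> = u \<bullet> ?a - 1 / K" using K by (simp add: power2_eq_square field_simps)
  finally have "1 / K \<le> ?a \<bullet> (S t *v ?a)" by (simp add: u_def inner_commute)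
  also have "\<dots> \<le> trace (S t)"
    unfolding trace_axis using S_nonneg[OF t] by (intro member_le_sum) auto
  finally show ?thesis .
qed

lemma norm_S_bound:
  assumes t: "1 \<le> t" and c: "0 < c" "\<And>v. c * (norm v)\<^sup>2 \<le> v \<bullet> (P t *v v)"
  shows "norm (S t *v v) \<le> norm v / c"
proof -
  let ?u = "S t *v v"
  have "P t *v ?u = v" using invariant[OF t] by (simp add: matrix_vector_mul_assoc)
  then have "c * (norm ?u)\<^sup>2 \<le> ?u \<bullet> v" using c(2)[of ?u] by simp
  also have "\<dots> \<le> norm ?u * norm v" by (rule norm_cauchy_schwarz)
  finally have "norm ?u * (c * norm ?u) \<le> norm ?u * norm v" by (simp add: power2_eq_square mult_ac)
  then have "c * norm ?u \<le> norm v"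
    by (cases "?u = 0") (auto dest: mult_left_le_imp_le)
  then show ?thesis using c(1) by (simp add: pos_le_divide_eq mult.commute)
qed

lemma trace_upper_bound:
  assumes t: "1 \<le> t" and c: "0 < c" "\<And>v. c * (norm v)\<^sup>2 \<le> v \<bullet> (P t *v v)"
  shows "trace (S t) \<le> real CARD('m) / c"
proof -
  have "axis i 1 \<bullet> (S t *v axis i (1::real)) \<le> 1 / c" for i
    using norm_cauchy_schwarz[of "axis i 1" "S t *v axis i 1"] norm_S_bound[OF assms, of "axis i 1"]
    by simp
  then have "trace (S t) \<le> (\<Sum>i\<in>(UNIV::'m set). 1 / c)"
    unfolding trace_axis by (intro sum_mono)
  then show ?thesis by simp
qed

lemma error_bound:
  assumes t: "1 \<le> t" and c: "0 < c" "\<And>v. c * (norm v)\<^sup>2 \<le> v \<bullet> (P t *v v)"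
  shows "norm (E t) \<le> norm (N t) / c"
proof -
  have "E t = E t ** (P t ** S t)" using invariant[OF t] by simp
  also have "\<dots> = N t ** S t" unfolding matrix_mul_assoc using invariant[OF t] by simp
  finally have "E t $ i = S t *v (N t $ i)" for i
  proof -
    assume "E t = N t ** S t"
    then have "E t $ i = (N t $ i) v* S t"
      by (simp add: vec_eq_iff matrix_matrix_mult_def vector_matrix_mult_def mult.commute)
    then show ?thesis using invariant[OF t] by (simp only: symmetric_vec_mult)
  qed
  then have "norm (E t) \<le> L2_set (\<lambda>i. norm (N t $ i) * (1 / c)) UNIV"
    unfolding norm_vec_def[of "E t"] using norm_S_bound[OF assms]
    by (intro L2_set_mono) auto
  also have "\<dots> = norm (N t) / c"
    using c(1) by (subst L2_set_left_distrib[symmetric]) (auto simp: norm_vec_def)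
  finally show ?thesis .
qed

end

lemma A_rate_increment_bounded:
  assumes "\<gamma> < 1" "0 < \<gamma>"
  shows "\<exists>K>0. \<forall>t\<ge>1. A_rate \<gamma> (Suc t) \<le> A_rate \<gamma> t + K"
proof -
  have "(\<lambda>t. A_rate \<gamma> (Suc t) - A_rate \<gamma> t) \<longlonglongrightarrow> 0"
    unfolding A_rate_def using assms by real_asymp
  then obtain K where "K > 0" "\<And>t. \<bar>A_rate \<gamma> (Suc t) - A_rate \<gamma> t\<bar> \<le> K"
    using convergent_imp_Bseq[of "\<lambda>t. A_rate \<gamma> (Suc t) - A_rate \<gamma> t"] 
    by (auto simp: convergent_def Bseq_def)
  then show ?thesis by (intro exI[of _ K]) (auto simp: abs_le_iff algebra_simps)
qed

lemma A_rate_pos: "2 \<le> t \<Longrightarrow> 0 < A_rate \<gamma> t"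
  by (simp add: A_rate_def)

lemma not_explores_iff:
  assumes "2 \<le> t"
  shows "\<not> explores \<gamma> S t \<longleftrightarrow> trace S \<le> 1 / A_rate \<gamma> t"
  using A_rate_pos[OF assms, of \<gamma>] by (simp add: explores_def not_less inverse_eq_divide)

text \<open>Induction on time. A round that does not explore has \<open>1 / (C0 + B n) \<le> tr S \<le> 1 / A\<close>, that is
  \<open>A \<le> C0 + B n\<close>; a round that explores increases \<open>n\<close> by one, while \<open>A\<close> grows only by a
  bounded amount per round as \<open>\<gamma> < 1\<close>. The constants depend only on \<open>C0\<close>, \<open>B\<close> and \<open>\<gamma>\<close>, hence serve
  all sample paths at once.\<close>

lemma exploration_count_lower_bound:
  fixes S :: "nat \<Rightarrow> real ^ 'm::finite ^ 'm"
  assumes \<gamma>: "0 < \<gamma>" "\<gamma> < 1" and C: "0 < C0" "0 \<le> B"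
  shows "\<exists>C1>0. \<exists>K>0. \<forall>S n.
    (\<forall>t\<ge>1. 1 / (C0 + B * n t) \<le> trace (S t :: real ^ 'm ^ 'm)) \<longrightarrow> (\<forall>t. 0 \<le> n t) \<longrightarrow>
    (\<forall>t\<ge>1. n (Suc t) = n t + of_bool (explores \<gamma> (S t) t)) \<longrightarrow>
    (\<forall>t\<ge>1. A_rate \<gamma> t \<le> C1 + K * n t)"
proof -
  obtain K0 where K0: "K0 > 0" "\<And>t. t \<ge> 1 \<Longrightarrow> A_rate \<gamma> (Suc t) \<le> A_rate \<gamma> t + K0"
    using A_rate_increment_bounded[OF \<gamma>(2,1)] by blast
  have "A_rate \<gamma> t \<le> (C0 + K0) + (B + K0) * n t"
    if tr: "\<forall>t\<ge>1. 1 / (C0 + B * n t) \<le> trace (S t)" and n0: "\<forall>t. 0 \<le> n t"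
      and n: "\<forall>t\<ge>1. n (Suc t) = n t + of_bool (explores \<gamma> (S t) t)" and t: "1 \<le> t"
    for n t and S :: "nat \<Rightarrow> real ^ 'm ^ 'm"
    using t
  proof (induction t rule: dec_induct)
    case base
    have "0 \<le> (C0 + K0) + (B + K0) * n 1" using C K0 n0 by auto
    then show ?case by (simp add: A_rate_def)
  next
    case (step t)
    have inc: "A_rate \<gamma> (Suc t) \<le> A_rate \<gamma> t + K0" using K0 step by auto
    show ?case
    proof (cases "explores \<gamma> (S t) t")
      case True
      then have "n (Suc t) = n t + 1" using n step by auto
      then show ?thesis using step.IH inc C by (simp add: algebra_simps)
    next
      case False
      then have nS: "n (Suc t) = n t" using n step by auto
      have "A_rate \<gamma> t \<le> C0 + B * n t"
      proof (cases "t = 1")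
        case True
        then show ?thesis using C n0 by (simp add: A_rate_def)
      next
        case neq: False
        then have t2: "2 \<le> t" using step by simp
        have "1 / (C0 + B * n t) \<le> 1 / A_rate \<gamma> t"
          using tr step False not_explores_iff[OF t2] by force
        moreover have "0 < C0 + B * n t" using C n0 by (simp add: add_pos_nonneg)
        ultimately show ?thesis using A_rate_pos[OF t2, of \<gamma>] by (simp add: field_simps)
      qed
      moreover have "0 \<le> K0 * n t" using K0 n0 by simp
      ultimately show ?thesis using inc unfolding nS distrib_right by linarith
    qed
  qed
  then show ?thesis using C K0 by (intro exI[of _ "C0 + K0"] conjI exI[of _ "B + K0"]) auto
qed

section \<open>Exponential moments of predictably selected sums\<close>

lemma exp_le_quadratic:
  fixes z :: real
  assumes "\<bar>z\<bar> \<le> 1"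
  shows "exp z \<le> 1 + z + z\<^sup>2"
proof (cases "0 \<le> z")
  case True
  then show ?thesis using exp_bound[of z] assms by simp
next
  case False
  have "1 - z + z\<^sup>2 / 2 \<le> exp (- z)"
    using exp_lower_Taylor_quadratic[of "- z"] False by simp
  moreover have "0 < 1 - z + z\<^sup>2 / 2" using False by (simp add: add_pos_nonneg)
  ultimately have "exp z \<le> 1 / (1 - z + z\<^sup>2 / 2)"
    by (simp add: exp_minus field_simps)
  also have "\<dots> \<le> 1 + z + z\<^sup>2"
  proof -
    have "(1 + z + z\<^sup>2) * (1 - z + z\<^sup>2 / 2) = 1 + z\<^sup>2 / 2 + z ^ 2 * (- z) / 2 + z ^ 4 / 2"
      by (simp add: field_simps power2_eq_square power4_eq_xxxx)
    also have "\<dots> \<ge> 1"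
    proof -
      have "0 \<le> z ^ 2 * (- z)" using False by (intro mult_nonneg_nonneg) auto
      moreover have "0 \<le> z ^ 4" "0 \<le> z\<^sup>2" by simp_all
      ultimately show ?thesis by linarith
    qed
    finally show ?thesis
      using \<open>0 < 1 - z + z\<^sup>2 / 2\<close> by (simp add: pos_divide_le_eq)
  qed
  finally show ?thesis .
qed

text \<open>The sigma-algebra on the sample space that is generated by the variables \<open>Z i\<close> with \<open>i \<in> J\<close>.\<close>

definition past :: "'w measure \<Rightarrow> ('i \<Rightarrow> 'w \<Rightarrow> 'b::topological_space) \<Rightarrow> 'i set \<Rightarrow> 'w measure" where
  "past M Z J = vimage_algebra (space M) (\<lambda>\<omega>. restrict (\<lambda>i. Z i \<omega>) J) (PiM J (\<lambda>_. borel))"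

lemma space_past [simp]: "space (past M Z J) = space M"
  by (simp add: past_def)

lemma measurable_past: "i \<in> J \<Longrightarrow> Z i \<in> borel_measurable (past M Z J)"
proof -
  assume i: "i \<in> J"
  have "(\<lambda>\<omega>. restrict (\<lambda>i. Z i \<omega>) J) \<in> past M Z J \<rightarrow>\<^sub>M PiM J (\<lambda>_. borel)"
    unfolding past_def by (rule measurable_vimage_algebra1) (auto simp: space_PiM)
  from measurable_compose[OF this measurable_component_singleton[OF i]] show ?thesis
    using i by simp
qed

lemma measurable_past_transfer:
  assumes "f \<in> past M Z J \<rightarrow>\<^sub>M N" "\<And>i. i \<in> J \<Longrightarrow> Z i \<in> borel_measurable (past M Z' K)"
  shows "f \<in> past M Z' K \<rightarrow>\<^sub>M N"
proof -
  have "(\<lambda>\<omega>. \<omega>) \<in> past M Z' K \<rightarrow>\<^sub>M past M Z J"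
    unfolding past_def[of M Z J] using assms(2)
    by (intro measurable_vimage_algebra2 measurable_restrict) auto
  from measurable_compose[OF this assms(1)] show ?thesis .
qed

lemma measurable_past_mono:
  assumes "f \<in> past M Z J \<rightarrow>\<^sub>M N" "J \<subseteq> K"
  shows "f \<in> past M Z K \<rightarrow>\<^sub>M N"
  using assms by (auto intro: measurable_past_transfer[of f M Z J N] measurable_past)

context prob_space
begin

lemma measurable_from_past:
  assumes "indep_vars (\<lambda>_. borel) Z I" "J \<subseteq> I" "f \<in> past M Z J \<rightarrow>\<^sub>M N"
  shows "f \<in> M \<rightarrow>\<^sub>M N"
proof -
  have "(\<lambda>\<omega>. \<omega>) \<in> M \<rightarrow>\<^sub>M past M Z J"
    unfolding past_def using assms(1,2)
    by (intro measurable_vimage_algebra2 measurable_restrict) (auto simp: indep_vars_def)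
  from measurable_compose[OF this assms(3)] show ?thesis .
qed

lemma indep_var_past:
  fixes N N' :: "'c measure"
  assumes ind: "indep_vars (\<lambda>_. borel) Z I" and J: "J \<subseteq> I" "i \<in> I" "i \<notin> J"
    and f: "f \<in> past M Z J \<rightarrow>\<^sub>M N" and g: "g \<in> borel \<rightarrow>\<^sub>M N'"
  shows "indep_var N f N' (\<lambda>\<omega>. g (Z i \<omega>))"
proof -
  have sets_past: "sets (past M Z K) = sigma_sets (space M)
      {(\<lambda>\<omega>. restrict (\<lambda>i. Z i \<omega>) K) -` A \<inter> space M |A. A \<in> sets (PiM K (\<lambda>_. borel))}" for K
    by (simp add: past_def sets_vimage_algebra)
  have "indep_set (sets (past M Z J)) (sets (past M Z {i}))"
    using indep_var_restrict[OF ind, of J "{i}"] J unfolding indep_var_eq sets_past by auto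
  then have prod: "sets (past M Z J) \<subseteq> events" "sets (past M Z {i}) \<subseteq> events"
    "\<And>a b. a \<in> sets (past M Z J) \<Longrightarrow> b \<in> sets (past M Z {i}) \<Longrightarrow> prob (a \<inter> b) = prob a * prob b"
    unfolding indep_sets2_eq by auto
  have gen: "sigma_sets (space M) {h -` A \<inter> space M |A. A \<in> sets L} \<subseteq> sets (past M Z K)"
    if "h \<in> past M Z K \<rightarrow>\<^sub>M L" for h K and L :: "'c measure"
    using measurable_sets[OF that]
    by (intro sets.sigma_sets_subset[of _ "past M Z K", simplified]) auto
  have gZ: "(\<lambda>\<omega>. g (Z i \<omega>)) \<in> past M Z {i} \<rightarrow>\<^sub>M N'"
    using measurable_past[of i "{i}" Z M] g by (auto intro: measurable_compose)
  have "indep_set (sigma_sets (space M) {f -` A \<inter> space M |A. A \<in> sets N})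
      (sigma_sets (space M) {(\<lambda>\<omega>. g (Z i \<omega>)) -` A \<inter> space M |A. A \<in> sets N'})"
    unfolding indep_sets2_eq
    using order_trans[OF gen[OF f] prod(1)] order_trans[OF gen[OF gZ] prod(2)]
      prod(3)[OF subsetD[OF gen[OF f]] subsetD[OF gen[OF gZ]]] by simp
  moreover have "f \<in> M \<rightarrow>\<^sub>M N" "(\<lambda>\<omega>. g (Z i \<omega>)) \<in> M \<rightarrow>\<^sub>M N'"
    using measurable_from_past[OF ind _ f] measurable_from_past[OF ind _ gZ] J by auto
  ultimately show ?thesis unfolding indep_var_eq by blast
qed

lemma nn_integral_indep_mult:
  fixes f g :: "'a \<Rightarrow> ennreal"
  assumes "indep_var borel f borel g"
  shows "(\<integral>\<^sup>+\<omega>. f \<omega> * g \<omega> \<partial>M) = (\<integral>\<^sup>+\<omega>. f \<omega> \<partial>M) * (\<integral>\<^sup>+\<omega>. g \<omega> \<partial>M)"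
proof -
  have "indep_vars (\<lambda>_. borel) (case_bool f g) UNIV"
    using assms unfolding indep_var_def
    by (rule back_subst[of "\<lambda>N. indep_vars N (case_bool f g) UNIV"]) (auto split: bool.split)
  from indep_vars_nn_integral[OF _ this] show ?thesis by (simp add: UNIV_bool mult.commute)
qed

text \<open>By Markov's inequality \<open>U t\<close> exceeds \<open>2 log t\<close> with probability at most \<open>t\<^sup>-\<^sup>2\<close>, and this is
  summable.\<close>

lemma exp_moment_log_growth:
  fixes U :: "nat \<Rightarrow> 'a \<Rightarrow> real"
  assumes [measurable]: "\<And>t. U t \<in> borel_measurable M"
    and le1: "\<And>t. t \<ge> 1 \<Longrightarrow> (\<integral>\<^sup>+\<omega>. ennreal (exp (U t \<omega>)) \<partial>M) \<le> 1"
  shows "AE \<omega> in M. eventually (\<lambda>t. U t \<omega> \<le> 2 * ln (real t)) sequentially"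
proof -
  define A where "A t = {\<omega> \<in> space M. 2 * ln (real t) < U t \<omega>}" for t
  have A[measurable]: "A t \<in> sets M" for t unfolding A_def by measurable
  have bound: "prob (A t) \<le> inverse ((real t)\<^sup>2)" if t: "t \<ge> 1" for t
  proof -
    have "emeasure M (A t) \<le> emeasure M ({\<omega>\<in>space M. 1 \<le> ennreal (inverse ((real t)\<^sup>2)) * ennreal (exp (U t \<omega>))})"
    proof (rule emeasure_mono)
      show "A t \<subseteq> {\<omega>\<in>space M. 1 \<le> ennreal (inverse ((real t)\<^sup>2)) * ennreal (exp (U t \<omega>))}"
      proof
        fix \<omega> assume "\<omega> \<in> A t"
        then have w: "\<omega> \<in> space M" "2 * ln (real t) < U t \<omega>" by (auto simp: A_def)
        have "(real t)\<^sup>2 = exp (2 * ln (real t))"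
          using t by (simp add: exp_double power2_eq_square)
        also have "\<dots> \<le> exp (U t \<omega>)" using w by simp
        finally have "1 \<le> inverse ((real t)\<^sup>2) * exp (U t \<omega>)" using t by (simp add: field_simps)
        then show "\<omega> \<in> {\<omega>\<in>space M. 1 \<le> ennreal (inverse ((real t)\<^sup>2)) * ennreal (exp (U t \<omega>))}"
          using w by (simp flip: ennreal_mult' ennreal_1)
      qed
    qed measurable
    also have "\<dots> \<le> ennreal (inverse ((real t)\<^sup>2)) * (\<integral>\<^sup>+\<omega>. ennreal (exp (U t \<omega>)) * indicator (space M) \<omega> \<partial>M)"
      by (rule nn_integral_Markov_inequality) auto
    also have "\<dots> \<le> ennreal (inverse ((real t)\<^sup>2)) * 1"
      using le1[OF t] by (intro mult_left_mono) (auto simp: nn_integral_set_ennreal cong: nn_integral_cong)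
    finally show ?thesis by (simp add: emeasure_eq_measure)
  qed
  have "summable (\<lambda>t. prob (A t))"
    by (rule summable_comparison_test'[OF inverse_power_summable[of 2], of 1]) (use bound in auto)
  then have "AE \<omega> in M. eventually (\<lambda>t. \<omega> \<in> space M - A t) sequentially"
    by (intro borel_cantelli_AE1) (auto simp: emeasure_eq_measure)
  then show ?thesis
    by eventually_elim (auto elim!: eventually_mono simp: A_def)
qed

text \<open>The exponential of the sum is a supermartingale: whether round \<open>t\<close> is selected is known from the
  variables before \<open>t\<close>, of which \<open>w t\<close> is independent, so a selected round contributes a factor with
  mean at most one. Working with nonnegative extended values allows for unbounded \<open>\<phi>\<close>.\<close>

lemma predictable_selection_exp_moment:
  fixes w :: "nat \<Rightarrow> 'a \<Rightarrow> 'b::topological_space" and \<phi> :: "'b \<Rightarrow> real"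
    and X :: "nat \<Rightarrow> 'a \<Rightarrow> bool"
  assumes ind: "indep_vars (\<lambda>_. borel) w {2..}"
    and X: "\<And>t. 2 \<le> t \<Longrightarrow> Measurable.pred (past M w {2..<t}) (X t)"
    and \<phi>[measurable]: "\<phi> \<in> borel_measurable borel"
    and le1: "\<And>t. 2 \<le> t \<Longrightarrow> (\<integral>\<^sup>+\<omega>. ennreal (exp (\<phi> (w t \<omega>))) \<partial>M) \<le> 1"
  shows "(\<lambda>\<omega>. \<Sum>s=2..t. if X s \<omega> then \<phi> (w s \<omega>) else 0) \<in> borel_measurable (past M w {2..t})"
    and "(\<integral>\<^sup>+\<omega>. ennreal (exp (\<Sum>s=2..t. if X s \<omega> then \<phi> (w s \<omega>) else 0)) \<partial>M) \<le> 1"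
proof -
  let ?U = "\<lambda>t \<omega>. \<Sum>s=2..t. if X s \<omega> then \<phi> (w s \<omega>) else 0"
  show meas: "?U t \<in> borel_measurable (past M w {2..t})" for t
  proof (intro borel_measurable_sum)
    fix s assume s: "s \<in> {2..t}"
    have [measurable]: "Measurable.pred (past M w {2..t}) (X s)"
      using s by (intro measurable_past_mono[OF X]) auto
    have [measurable]: "w s \<in> borel_measurable (past M w {2..t})"
      using s by (rule measurable_past)
    show "(\<lambda>\<omega>. if X s \<omega> then \<phi> (w s \<omega>) else 0) \<in> borel_measurable (past M w {2..t})"
      by measurable
  qed
  show "(\<integral>\<^sup>+\<omega>. ennreal (exp (?U t \<omega>)) \<partial>M) \<le> 1"
  proof (induction t)
    case 0
    then show ?case by (simp add: emeasure_space_1)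
  next
    case (Suc t)
    show ?case
    proof (cases "2 \<le> Suc t")
      case False
      then show ?thesis by (simp add: emeasure_space_1)
    next
      case True
      let ?J = "{2..t}"
      have J: "{2..<Suc t} = ?J" by auto
      have X': "Measurable.pred (past M w ?J) (X (Suc t))" using X[OF True] by (simp add: J)
      \<comment> \<open>the two cases of round \<open>Suc t\<close>: not selected, with factor 1, and selected, with factor \<open>c\<close>\<close>
      define a where "a \<omega> = ennreal (exp (?U t \<omega>)) * indicator {\<omega>. \<not> X (Suc t) \<omega>} \<omega>" for \<omega>
      define b where "b \<omega> = ennreal (exp (?U t \<omega>)) * indicator {\<omega>. X (Suc t) \<omega>} \<omega>" for \<omega>
      define c where "c \<omega> = ennreal (exp (\<phi> (w (Suc t) \<omega>)))" for \<omega>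
      have a': "a \<in> borel_measurable (past M w ?J)" and b': "b \<in> borel_measurable (past M w ?J)"
        unfolding a_def b_def using X' meas[of t] by measurable
      have [measurable]: "a \<in> borel_measurable M" "b \<in> borel_measurable M"
        by (rule measurable_from_past[OF ind _ a'] measurable_from_past[OF ind _ b'], auto)+
      have "indep_var borel b borel c"
        unfolding c_def using True
        by (intro indep_var_past[OF ind _ _ _ b', where g="\<lambda>v. ennreal (exp (\<phi> v))"]) auto
      then have bc: "(\<integral>\<^sup>+\<omega>. b \<omega> * c \<omega> \<partial>M) = (\<integral>\<^sup>+\<omega>. b \<omega> \<partial>M) * (\<integral>\<^sup>+\<omega>. c \<omega> \<partial>M)"
        by (rule nn_integral_indep_mult)
      have [measurable]: "w (Suc t) \<in> borel_measurable M"
        using ind True by (auto simp: indep_vars_def)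
      have [measurable]: "c \<in> borel_measurable M" unfolding c_def by measurable
      have "(\<integral>\<^sup>+\<omega>. ennreal (exp (?U (Suc t) \<omega>)) \<partial>M) = (\<integral>\<^sup>+\<omega>. a \<omega> + b \<omega> * c \<omega> \<partial>M)"
        using True
        by (intro nn_integral_cong) (auto simp: a_def b_def c_def exp_add ennreal_mult'')
      also have "\<dots> = (\<integral>\<^sup>+\<omega>. a \<omega> \<partial>M) + (\<integral>\<^sup>+\<omega>. b \<omega> \<partial>M) * (\<integral>\<^sup>+\<omega>. c \<omega> \<partial>M)"
        by (subst nn_integral_add) (auto simp: bc)
      also have "\<dots> \<le> (\<integral>\<^sup>+\<omega>. a \<omega> \<partial>M) + (\<integral>\<^sup>+\<omega>. b \<omega> \<partial>M) * 1"
        using le1[OF True] by (intro add_left_mono mult_left_mono) (auto simp: c_def)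
      also have "\<dots> = (\<integral>\<^sup>+\<omega>. a \<omega> + b \<omega> \<partial>M)" by (subst nn_integral_add) auto
      also have "\<dots> = (\<integral>\<^sup>+\<omega>. ennreal (exp (?U t \<omega>)) \<partial>M)"
        by (intro nn_integral_cong) (auto simp: a_def b_def indicator_def)
      also have "\<dots> \<le> 1" by (rule Suc.IH)
      finally show ?thesis .
    qed
  qed
qed

lemma predictable_selection_log_growth:
  fixes w :: "nat \<Rightarrow> 'a \<Rightarrow> 'b::topological_space" and \<phi> :: "'b \<Rightarrow> real"
  assumes ind: "indep_vars (\<lambda>_. borel) w {2..}"
    and X: "\<And>t. 2 \<le> t \<Longrightarrow> Measurable.pred (past M w {2..<t}) (X t)"
    and \<phi>: "\<phi> \<in> borel_measurable borel"
    and le1: "\<And>t. 2 \<le> t \<Longrightarrow> (\<integral>\<^sup>+\<omega>. ennreal (exp (\<phi> (w t \<omega>))) \<partial>M) \<le> 1"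
  shows "AE \<omega> in M. eventually
    (\<lambda>t. (\<Sum>s=2..t. if X s \<omega> then \<phi> (w s \<omega>) else 0) \<le> 2 * ln (real t)) sequentially"
proof (rule exp_moment_log_growth)
  show "(\<lambda>\<omega>. \<Sum>s=2..t. if X s \<omega> then \<phi> (w s \<omega>) else 0) \<in> borel_measurable M" for t
    using predictable_selection_exp_moment(1)[OF assms] by (rule measurable_from_past[OF ind, rotated]) auto
qed (rule predictable_selection_exp_moment(2)[OF assms])


text \<open>A supermartingale for noise with predictable random coefficients \<open>c t\<close>. Because the noise is
  multiplied by a random coefficient, its factor does not split off as an independent
  random variable. The quadratic bound on the exponential, valid as \<open>|\<beta> c y| \<le> 1\<close>, turns that factor into a
  sum of products of a past quantity and a function of the noise alone, whose means
  multiply. The compensator \<open>\<kappa>\<close> collects the resulting first and second order terms.\<close>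

lemma predictable_noise_exp_moment:
  fixes Z :: "'i \<Rightarrow> 'a \<Rightarrow> 'b::topological_space" and y :: "'b \<Rightarrow> real"
    and c :: "nat \<Rightarrow> 'a \<Rightarrow> real" and X :: "nat \<Rightarrow> 'a \<Rightarrow> bool" and J :: "nat \<Rightarrow> 'i set"
  assumes ind: "indep_vars (\<lambda>_. borel) Z I"
    and J: "\<And>t. J t \<subseteq> I" "\<And>t. J t \<subseteq> J (Suc t)"
    and \<iota>: "\<And>t. 2 \<le> t \<Longrightarrow> \<iota> t \<in> J (Suc t)" "\<And>t. 2 \<le> t \<Longrightarrow> \<iota> t \<notin> J t"
    and X: "\<And>t. 2 \<le> t \<Longrightarrow> Measurable.pred (past M Z (J t)) (X t)"
    and c: "\<And>t. 2 \<le> t \<Longrightarrow> c t \<in> borel_measurable (past M Z (J t))"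
    and c_bound: "\<And>t \<omega>. 2 \<le> t \<Longrightarrow> \<omega> \<in> space M \<Longrightarrow> \<bar>c t \<omega>\<bar> \<le> B * of_bool (X t \<omega>)"
    and y[measurable]: "y \<in> borel_measurable borel"
    and y_bound: "\<And>v. B * \<bar>\<beta> * y v\<bar> \<le> 1"
    and y_mean: "\<And>t. 2 \<le> t \<Longrightarrow> \<bar>\<integral>\<omega>. y (Z (\<iota> t) \<omega>) \<partial>M\<bar> \<le> \<mu>"
    and y_square: "\<And>t. 2 \<le> t \<Longrightarrow> (\<integral>\<omega>. (y (Z (\<iota> t) \<omega>))\<^sup>2 \<partial>M) \<le> V"
    and pos: "0 < \<beta>" "0 < B"
  defines "\<kappa> \<equiv> \<beta> * B * \<mu> + (\<beta> * B)\<^sup>2 * V"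
  defines "U \<equiv> \<lambda>t \<omega>. \<Sum>s=2..t. \<beta> * (c s \<omega> * y (Z (\<iota> s) \<omega>)) - \<kappa> * of_bool (X s \<omega>)"
  shows "U t \<in> borel_measurable (past M Z (J (Suc t)))"
    and "(\<integral>\<^sup>+\<omega>. ennreal (exp (U t \<omega>)) \<partial>M) \<le> 1"
proof -
  have Jmono: "s \<le> t \<Longrightarrow> J s \<subseteq> J t" for s t
    by (rule lift_Suc_mono_le[of J]) (use J in auto)
  show meas: "U t \<in> borel_measurable (past M Z (J (Suc t)))" for t
    unfolding U_def
  proof (intro borel_measurable_sum)
    fix s assume s: "s \<in> {2..t}"
    then have sub: "J s \<subseteq> J (Suc t)" "J (Suc s) \<subseteq> J (Suc t)" by (auto intro!: Jmono)
    have [measurable]: "Measurable.pred (past M Z (J (Suc t))) (X s)"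
      "c s \<in> borel_measurable (past M Z (J (Suc t)))"
      "Z (\<iota> s) \<in> borel_measurable (past M Z (J (Suc t)))"
      using s sub \<iota>(1)[of s]
      by (auto intro: measurable_past_mono[OF X] measurable_past_mono[OF c] measurable_past)
    show "(\<lambda>\<omega>. \<beta> * (c s \<omega> * y (Z (\<iota> s) \<omega>)) - \<kappa> * of_bool (X s \<omega>))
        \<in> borel_measurable (past M Z (J (Suc t)))"
      by measurable
  qed
  have meas_M: "U t \<in> borel_measurable M" for t
    by (rule measurable_from_past[OF ind J(1) meas])
  have Z_M: "Z (\<iota> t) \<in> borel_measurable M" if "2 \<le> t" for t
    using ind \<iota>(1)[OF that] J(1)[of "Suc t"] by (auto simp: indep_vars_def)
  have \<mu>0: "0 \<le> \<mu>" using y_mean[of 2] by simp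
  have "0 \<le> (\<integral>\<omega>. (y (Z (\<iota> 2) \<omega>))\<^sup>2 \<partial>M)" by simp
  then have V0: "0 \<le> V" using y_square[of 2] by linarith
  have \<kappa>0: "0 \<le> \<kappa>" using pos \<mu>0 V0 by (simp add: \<kappa>_def)
  have small: "\<bar>\<beta> * (c s \<omega> * y v)\<bar> \<le> 1" if "2 \<le> s" "\<omega> \<in> space M" for s \<omega> v
  proof -
    have "\<bar>\<beta> * (c s \<omega> * y v)\<bar> = \<bar>c s \<omega>\<bar> * \<bar>\<beta> * y v\<bar>" by (simp add: abs_mult)
    also have "\<dots> \<le> B * \<bar>\<beta> * y v\<bar>"
      using c_bound[OF that] pos by (intro mult_right_mono) (auto split: if_splits simp: of_bool_def)
    finally show ?thesis using y_bound[of v] by simp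
  qed
  have U_le: "U t \<omega> \<le> real t" if "\<omega> \<in> space M" for t \<omega>
  proof -
    have "U t \<omega> \<le> (\<Sum>s=2..t. 1)"
      unfolding U_def
    proof (intro sum_mono)
      fix s assume "s \<in> {2..t}"
      then have "\<beta> * (c s \<omega> * y (Z (\<iota> s) \<omega>)) \<le> 1"
        using small[of s \<omega> "Z (\<iota> s) \<omega>"] that by (simp add: abs_le_iff)
      moreover have "0 \<le> \<kappa> * of_bool (X s \<omega>)" using \<kappa>0 by simp
      ultimately show "\<beta> * (c s \<omega> * y (Z (\<iota> s) \<omega>)) - \<kappa> * of_bool (X s \<omega>) \<le> 1" by linarith
    qed
    then show ?thesis by simp
  qed
  have integrable_U: "integrable M (\<lambda>\<omega>. exp (U t \<omega>))" for t
    using meas_M U_le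
    by (intro integrable_const_bound[of _ "exp (real t)"]) auto
  have "(\<integral>\<omega>. exp (U t \<omega>) \<partial>M) \<le> 1" for t
  proof (induction t)
    case 0
    then show ?case by (simp add: U_def prob_space)
  next
    case (Suc t)
    show ?case
    proof (cases "2 \<le> Suc t")
      case False
      then show ?thesis by (simp add: U_def prob_space)
    next
      case True
      define T where "T = Suc t"
      have T: "2 \<le> T" using True by (simp add: T_def)
      \<comment> \<open>the part of the exponential that is known before the noise of round \<open>T\<close>\<close>
      define H where "H \<omega> = exp (U t \<omega>) * exp (- \<kappa> * of_bool (X T \<omega>))" for \<omega>
      define Y where "Y \<omega> = y (Z (\<iota> T) \<omega>)" for \<omega>
      have H_past: "H \<in> borel_measurable (past M Z (J T))"
        unfolding H_def using X[OF T] meas[of t] by (simp add: T_def)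
      have Hc: "(\<lambda>\<omega>. H \<omega> * c T \<omega>) \<in> borel_measurable (past M Z (J T))"
        "(\<lambda>\<omega>. H \<omega> * (c T \<omega>)\<^sup>2) \<in> borel_measurable (past M Z (J T))"
        using H_past c[OF T] by measurable
      have [measurable]: "H \<in> borel_measurable M" "c T \<in> borel_measurable M" "Z (\<iota> T) \<in> borel_measurable M"
        "Measurable.pred M (X T)"
        using measurable_from_past[OF ind J(1)] H_past c[OF T] Z_M[OF T] X[OF T] by auto
      have [measurable]: "Y \<in> borel_measurable M" unfolding Y_def by measurable
      have H0: "0 \<le> H \<omega>" for \<omega> by (simp add: H_def)
      have H_le: "H \<omega> \<le> exp (real t)" if "\<omega> \<in> space M" for \<omega>
        using U_le[OF that, of t] \<kappa>0 unfolding H_def exp_add[symmetric] by simp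
      have c_le: "\<bar>c T \<omega>\<bar> \<le> B" if "\<omega> \<in> space M" for \<omega>
        using c_bound[OF T that] pos by (auto simp: of_bool_def split: if_splits)
      have c2_le: "(c T \<omega>)\<^sup>2 \<le> B\<^sup>2" if "\<omega> \<in> space M" for \<omega>
        using c_le[OF that] pos by (simp add: abs_le_square_iff[symmetric])
      have Y_le: "\<bar>Y \<omega>\<bar> \<le> 1 / (B * \<beta>)" for \<omega>
        using y_bound[of "Z (\<iota> T) \<omega>"] pos by (simp add: Y_def abs_mult field_simps)
      have int_H: "integrable M H"
        using H0 H_le by (intro integrable_const_bound[of _ "exp (real t)"]) auto
      have int_Hc: "integrable M (\<lambda>\<omega>. H \<omega> * c T \<omega>)"
        using H0 H_le c_le by (intro integrable_const_bound[of _ "exp (real t) * B"])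
          (auto intro!: mult_mono simp: abs_mult)
      have int_Hc2: "integrable M (\<lambda>\<omega>. H \<omega> * (c T \<omega>)\<^sup>2)"
        using H0 H_le c_le by (intro integrable_const_bound[of _ "exp (real t) * B\<^sup>2"])
          (auto intro!: mult_mono simp: abs_mult c2_le)
      have int_HX: "integrable M (\<lambda>\<omega>. H \<omega> * of_bool (X T \<omega>))"
        using H0 H_le by (intro integrable_const_bound[of _ "exp (real t)"])
          (auto simp: of_bool_def)
      have int_Y: "integrable M Y"
        using Y_le by (intro integrable_const_bound[of _ "1 / (B * \<beta>)"]) auto
      have int_Y2: "integrable M (\<lambda>\<omega>. (Y \<omega>)\<^sup>2)"
        using Y_le pos by (intro integrable_const_bound[of _ "(1 / (B * \<beta>))\<^sup>2"])
          (auto simp del: power_divide simp: abs_le_square_iff[symmetric])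
      have ind1: "indep_var borel (\<lambda>\<omega>. H \<omega> * c T \<omega>) borel Y"
        unfolding Y_def using \<iota>(1)[OF T] J(1)[of "Suc T"]
        by (intro indep_var_past[OF ind J(1) _ \<iota>(2)[OF T] Hc(1) y]) auto
      have ind2: "indep_var borel (\<lambda>\<omega>. H \<omega> * (c T \<omega>)\<^sup>2) borel (\<lambda>\<omega>. (Y \<omega>)\<^sup>2)"
        unfolding Y_def using \<iota>(1)[OF T] J(1)[of "Suc T"]
        by (intro indep_var_past[OF ind J(1) _ \<iota>(2)[OF T] Hc(2), where g="\<lambda>v. (y v)\<^sup>2"]) auto
      note prod1 = indep_var_lebesgue_integral[OF ind1 int_Hc int_Y]
        and prod2 = indep_var_lebesgue_integral[OF ind2 int_Hc2 int_Y2]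
      note int1 = indep_var_integrable[OF ind1 int_Hc int_Y]
        and int2 = indep_var_integrable[OF ind2 int_Hc2 int_Y2]
      have "(\<integral>\<omega>. exp (U T \<omega>) \<partial>M) \<le> (\<integral>\<omega>. H \<omega> + \<beta> * (H \<omega> * c T \<omega> * Y \<omega>)
          + \<beta>\<^sup>2 * (H \<omega> * (c T \<omega>)\<^sup>2 * (Y \<omega>)\<^sup>2) \<partial>M)"
      proof (rule integral_mono[OF integrable_U])
        show "integrable M (\<lambda>\<omega>. H \<omega> + \<beta> * (H \<omega> * c T \<omega> * Y \<omega>) + \<beta>\<^sup>2 * (H \<omega> * (c T \<omega>)\<^sup>2 * (Y \<omega>)\<^sup>2))"
          using int_H int1 int2 by simp
        fix \<omega> assume w: "\<omega> \<in> space M"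
        let ?z = "\<beta> * (c T \<omega> * Y \<omega>)"
        have "exp (U T \<omega>) = H \<omega> * exp ?z"
          using True by (simp add: U_def H_def Y_def T_def exp_add[symmetric])
        also have "\<dots> \<le> H \<omega> * (1 + ?z + ?z\<^sup>2)"
          using small[OF T w] H0 by (intro mult_left_mono exp_le_quadratic) (auto simp: Y_def)
        finally show "exp (U T \<omega>) \<le> H \<omega> + \<beta> * (H \<omega> * c T \<omega> * Y \<omega>) + \<beta>\<^sup>2 * (H \<omega> * (c T \<omega>)\<^sup>2 * (Y \<omega>)\<^sup>2)"
          by (simp add: algebra_simps power_mult_distrib)
      qed
      also have "\<dots> = (\<integral>\<omega>. H \<omega> \<partial>M) + \<beta> * ((\<integral>\<omega>. H \<omega> * c T \<omega> \<partial>M) * (\<integral>\<omega>. Y \<omega> \<partial>M))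
          + \<beta>\<^sup>2 * ((\<integral>\<omega>. H \<omega> * (c T \<omega>)\<^sup>2 \<partial>M) * (\<integral>\<omega>. (Y \<omega>)\<^sup>2 \<partial>M))"
        using int_H int1 int2 prod1 prod2 by simp
      also have "\<dots> \<le> (\<integral>\<omega>. H \<omega> \<partial>M) + \<beta> * ((\<integral>\<omega>. H \<omega> * of_bool (X T \<omega>) \<partial>M) * B * \<mu>)
          + \<beta>\<^sup>2 * ((\<integral>\<omega>. H \<omega> * of_bool (X T \<omega>) \<partial>M) * B\<^sup>2 * V)"
      proof (intro add_mono mult_left_mono)
        have "\<bar>\<integral>\<omega>. H \<omega> * c T \<omega> \<partial>M\<bar> \<le> (\<integral>\<omega>. \<bar>H \<omega> * c T \<omega>\<bar> \<partial>M)"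
          by (rule integral_abs_bound)
        also have "\<dots> \<le> (\<integral>\<omega>. H \<omega> * of_bool (X T \<omega>) * B \<partial>M)"
          using int_Hc int_HX
        proof (intro integral_mono)
          fix \<omega> assume "\<omega> \<in> space M"
          then show "\<bar>H \<omega> * c T \<omega>\<bar> \<le> H \<omega> * of_bool (X T \<omega>) * B"
            using mult_left_mono[OF c_bound[OF T] H0[of \<omega>]] H0[of \<omega>]
            by (simp add: abs_mult mult_ac)
        qed auto
        also have "\<dots> = (\<integral>\<omega>. H \<omega> * of_bool (X T \<omega>) \<partial>M) * B" by simp
        finally have 1: "\<bar>\<integral>\<omega>. H \<omega> * c T \<omega> \<partial>M\<bar> \<le> (\<integral>\<omega>. H \<omega> * of_bool (X T \<omega>) \<partial>M) * B" .
        have "(\<integral>\<omega>. H \<omega> * c T \<omega> \<partial>M) * (\<integral>\<omega>. Y \<omega> \<partial>M)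
            \<le> \<bar>\<integral>\<omega>. H \<omega> * c T \<omega> \<partial>M\<bar> * \<bar>\<integral>\<omega>. Y \<omega> \<partial>M\<bar>"
          by (metis abs_ge_self abs_mult)
        also have "\<dots> \<le> (\<integral>\<omega>. H \<omega> * of_bool (X T \<omega>) \<partial>M) * B * \<mu>"
          using 1 y_mean[OF T] by (intro mult_mono) (auto simp: Y_def intro: order_trans[OF abs_ge_zero])
        finally show "(\<integral>\<omega>. H \<omega> * c T \<omega> \<partial>M) * (\<integral>\<omega>. Y \<omega> \<partial>M)
            \<le> (\<integral>\<omega>. H \<omega> * of_bool (X T \<omega>) \<partial>M) * B * \<mu>" .
        have "(\<integral>\<omega>. H \<omega> * (c T \<omega>)\<^sup>2 \<partial>M) \<le> (\<integral>\<omega>. H \<omega> * of_bool (X T \<omega>) * B\<^sup>2 \<partial>M)"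
          using int_Hc2 int_HX
        proof (intro integral_mono)
          fix \<omega> assume w: "\<omega> \<in> space M"
          have "(c T \<omega>)\<^sup>2 \<le> (B * of_bool (X T \<omega>))\<^sup>2"
            using c_bound[OF T w] pos by (simp add: abs_le_square_iff[symmetric])
          then have "(c T \<omega>)\<^sup>2 \<le> of_bool (X T \<omega>) * B\<^sup>2" by (auto simp: of_bool_def split: if_splits)
          then show "H \<omega> * (c T \<omega>)\<^sup>2 \<le> H \<omega> * of_bool (X T \<omega>) * B\<^sup>2"
            using mult_left_mono[OF _ H0[of \<omega>]] by (simp add: mult.assoc)
        qed auto
        then show "(\<integral>\<omega>. H \<omega> * (c T \<omega>)\<^sup>2 \<partial>M) * (\<integral>\<omega>. (Y \<omega>)\<^sup>2 \<partial>M)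
            \<le> (\<integral>\<omega>. H \<omega> * of_bool (X T \<omega>) \<partial>M) * B\<^sup>2 * V"
          using y_square[OF T] H0
          by (intro mult_mono) (auto simp: Y_def intro!: integral_nonneg_AE AE_I2)
      qed (use pos in auto)
      also have "\<dots> = (\<integral>\<omega>. H \<omega> \<partial>M) + \<kappa> * (\<integral>\<omega>. H \<omega> * of_bool (X T \<omega>) \<partial>M)"
        by (simp add: \<kappa>_def algebra_simps)
      also have "\<dots> = (\<integral>\<omega>. H \<omega> + \<kappa> * (H \<omega> * of_bool (X T \<omega>)) \<partial>M)"
        using int_H int_HX by simp
      also have "\<dots> \<le> (\<integral>\<omega>. exp (U t \<omega>) \<partial>M)"
      proof (rule integral_mono[OF _ integrable_U])
        show "integrable M (\<lambda>\<omega>. H \<omega> + \<kappa> * (H \<omega> * of_bool (X T \<omega>)))" using int_H int_HX by simp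
        fix \<omega>
        have "H \<omega> + \<kappa> * (H \<omega> * of_bool (X T \<omega>)) = H \<omega> * (1 + \<kappa> * of_bool (X T \<omega>))"
          by (simp add: algebra_simps)
        also have "\<dots> \<le> H \<omega> * exp (\<kappa> * of_bool (X T \<omega>))"
          using H0 exp_ge_add_one_self by (intro mult_left_mono) auto
        also have "\<dots> = exp (U t \<omega>)" by (simp add: H_def exp_add[symmetric])
        finally show "H \<omega> + \<kappa> * (H \<omega> * of_bool (X T \<omega>)) \<le> exp (U t \<omega>)" .
      qed
      also have "\<dots> \<le> 1" by (rule Suc.IH)
      finally show ?thesis by (simp add: T_def)
    qed
  qed
  then show "(\<integral>\<^sup>+\<omega>. ennreal (exp (U t \<omega>)) \<partial>M) \<le> 1"
    using integrable_U[of t] by (simp add: nn_integral_eq_integral)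
qed

end

section \<open>The law of the exploration draws\<close>

definition gaussian_law :: "real \<Rightarrow> (real ^ 'n::finite) measure" where
  "gaussian_law \<sigma> = density lborel (\<lambda>x. ennreal (\<Prod>i\<in>UNIV. normal_density 0 \<sigma> (x $ i)))"

lemma sets_gaussian_law [measurable_cong, simp]: "sets (gaussian_law \<sigma>) = sets borel"
  by (simp add: gaussian_law_def)

lemma gaussian_law_open_pos:
  fixes U :: "(real ^ 'n::finite) set"
  assumes "0 < \<sigma>" "open U" "U \<noteq> {}"
  shows "emeasure (gaussian_law \<sigma>) U \<noteq> 0"
proof
  let ?f = "\<lambda>x::real^'n. ennreal (\<Prod>i\<in>UNIV. normal_density 0 \<sigma> (x $ i))"
  assume "emeasure (gaussian_law \<sigma>) U = 0"
  then have "(\<integral>\<^sup>+x. ?f x * indicator U x \<partial>lborel) = 0"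
    using \<open>open U\<close> by (simp add: gaussian_law_def emeasure_density)
  then have "AE x in lborel. ?f x * indicator U x = 0"
    using \<open>open U\<close> by (subst (asm) nn_integral_0_iff_AE) auto
  moreover have "?f x \<noteq> 0" for x
    using \<open>0 < \<sigma>\<close> by (simp add: prod_pos normal_density_pos ennreal_eq_0_iff not_le)
  ultimately have "AE x in lborel. x \<notin> U" by (auto simp: indicator_def)
  then have "U \<in> null_sets lborel" using \<open>open U\<close> by (simp add: AE_iff_null_sets)
  then have "negligible U" by (simp add: negligible_iff_null_sets null_sets_completionI)
  with assms show False using open_not_negligible by blast
qed

text \<open>With \<open>\<beta> = 1 / (4 \<sigma>\<^sup>2)\<close> the Gaussian density of variance \<open>\<sigma>\<^sup>2\<close> times \<open>exp (\<beta> y\<^sup>2)\<close> is \<open>\<surd>2\<close> times the one of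
  variance \<open>2 \<sigma>\<^sup>2\<close>, so the integral is \<open>\<surd>2\<close> per coordinate, which \<open>K\<close> compensates.\<close>

lemma gaussian_law_exp_square:
  assumes "0 < \<sigma>"
  shows "\<exists>\<beta>>0. \<exists>K. (\<integral>\<^sup>+x. ennreal (exp (\<beta> * (norm (x :: real ^ 'n::finite))\<^sup>2 - K)) \<partial>gaussian_law \<sigma>) \<le> 1"
proof -
  define \<beta> where "\<beta> = 1 / (4 * \<sigma>\<^sup>2)"
  define K where "K = real CARD('n) * ln (sqrt 2)"
  have \<beta>: "0 < \<beta>" using assms by (simp add: \<beta>_def)
  have one: "normal_density 0 \<sigma> y * exp (\<beta> * y\<^sup>2) / sqrt 2 = normal_density 0 (sqrt 2 * \<sigma>) y" for y
  proof -
    have "- (y\<^sup>2) / (2 * \<sigma>\<^sup>2) + \<beta> * y\<^sup>2 = - (y\<^sup>2) / (2 * (sqrt 2 * \<sigma>)\<^sup>2)"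
      using assms by (simp add: \<beta>_def power_mult_distrib field_simps)
    moreover have "sqrt (2 * pi * (sqrt 2 * \<sigma>)\<^sup>2) = sqrt (2 * pi * \<sigma>\<^sup>2) * sqrt 2"
      by (simp add: power_mult_distrib real_sqrt_mult[symmetric] mult_ac)
    ultimately show ?thesis
      by (simp add: normal_density_def mult_exp_exp)
  qed
  have expand: "(\<Prod>i\<in>UNIV. normal_density 0 \<sigma> (x $ i)) * exp (\<beta> * (norm x)\<^sup>2 - K)
      = (\<Prod>b\<in>Basis. normal_density 0 (sqrt 2 * \<sigma>) (x \<bullet> b))" for x :: "real ^ 'n"
  proof -
    have norm: "(norm x)\<^sup>2 = (\<Sum>i\<in>UNIV. (x $ i)\<^sup>2)"
      unfolding power2_norm_eq_inner inner_vec_def by (simp add: power2_eq_square)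
    have "exp (\<beta> * (norm x)\<^sup>2 - K) = (\<Prod>i\<in>UNIV. exp (\<beta> * (x $ i)\<^sup>2)) / exp K"
      by (simp add: norm exp_diff sum_distrib_left exp_sum)
    also have "exp K = (\<Prod>i\<in>(UNIV::'n set). sqrt 2)"
      by (simp add: K_def exp_of_nat_mult)
    finally have "(\<Prod>i\<in>UNIV. normal_density 0 \<sigma> (x $ i)) * exp (\<beta> * (norm x)\<^sup>2 - K)
      = (\<Prod>i\<in>UNIV. normal_density 0 \<sigma> (x $ i) * exp (\<beta> * (x $ i)\<^sup>2) / sqrt 2)"
      by (simp add: prod.distrib prod_dividef)
    also have "\<dots> = (\<Prod>i\<in>UNIV. normal_density 0 (sqrt 2 * \<sigma>) (x \<bullet> axis i 1))"
      by (simp add: one inner_axis)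
    also have "\<dots> = (\<Prod>b\<in>range (\<lambda>i. axis i 1). normal_density 0 (sqrt 2 * \<sigma>) (x \<bullet> b))"
      by (subst prod.reindex) (auto simp: inj_on_def axis_eq_axis)
    also have "range (\<lambda>i. axis i 1) = (Basis :: (real ^ 'n) set)"
      by (auto simp: Basis_vec_def)
    finally show ?thesis .
  qed
  have total: "(\<integral>\<^sup>+y. ennreal (normal_density 0 (sqrt 2 * \<sigma>) y) \<partial>lborel) = 1"
  proof -
    have "prob_space (density lborel (\<lambda>y. ennreal (normal_density 0 (sqrt 2 * \<sigma>) y)))"
      using assms by (intro prob_space_normal_density) simp
    then show ?thesis
      using prob_space.emeasure_space_1 by (fastforce simp: emeasure_density)
  qed
  have "(\<integral>\<^sup>+x. ennreal (exp (\<beta> * (norm (x :: real ^ 'n))\<^sup>2 - K)) \<partial>gaussian_law \<sigma>)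
      = (\<integral>\<^sup>+x. ennreal ((\<Prod>i\<in>UNIV. normal_density 0 \<sigma> (x $ i)) * exp (\<beta> * (norm x)\<^sup>2 - K)) \<partial>(lborel :: (real^'n) measure))"
    unfolding gaussian_law_def by (subst nn_integral_density) (auto simp: ennreal_mult'' prod_nonneg)
  also have "\<dots> = (\<integral>\<^sup>+x. (\<Prod>b\<in>Basis. ennreal (normal_density 0 (sqrt 2 * \<sigma>) (x \<bullet> b))) \<partial>(lborel :: (real^'n) measure))"
    unfolding expand by (simp add: prod_ennreal)
  also have "\<dots> = 1"
    by (subst nn_integral_lborel_prod) (auto simp: total)
  finally show ?thesis using \<beta> by (intro exI[of _ \<beta>] conjI exI[of _ K]) auto
qed

section \<open>Sample paths of the algorithm\<close>

locale incentive_learning = polynomial_game Xs l mon Theta_star xd ud + prob_space M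
  for Xs :: "'n::finite \<Rightarrow> real set" and l and mon :: "'m::finite \<Rightarrow> 'n \<Rightarrow> nat"
    and Theta_star xd ud and M :: "'w measure" +
  fixes e w :: "nat \<Rightarrow> 'w \<Rightarrow> real ^ 'n"
    and \<gamma> \<sigma> :: real
    and S1 :: "real ^ 'm ^ 'm"
    and p1 :: "real ^ 'n"
    and T1 :: "real ^ 'm ^ 'n"
    and p :: "nat \<Rightarrow> 'w \<Rightarrow> real ^ 'n"
    and S :: "nat \<Rightarrow> 'w \<Rightarrow> real ^ 'm ^ 'm"
    and Theta :: "nat \<Rightarrow> 'w \<Rightarrow> real ^ 'm ^ 'n"
  assumes inj_mon: "inj mon"
    and noise: "noise_assumption M e"
    and rate: "1 / 2 \<le> \<gamma>" "\<gamma> < 1"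
    and \<sigma>_pos: "0 < \<sigma>"
    and draws: "exploration_draws M e \<sigma> w"
    and init: "sym_pos_def S1"
    and algorithm: "\<And>\<omega>. \<omega> \<in> space M \<Longrightarrow>
        algorithm_path (action_profiles Xs) mon (nash_response Xs l xd ud) xd \<gamma> S1 p1 T1
          (\<lambda>t. e t \<omega>) (\<lambda>t. w t \<omega>) (\<lambda>t. p t \<omega>) (\<lambda>t. S t \<omega>) (\<lambda>t. Theta t \<omega>)"
begin

definition explored :: "nat \<Rightarrow> 'w \<Rightarrow> bool" where
  "explored t \<omega> \<longleftrightarrow> explores \<gamma> (S (t - 1) \<omega>) (t - 1)"

text \<open>The factor \<open>\<delta>\<close> of the algorithm, which discards responses on the boundary, is absorbed into the
  feature vector.\<close>

definition gated_features :: "real ^ 'n \<Rightarrow> real ^ 'm" where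
  "gated_features v = indicator (interior X) (xs v) *\<^sub>R features mon (xs v)"

definition regressor :: "nat \<Rightarrow> 'w \<Rightarrow> real ^ 'm" where
  "regressor t \<omega> = (if explored t \<omega> then gated_features (w t \<omega>) else 0)"

definition explorations :: "nat \<Rightarrow> 'w \<Rightarrow> real" where
  "explorations t \<omega> = (\<Sum>s=2..t. of_bool (explored s \<omega>))"

definition err :: "nat \<Rightarrow> 'w \<Rightarrow> real ^ 'm ^ 'n" where
  "err t \<omega> = Theta t \<omega> - Theta_star"

lemma S_update_zero: "S_update 1 0 A = A" and rls_error_zero: "rls_error 0 A \<epsilon> B = B"
  by (simp_all add: S_update_def rls_error_def)

text \<open>All rounds follow one recursion: where nothing is learnt the regressor is zero, and elsewhere
  the response is interior, so that the observed parameter satisfies the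
  regression equation.\<close>

lemma path_step:
  assumes \<omega>: "\<omega> \<in> space M" and t: "2 \<le> t"
  shows "S t \<omega> = S_update 1 (regressor t \<omega>) (S (t - 1) \<omega>)"
    and "err t \<omega> = rls_error (regressor t \<omega>) (S (t - 1) \<omega>) (e t \<omega>) (err (t - 1) \<omega>)"
    and "explored t \<omega> \<Longrightarrow> p t \<omega> = w t \<omega>"
    and "\<not> explored t \<omega> \<Longrightarrow> p t \<omega> = - (Theta (t - 1) \<omega> *v features mon xd)"
proof -
  let ?x = "xs (p t \<omega>)"
  let ?\<delta> = "indicator (interior X) ?x :: real"
  note step = algorithm[OF \<omega>, unfolded algorithm_path_def Let_def, THEN conjunct2, THEN conjunct2,
      THEN conjunct2, rule_format, OF t, folded explored_def]
  have "S t \<omega> = S_update 1 (regressor t \<omega>) (S (t - 1) \<omega>) \<and>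
    err t \<omega> = rls_error (regressor t \<omega>) (S (t - 1) \<omega>) (e t \<omega>) (err (t - 1) \<omega>)"
  proof (cases "explored t \<omega>")
    case True
    then have p: "p t \<omega> = w t \<omega>"
      and T: "Theta t \<omega> = Theta_update ?\<delta> (features mon ?x) (S (t - 1) \<omega>) (p t \<omega> + e t \<omega>) (Theta (t - 1) \<omega>)"
      and S: "S t \<omega> = S_update ?\<delta> (features mon ?x) (S (t - 1) \<omega>)"
      using step by auto
    have \<delta>: "?\<delta> = 0 \<or> ?\<delta> = 1" by (auto simp: indicator_def)
    have "regressor t \<omega> = ?\<delta> *\<^sub>R features mon ?x" using True by (simp add: regressor_def gated_features_def p)
    moreover have "p t \<omega> + e t \<omega> + Theta_star *v features mon ?x = e t \<omega>" if "?\<delta> = 1"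
    proof -
      have "p t \<omega> = - F ?x" using that by (intro interior_response) (simp add: indicator_def split: if_splits)
      then have "p t \<omega> + F ?x = 0" by (metis eq_neg_iff_add_eq_0)
      then show ?thesis by (simp add: add.assoc add.left_commute)
    qed
    note response = this
    moreover have "Theta_update ?\<delta> (features mon ?x) (S (t - 1) \<omega>) (p t \<omega> + e t \<omega>) (Theta (t - 1) \<omega>) - Theta_star
        = rls_error (?\<delta> *\<^sub>R features mon ?x) (S (t - 1) \<omega>) (e t \<omega>) (Theta (t - 1) \<omega> - Theta_star)"
      by (rule Theta_update_gating[OF \<delta> response])
    ultimately show ?thesis
      using S_update_gating[OF \<delta>] by (simp add: S T err_def)
  next
    case False
    then show ?thesis using step by (simp add: regressor_def err_def S_update_zero rls_error_zero)
  qed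
  then show "S t \<omega> = S_update 1 (regressor t \<omega>) (S (t - 1) \<omega>)"
    "err t \<omega> = rls_error (regressor t \<omega>) (S (t - 1) \<omega>) (e t \<omega>) (err (t - 1) \<omega>)" by auto
  show "explored t \<omega> \<Longrightarrow> p t \<omega> = w t \<omega>"
    "\<not> explored t \<omega> \<Longrightarrow> p t \<omega> = - (Theta (t - 1) \<omega> *v features mon xd)"
    using step by auto
qed

lemma path_init: "\<omega> \<in> space M \<Longrightarrow> S 1 \<omega> = S1" "\<omega> \<in> space M \<Longrightarrow> err 1 \<omega> = T1 - Theta_star"
  using algorithm by (auto simp: algorithm_path_def err_def)

definition P1 :: "real ^ 'm ^ 'm" where
  "P1 = (SOME P. P ** S1 = mat 1 \<and> (\<forall>v. 0 \<le> v \<bullet> (P *v v)))"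

lemma P1: "P1 ** S1 = mat 1" "0 \<le> v \<bullet> (P1 *v v)"
proof -
  have "\<exists>P. P ** S1 = mat 1 \<and> (\<forall>v. 0 \<le> v \<bullet> (P *v v))"
    using sym_pos_def_inverse[OF init] by blast
  from someI_ex[OF this] show "P1 ** S1 = mat 1" "0 \<le> v \<bullet> (P1 *v v)"
    unfolding P1_def by auto
qed

lemma rls_path:
  assumes "\<omega> \<in> space M"
  shows "rls (\<lambda>t. S t \<omega>) (\<lambda>t. err t \<omega>) (\<lambda>t. regressor t \<omega>) (\<lambda>t. e t \<omega>) P1"
proof
  show "transpose (S 1 \<omega>) = S 1 \<omega>" using init path_init[OF assms] by (simp add: sym_pos_def_def)
qed (use path_step[OF assms] path_init[OF assms] P1 in auto)

lemma gated_features_bounded: "\<exists>B>0. \<forall>v. norm (gated_features v) \<le> B"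
proof -
  have "compact (features mon ` X)"
    by (intro compact_continuous_image continuous_intros compact_X)
  then have "bounded (features mon ` X)" by (rule compact_imp_bounded)
  then obtain B where B: "0 < B" "\<And>x. x \<in> X \<Longrightarrow> norm (features mon x) \<le> B"
    unfolding bounded_pos by blast
  then have "norm (gated_features v) \<le> B" for v
    using xs_in_X[of v] by (auto simp: gated_features_def indicator_def less_imp_le)
  then show ?thesis using B by blast
qed

lemma measurable_xs [measurable]: "xs \<in> borel_measurable borel"
  by (intro borel_measurable_continuous_onI continuous_on_xs)

lemma measurable_gated_features [measurable]: "gated_features \<in> borel_measurable borel"
proof -
  have [measurable]: "features mon \<in> borel_measurable borel"
    by (intro borel_measurable_continuous_onI continuous_intros)
  have [measurable]: "interior X \<in> sets borel" by simp
  show ?thesis unfolding gated_features_def by measurable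
qed

lemma indep_w: "indep_vars (\<lambda>_. borel) w {2..}"
proof -
  have "indep_vars (\<lambda>_. borel) (case_sum e w) ({1..} <+> {2..})"
    using draws unfolding exploration_draws_def by blast
  then have "indep_vars (\<lambda>t. PiM {Inr t} (\<lambda>_. borel)) (\<lambda>t \<omega>. restrict (\<lambda>i. case_sum e w i \<omega>) {Inr t}) {2..}"
    by (rule indep_vars_restrict) (auto simp: disjoint_family_on_def)
  from indep_vars_compose2[OF this, of "\<lambda>t h. h (Inr t)" "\<lambda>_. borel"] show ?thesis
    by simp
qed

lemma nn_integral_w:
  assumes "2 \<le> t" "g \<in> borel_measurable borel"
  shows "(\<integral>\<^sup>+\<omega>. g (w t \<omega>) \<partial>M) = (\<integral>\<^sup>+x. g x \<partial>gaussian_law \<sigma>)"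
proof -
  have d: "distributed M lborel (w t) (\<lambda>x. ennreal (\<Prod>i\<in>UNIV. normal_density 0 \<sigma> (x $ i)))"
    using draws assms by (auto simp: exploration_draws_def)
  then have "w t \<in> M \<rightarrow>\<^sub>M lborel" by (rule distributed_measurable)
  then have "(\<integral>\<^sup>+\<omega>. g (w t \<omega>) \<partial>M) = (\<integral>\<^sup>+x. g x \<partial>distr M lborel (w t))"
    using assms by (intro nn_integral_distr[symmetric]) auto
  then show ?thesis
    using distributed_distr_eq_density[OF d] by (simp add: gaussian_law_def)
qed

lemma measurable_S_update:
  assumes [measurable]: "h \<in> borel_measurable N" "A \<in> borel_measurable N"
  shows "(\<lambda>\<omega>. S_update 1 (h \<omega>) (A \<omega> :: real ^ 'm ^ 'm)) \<in> borel_measurable N"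
proof -
  have c1: "continuous_on UNIV (\<lambda>x::(real ^ 'm) \<times> (real ^ 'm ^ 'm). fst x \<bullet> (snd x *v fst x))"
    unfolding matrix_vector_mult_def inner_vec_def by (intro continuous_intros)
  have c2: "continuous_on UNIV (\<lambda>x::(real ^ 'm) \<times> (real ^ 'm ^ 'm). outer (snd x *v fst x) (fst x v* snd x))"
    unfolding matrix_vector_mult_def vector_matrix_mult_def outer_def vec_lambda_beta
    by (intro continuous_on_vec_lambda continuous_intros)
  have pair: "(\<lambda>\<omega>. (h \<omega>, A \<omega>)) \<in> borel_measurable N"
    by (rule borel_measurable_Pair) measurable
  have [measurable]: "(\<lambda>\<omega>. h \<omega> \<bullet> (A \<omega> *v h \<omega>)) \<in> borel_measurable N"
    using measurable_compose[OF pair borel_measurable_continuous_onI[OF c1]] by simp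
  have [measurable]: "(\<lambda>\<omega>. outer (A \<omega> *v h \<omega>) (h \<omega> v* A \<omega>)) \<in> borel_measurable N"
    using measurable_compose[OF pair borel_measurable_continuous_onI[OF c2]] by simp
  show ?thesis unfolding S_update_def by measurable
qed

lemma pred_explores:
  assumes A: "A \<in> borel_measurable N"
  shows "Measurable.pred N (\<lambda>\<omega>. explores \<gamma> (A \<omega> :: real ^ 'm ^ 'm) t)"
proof -
  have "continuous_on UNIV (\<lambda>x::real ^ 'm ^ 'm. trace x)"
    unfolding trace_def by (intro continuous_intros)
  from measurable_compose[OF A borel_measurable_continuous_onI[OF this]]
  have [measurable]: "(\<lambda>\<omega>. trace (A \<omega>)) \<in> borel_measurable N" .
  show ?thesis unfolding explores_def by measurable
qed

text \<open>The gain never depends on the noise, only on the draws up to its own round. The exploration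
  times are therefore independent of the noise.\<close>

lemma measurable_S: "1 \<le> t \<Longrightarrow> S t \<in> borel_measurable (past M w {2..t})"
proof (induction t rule: dec_induct)
  case base
  show ?case
    using path_init by (subst measurable_cong[of _ _ "\<lambda>_. S1"]) auto
next
  case (step t)
  let ?N = "past M w {2..Suc t}"
  have S[measurable]: "S t \<in> borel_measurable ?N"
    by (rule measurable_past_mono[OF step.IH]) auto
  have [measurable]: "w (Suc t) \<in> borel_measurable ?N"
    using step.hyps by (intro measurable_past) auto
  have [measurable]: "Measurable.pred ?N (explored (Suc t))"
    unfolding explored_def[abs_def] using pred_explores[OF S] by simp
  have "(\<lambda>\<omega>. S_update 1 (regressor (Suc t) \<omega>) (S t \<omega>)) \<in> borel_measurable ?N"
    unfolding regressor_def by (intro measurable_S_update) measurable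
  moreover have "S (Suc t) \<omega> = S_update 1 (regressor (Suc t) \<omega>) (S t \<omega>)" if "\<omega> \<in> space ?N" for \<omega>
    using path_step(1)[of \<omega> "Suc t"] that step.hyps by simp
  ultimately show ?case by (subst measurable_cong) auto
qed

lemma pred_explored: "2 \<le> t \<Longrightarrow> Measurable.pred (past M w {2..<t}) (explored t)"
proof -
  assume t: "2 \<le> t"
  then have "{2..<t} = {2..t - 1}" by auto
  then show ?thesis
    unfolding explored_def[abs_def] using measurable_S[of "t - 1"] t by (auto intro: pred_explores)
qed

lemma measurable_regressor: "2 \<le> t \<Longrightarrow> regressor t \<in> borel_measurable (past M w {2..t})"
proof -
  assume t: "2 \<le> t"
  have [measurable]: "Measurable.pred (past M w {2..t}) (explored t)"
    by (rule measurable_past_mono[OF pred_explored[OF t]]) auto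
  have [measurable]: "w t \<in> borel_measurable (past M w {2..t})"
    using t by (intro measurable_past) auto
  show ?thesis unfolding regressor_def[abs_def] by measurable
qed

end

section \<open>Number of explorations and growth of the information matrix\<close>

lemma A_rate_mono: "0 \<le> \<gamma> \<Longrightarrow> 1 \<le> s \<Longrightarrow> s \<le> t \<Longrightarrow> A_rate \<gamma> s \<le> A_rate \<gamma> t"
  unfolding A_rate_def by (intro mult_mono powr_mono2) auto

lemma A_rate_at_top:
  assumes "0 < \<gamma>"
  shows "filterlim (A_rate \<gamma>) at_top sequentially"
  unfolding A_rate_def[abs_def] using assms by real_asymp

context incentive_learning
begin

lemma explorations_nonneg [simp]: "0 \<le> explorations t \<omega>"
  by (simp add: explorations_def sum_nonneg)

lemma explorations_Suc: "1 \<le> t \<Longrightarrow> explorations (Suc t) \<omega> = explorations t \<omega> + of_bool (explored (Suc t) \<omega>)"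
  by (simp add: explorations_def)

lemma explorations_le: "explorations t \<omega> \<le> real t"
proof -
  have "explorations t \<omega> \<le> (\<Sum>s=2..t. 1)" unfolding explorations_def by (intro sum_mono) auto
  then show ?thesis by simp
qed

lemma regressor_square_le:
  assumes "\<And>v. norm (gated_features v) \<le> B"
  shows "(v \<bullet> regressor s \<omega>)\<^sup>2 \<le> B\<^sup>2 * (norm v)\<^sup>2 * of_bool (explored s \<omega>)"
proof -
  have "\<bar>v \<bullet> gated_features x\<bar> \<le> norm v * B" for x
    using assms[of x] Cauchy_Schwarz_ineq2[of v "gated_features x"]
    by (meson mult_left_mono norm_ge_zero order_trans)
  then have "(v \<bullet> gated_features x)\<^sup>2 \<le> (norm v * B)\<^sup>2" for x
    by (metis abs_ge_zero power2_abs power_mono)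
  then show ?thesis by (simp add: regressor_def power_mult_distrib mult.commute)
qed

text \<open>Boundedness of the regressors yields \<open>A \<le> C1 + K n\<close> on every path. As \<open>A\<close> is \<open>log t\<close> times an
  unbounded factor, both the constant and any multiple of \<open>log t\<close> are
  eventually negligible.\<close>

lemma rate_le_explorations: "\<exists>K>0. \<forall>\<omega>\<in>space M. eventually (\<lambda>t. A_rate \<gamma> t \<le> K * explorations t \<omega>) sequentially"
  and ln_le_explorations: "\<omega> \<in> space M \<Longrightarrow> eventually (\<lambda>t. C * ln (real t) \<le> explorations t \<omega>) sequentially"
proof -
  obtain B where B: "0 < B" "\<And>v. norm (gated_features v) \<le> B" using gated_features_bounded by blast
  let ?a = "axis undefined 1 :: real ^ 'm"
  define C0 where "C0 = ?a \<bullet> (P1 *v ?a) + 1"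
  have C0: "0 < C0" using P1(2)[of ?a] by (simp add: C0_def)
  have tr: "1 / (C0 + B\<^sup>2 * explorations t \<omega>) \<le> trace (S t \<omega>)" if \<omega>: "\<omega> \<in> space M" and t: "1 \<le> t" for \<omega> t
  proof -
    interpret r: rls "\<lambda>t. S t \<omega>" "\<lambda>t. err t \<omega>" "\<lambda>t. regressor t \<omega>" "\<lambda>t. e t \<omega>" P1
      by (rule rls_path[OF \<omega>])
    have "(\<Sum>s=2..t. (?a \<bullet> regressor s \<omega>)\<^sup>2) \<le> (\<Sum>s=2..t. B\<^sup>2 * of_bool (explored s \<omega>))"
      using regressor_square_le[OF B(2), of ?a] by (intro sum_mono) simp
    then have "?a \<bullet> (r.P t *v ?a) \<le> C0 + B\<^sup>2 * explorations t \<omega>"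
      unfolding r.quadratic_form_P C0_def explorations_def sum_distrib_left by linarith
    then show ?thesis
      using C0 by (intro r.trace_lower_bound[OF t]) (auto intro: add_pos_nonneg)
  qed
  obtain C1 K where CK: "0 < C1" "0 < K" and lower: "\<forall>S n.
    (\<forall>t\<ge>1. 1 / (C0 + B\<^sup>2 * n t) \<le> trace (S t :: real ^ 'm ^ 'm)) \<longrightarrow> (\<forall>t. 0 \<le> n t) \<longrightarrow>
    (\<forall>t\<ge>1. n (Suc t) = n t + of_bool (explores \<gamma> (S t) t)) \<longrightarrow>
    (\<forall>t\<ge>1. A_rate \<gamma> t \<le> C1 + K * n t)"
    using exploration_count_lower_bound[of \<gamma> C0 "B\<^sup>2"] rate C0 by auto
  have ineq: "A_rate \<gamma> t \<le> C1 + K * explorations t \<omega>" if "\<omega> \<in> space M" "1 \<le> t" for \<omega> t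
    using lower[rule_format, of "\<lambda>t. explorations t \<omega>" "\<lambda>t. S t \<omega>" t] tr[OF that(1)] that(2)
    by (simp add: explorations_Suc explored_def)
  have ln: "eventually (\<lambda>t. C * ln (real t) \<le> explorations t \<omega>) sequentially" if \<omega>: "\<omega> \<in> space M" for C \<omega>
  proof -
    have "filterlim (\<lambda>t. real t powr \<gamma>) at_top sequentially" using rate by real_asymp
    then have "eventually (\<lambda>t. \<bar>C\<bar> * K + C1 \<le> real t powr \<gamma>) sequentially"
      by (simp add: filterlim_at_top)
    moreover have "eventually (\<lambda>t. 1 \<le> ln (real t)) sequentially" by real_asymp
    ultimately show ?thesis using eventually_ge_at_top[of 1]
    proof eventually_elim
      case (elim t)
      have "K * (\<bar>C\<bar> * ln (real t)) + C1 \<le> (\<bar>C\<bar> * K + C1) * ln (real t)"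
        using elim CK by (simp add: algebra_simps)
      also have "\<dots> \<le> A_rate \<gamma> t" unfolding A_rate_def using elim by (intro mult_right_mono) auto
      also have "\<dots> \<le> C1 + K * explorations t \<omega>" using ineq[OF \<omega>] elim by simp
      finally have "\<bar>C\<bar> * ln (real t) \<le> explorations t \<omega>" using CK by simp
      moreover have "C * ln (real t) \<le> \<bar>C\<bar> * ln (real t)" using elim by (intro mult_right_mono) auto
      ultimately show ?case by linarith
    qed
  qed
  show "\<omega> \<in> space M \<Longrightarrow> eventually (\<lambda>t. C * ln (real t) \<le> explorations t \<omega>) sequentially" by (rule ln)
  have "eventually (\<lambda>t. A_rate \<gamma> t \<le> (C1 + K) * explorations t \<omega>) sequentially" if \<omega>: "\<omega> \<in> space M" for \<omega>
  proof -
    have "eventually (\<lambda>t. 1 \<le> ln (real t)) sequentially" by real_asymp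
    then show ?thesis using ln[OF \<omega>, of 1] eventually_ge_at_top[of 1]
    proof eventually_elim
      case (elim t)
      have "C1 * 1 \<le> C1 * explorations t \<omega>" using elim CK by (intro mult_left_mono) auto
      then show ?case using ineq[OF \<omega>, of t] elim by (simp add: algebra_simps)
    qed
  qed
  then show "\<exists>K>0. \<forall>\<omega>\<in>space M. eventually (\<lambda>t. A_rate \<gamma> t \<le> K * explorations t \<omega>) sequentially"
    using CK by (intro exI[of _ "C1 + K"]) auto
qed

lemma prob_space_gaussian_law: "prob_space (gaussian_law \<sigma> :: (real ^ 'n) measure)"
proof
  show "emeasure (gaussian_law \<sigma> :: (real ^ 'n) measure) (space (gaussian_law \<sigma>)) = 1"
    using nn_integral_w[of 2 "\<lambda>_. 1"] by (simp add: emeasure_space_1)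
qed

lemma exploration_selection_growth:
  assumes "\<phi> \<in> borel_measurable borel"
    and "(\<integral>\<^sup>+x. ennreal (exp (\<phi> x)) \<partial>gaussian_law \<sigma>) \<le> 1"
  shows "AE \<omega> in M. eventually
    (\<lambda>t. (\<Sum>s=2..t. if explored s \<omega> then \<phi> (w s \<omega>) else 0) \<le> 2 * ln (real t)) sequentially"
  using assms nn_integral_w[of _ "\<lambda>x. ennreal (exp (\<phi> x))"]
  by (intro predictable_selection_log_growth[OF indep_w pred_explored]) auto

text \<open>A Chernoff bound from below for the number of explored draws in \<open>U\<close>. With \<open>q\<close> the Gaussian
  probability of \<open>U\<close>, the variable \<open>b - 1\<^sub>U\<close> has exponential moment exactly one if
  \<open>exp (- b) = 1 - (1 - exp (- 1)) q\<close>, and then \<open>b n\<close> eventually exceeds the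
  number of visits by at most \<open>2 log t\<close>, which costs no more than half of \<open>b\<close>.\<close>

lemma open_set_visits:
  assumes "open U" "U \<noteq> {}"
  shows "\<exists>b>0. AE \<omega> in M. eventually (\<lambda>t. b * explorations t \<omega>
    \<le> (\<Sum>s=2..t. if explored s \<omega> then indicator U (w s \<omega>) else 0)) sequentially"
proof -
  let ?L = "gaussian_law \<sigma> :: (real ^ 'n) measure"
  interpret L: prob_space ?L by (rule prob_space_gaussian_law)
  define q where "q = measure ?L U"
  have U[measurable]: "U \<in> sets borel" using assms by auto
  have q: "0 < q" "q \<le> 1"
    using gaussian_law_open_pos[OF \<sigma>_pos assms] by (auto simp: q_def L.emeasure_eq_measure zero_less_measure_iff)
  define \<theta> where "\<theta> = 1 - exp (-1::real)"
  have \<theta>: "0 < \<theta>" "\<theta> < 1" by (auto simp: \<theta>_def)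
  have \<theta>q: "0 < \<theta> * q" "\<theta> * q < 1"
  proof -
    have "\<theta> * q \<le> \<theta> * 1" using \<theta> q by (intro mult_left_mono) auto
    then show "\<theta> * q < 1" using \<theta> by linarith
  qed (use \<theta> q in simp)
  define b where "b = - ln (1 - \<theta> * q)"
  have b: "0 < b" using \<theta>q by (simp add: b_def)
  define \<phi> where "\<phi> x = b - indicator U x" for x :: "real ^ 'n"
  have [measurable]: "\<phi> \<in> borel_measurable borel" unfolding \<phi>_def by measurable
  have exp_\<phi>: "exp (\<phi> x) = exp b - exp b * \<theta> * indicator U x" for x
    by (auto simp: \<phi>_def \<theta>_def indicator_def exp_diff exp_minus algebra_simps divide_inverse)
  have "(\<integral>\<^sup>+x. ennreal (exp (\<phi> x)) \<partial>?L) = ennreal (\<integral>x. exp b - exp b * \<theta> * indicator U x \<partial>?L)"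
    unfolding exp_\<phi>[symmetric]
  proof (rule nn_integral_eq_integral)
    show "integrable ?L (\<lambda>x. exp (\<phi> x))"
      unfolding exp_\<phi> by (intro Bochner_Integration.integrable_diff integrable_mult_right) 
         (auto simp: L.emeasure_eq_measure)
  qed simp
  also have "(\<integral>x. exp b - exp b * \<theta> * indicator U x \<partial>?L) = exp b - exp b * \<theta> * q"
    by (subst Bochner_Integration.integral_diff) (auto simp: q_def L.emeasure_eq_measure L.prob_space)
  also have "exp b - exp b * \<theta> * q = exp b * (1 - \<theta> * q)" by (simp add: algebra_simps)
  also have "\<dots> = 1" using \<theta>q by (simp add: b_def exp_minus)
  finally have "AE \<omega> in M. eventually
    (\<lambda>t. (\<Sum>s=2..t. if explored s \<omega> then \<phi> (w s \<omega>) else 0) \<le> 2 * ln (real t)) sequentially"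
    by (intro exploration_selection_growth) auto
  then have "AE \<omega> in M. eventually (\<lambda>t. b / 2 * explorations t \<omega>
    \<le> (\<Sum>s=2..t. if explored s \<omega> then indicator U (w s \<omega>) else 0)) sequentially"
  proof (rule AE_mp, intro AE_I2 impI)
    fix \<omega> assume \<omega>: "\<omega> \<in> space M"
    assume "eventually (\<lambda>t. (\<Sum>s=2..t. if explored s \<omega> then \<phi> (w s \<omega>) else 0) \<le> 2 * ln (real t)) sequentially"
    then show "eventually (\<lambda>t. b / 2 * explorations t \<omega>
        \<le> (\<Sum>s=2..t. if explored s \<omega> then indicator U (w s \<omega>) else 0)) sequentially"
      using ln_le_explorations[OF \<omega>, of "4 / b"]
    proof eventually_elim
      case (elim t)
      have "(\<Sum>s=2..t. if explored s \<omega> then \<phi> (w s \<omega>) else 0)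
          = (\<Sum>s=2..t. b * of_bool (explored s \<omega>) - (if explored s \<omega> then indicator U (w s \<omega>) else 0))"
        by (intro sum.cong) (auto simp: \<phi>_def)
      also have "\<dots> = b * explorations t \<omega> - (\<Sum>s=2..t. if explored s \<omega> then indicator U (w s \<omega>) else 0)"
        by (simp add: sum_subtractf explorations_def sum_distrib_left)
      finally show ?case using elim b by (simp add: field_simps)
    qed
  qed
  then show ?thesis using b by (intro exI[of _ "b / 2"]) auto
qed

text \<open>Some interior profile has features not orthogonal to \<open>v\<close>. It is the response to some parameter, and
  by continuity the features of responses to nearby parameters are not nearly orthogonal to
  directions near \<open>v\<close>.\<close>

lemma local_excitation:
  assumes "v \<noteq> 0"
  shows "\<exists>U r c. open U \<and> U \<noteq> {} \<and> 0 < r \<and> 0 < c \<and> (\<forall>u\<in>ball v r. \<forall>q\<in>U. c \<le> (u \<bullet> gated_features q)\<^sup>2)"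
proof -
  obtain B where B: "0 < B" "\<And>v. norm (gated_features v) \<le> B" using gated_features_bounded by blast
  obtain x where x: "x \<in> interior X" "v \<bullet> features mon x \<noteq> 0"
    using features_span[OF inj_mon open_interior target_interior] assms by blast
  define q0 where "q0 = - F x"
  have xs0: "xs q0 = x" unfolding q0_def using x interior_subset by (intro xs_implementation) blast
  define \<delta> where "\<delta> = \<bar>v \<bullet> features mon x\<bar>"
  have \<delta>: "0 < \<delta>" using x by (simp add: \<delta>_def)
  define G where "G = xs -` interior X"
  have G: "open G" unfolding G_def by (intro open_vimage open_interior continuous_on_xs)
  define U where "U = G \<inter> (\<lambda>q. \<bar>v \<bullet> features mon (xs q)\<bar>) -` {\<delta> / 2<..}"
  have "open U" unfolding U_def
    by (intro open_Int G open_vimage) (auto intro!: continuous_intros continuous_on_xs)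
  moreover have "q0 \<in> U" using x \<delta> by (simp add: U_def G_def xs0 \<delta>_def)
  moreover have "(\<delta> / 4)\<^sup>2 \<le> (u \<bullet> gated_features q)\<^sup>2" if u: "u \<in> ball v (\<delta> / (4 * B))" and q: "q \<in> U" for u q
  proof -
    have g: "gated_features q = features mon (xs q)" using q by (simp add: gated_features_def U_def G_def)
    have "\<bar>(v - u) \<bullet> gated_features q\<bar> \<le> norm (v - u) * norm (gated_features q)" by (rule Cauchy_Schwarz_ineq2)
    also have "\<dots> \<le> \<delta> / (4 * B) * B"
      using u B \<delta> by (intro mult_mono) (auto simp: dist_norm)
    finally have "\<bar>(v - u) \<bullet> gated_features q\<bar> \<le> \<delta> / 4" using B by simp
    moreover have "\<delta> / 2 < \<bar>v \<bullet> gated_features q\<bar>" using q by (simp add: U_def g)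
    ultimately have "\<delta> / 4 \<le> \<bar>u \<bullet> gated_features q\<bar>" unfolding inner_diff_left by linarith
    then show ?thesis using \<delta> by (simp add: abs_le_square_iff[symmetric])
  qed
  ultimately show ?thesis using \<delta> B
    by (intro exI[of _ U] exI[of _ "\<delta> / (4 * B)"] exI[of _ "(\<delta> / 4)\<^sup>2"]) auto
qed

text \<open>Compactness of the unit sphere leaves finitely many of these neighbourhoods of directions, and the
  draws visit the finitely many corresponding sets of parameters with positive frequency.\<close>

lemma persistent_excitation:
  "\<exists>c>0. AE \<omega> in M. eventually (\<lambda>t. \<forall>v. c * explorations t \<omega> * (norm v)\<^sup>2 \<le> (\<Sum>s=2..t. (v \<bullet> regressor s \<omega>)\<^sup>2)) sequentially"
proof -
  have "\<forall>v\<in>sphere (0::real ^ 'm) 1. \<exists>U r c. open U \<and> U \<noteq> {} \<and> 0 < r \<and> 0 < c \<and>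
      (\<forall>u\<in>ball v r. \<forall>q\<in>U. c \<le> (u \<bullet> gated_features q)\<^sup>2)"
    by (intro ballI local_excitation) auto
  then obtain U r c where U: "\<And>v. v \<in> sphere (0::real ^ 'm) 1 \<Longrightarrow> open (U v) \<and> U v \<noteq> {}"
    and r: "\<And>v. v \<in> sphere (0::real ^ 'm) 1 \<Longrightarrow> 0 < r v"
    and c: "\<And>v. v \<in> sphere (0::real ^ 'm) 1 \<Longrightarrow> 0 < c v"
    and exc: "\<And>v u q. v \<in> sphere (0::real ^ 'm) 1 \<Longrightarrow> u \<in> ball v (r v) \<Longrightarrow> q \<in> U v \<Longrightarrow> c v \<le> (u \<bullet> gated_features q)\<^sup>2"
    unfolding bchoice_iff by blast
  obtain D where D: "D \<subseteq> sphere 0 1" "finite D" "sphere 0 1 \<subseteq> (\<Union>v\<in>D. ball v (r v))"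
    by (rule compactE_image[OF compact_sphere, of "sphere 0 1" "\<lambda>v. ball v (r v)" 0 1]) (use r in force)+
  have "\<forall>v\<in>D. \<exists>b>0. AE \<omega> in M. eventually (\<lambda>t. b * explorations t \<omega>
    \<le> (\<Sum>s=2..t. if explored s \<omega> then indicator (U v) (w s \<omega>) else 0)) sequentially"
    using U D by (intro ballI open_set_visits) auto
  then obtain b where b: "\<And>v. v \<in> D \<Longrightarrow> 0 < b v"
    and visits: "\<And>v. v \<in> D \<Longrightarrow> AE \<omega> in M. eventually (\<lambda>t. b v * explorations t \<omega>
      \<le> (\<Sum>s=2..t. if explored s \<omega> then indicator (U v) (w s \<omega>) else 0)) sequentially"
    unfolding bchoice_iff by blast
  have "D \<noteq> {}"
  proof
    assume "D = {}"
    then have "axis undefined 1 \<notin> sphere (0 :: real ^ 'm) 1" using D by auto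
    then show False by simp
  qed
  define a where "a = Min ((\<lambda>v. c v * b v) ` D)"
  have a: "0 < a" unfolding a_def using D c b \<open>D \<noteq> {}\<close> by (subst Min_gr_iff) auto
  have a_le: "a \<le> c v * b v" if "v \<in> D" for v unfolding a_def using D that by (intro Min_le) auto
  have "AE \<omega> in M. \<forall>v\<in>D. eventually (\<lambda>t. b v * explorations t \<omega>
      \<le> (\<Sum>s=2..t. if explored s \<omega> then indicator (U v) (w s \<omega>) else 0)) sequentially"
    using visits D by (intro AE_finite_allI) auto
  then have "AE \<omega> in M. eventually (\<lambda>t. \<forall>v. a * explorations t \<omega> * (norm v)\<^sup>2 \<le> (\<Sum>s=2..t. (v \<bullet> regressor s \<omega>)\<^sup>2)) sequentially"
  proof (rule AE_mp, intro AE_I2 impI)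
    fix \<omega> assume "\<omega> \<in> space M"
    assume "\<forall>v\<in>D. eventually (\<lambda>t. b v * explorations t \<omega>
      \<le> (\<Sum>s=2..t. if explored s \<omega> then indicator (U v) (w s \<omega>) else 0)) sequentially"
    then have "eventually (\<lambda>t. \<forall>v\<in>D. b v * explorations t \<omega>
      \<le> (\<Sum>s=2..t. if explored s \<omega> then indicator (U v) (w s \<omega>) else 0)) sequentially"
      using D by (intro eventually_ball_finite) auto
    then show "eventually (\<lambda>t. \<forall>v. a * explorations t \<omega> * (norm v)\<^sup>2 \<le> (\<Sum>s=2..t. (v \<bullet> regressor s \<omega>)\<^sup>2)) sequentially"
    proof eventually_elim
      case (elim t)
      show ?case
      proof
        fix z :: "real ^ 'm"
        show "a * explorations t \<omega> * (norm z)\<^sup>2 \<le> (\<Sum>s=2..t. (z \<bullet> regressor s \<omega>)\<^sup>2)"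
        proof (cases "z = 0")
          case False
          define u where "u = z /\<^sub>R norm z"
          have zu: "z = norm z *\<^sub>R u" using False by (simp add: u_def)
          have "u \<in> sphere 0 1" using False by (simp add: u_def)
          then obtain v where v: "v \<in> D" "u \<in> ball v (r v)" using D by blast
          have vs: "v \<in> sphere 0 1" using v D by blast
          have "a * explorations t \<omega> \<le> c v * (b v * explorations t \<omega>)"
            using mult_right_mono[OF a_le[OF v(1)] explorations_nonneg[of t \<omega>]] by (simp add: mult.assoc)
          also have "\<dots> \<le> c v * (\<Sum>s=2..t. if explored s \<omega> then indicator (U v) (w s \<omega>) else 0)"
            using elim v c[OF vs] by (intro mult_left_mono) auto
          also have "\<dots> \<le> (\<Sum>s=2..t. (u \<bullet> regressor s \<omega>)\<^sup>2)"
            unfolding sum_distrib_left using exc[OF vs v(2)]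
            by (intro sum_mono) (auto simp: regressor_def indicator_def)
          finally have "(norm z)\<^sup>2 * (a * explorations t \<omega>) \<le> (norm z)\<^sup>2 * (\<Sum>s=2..t. (u \<bullet> regressor s \<omega>)\<^sup>2)"
            by (intro mult_left_mono) auto
          also have "\<dots> = (\<Sum>s=2..t. (z \<bullet> regressor s \<omega>)\<^sup>2)"
          proof -
            have "(z \<bullet> regressor s \<omega>)\<^sup>2 = (norm z)\<^sup>2 * (u \<bullet> regressor s \<omega>)\<^sup>2" for s
              using arg_cong[OF zu, of "\<lambda>z. z \<bullet> regressor s \<omega>"] by (simp add: power_mult_distrib)
            then show ?thesis by (simp add: sum_distrib_left)
          qed
          finally show ?thesis by (simp add: mult_ac)
        qed (simp add: sum_nonneg)
      qed
    qed
  qed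
  then show ?thesis using a by blast
qed

text \<open>An explored round has \<open>1 / A < tr S\<close>, and \<open>tr S\<close> is at most of order \<open>1 / n\<close> by excitation. Hence
  \<open>n\<close> can only increase while it is below a multiple of \<open>A\<close>.\<close>

lemma explorations_upper:
  "\<exists>C>0. AE \<omega> in M. eventually (\<lambda>t. explorations t \<omega> \<le> C * A_rate \<gamma> t) sequentially"
proof -
  obtain c where c: "0 < c" and exc: "AE \<omega> in M. eventually
      (\<lambda>t. \<forall>v. c * explorations t \<omega> * (norm v)\<^sup>2 \<le> (\<Sum>s=2..t. (v \<bullet> regressor s \<omega>)\<^sup>2)) sequentially"
    using persistent_excitation by blast
  define D where "D = real CARD('m) / c"
  have D: "0 < D" using c by (simp add: D_def)
  from exc have "AE \<omega> in M. eventually (\<lambda>t. explorations t \<omega> \<le> 2 * D * A_rate \<gamma> t) sequentially"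
  proof (rule AE_mp, intro AE_I2 impI)
    fix \<omega> assume \<omega>: "\<omega> \<in> space M"
    assume "eventually (\<lambda>t. \<forall>v. c * explorations t \<omega> * (norm v)\<^sup>2 \<le> (\<Sum>s=2..t. (v \<bullet> regressor s \<omega>)\<^sup>2)) sequentially"
    moreover have "eventually (\<lambda>t. 1 \<le> ln (real t)) sequentially" by real_asymp
    ultimately have "eventually (\<lambda>t. 1 \<le> explorations t \<omega> \<and> (\<forall>v. c * explorations t \<omega> * (norm v)\<^sup>2 \<le> (\<Sum>s=2..t. (v \<bullet> regressor s \<omega>)\<^sup>2))) sequentially"
      using ln_le_explorations[OF \<omega>, of 1] by eventually_elim auto
    then obtain t0 where t0: "\<And>t. t0 \<le> t \<Longrightarrow> 1 \<le> explorations t \<omega>"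
      "\<And>t v. t0 \<le> t \<Longrightarrow> c * explorations t \<omega> * (norm v)\<^sup>2 \<le> (\<Sum>s=2..t. (v \<bullet> regressor s \<omega>)\<^sup>2)"
      unfolding eventually_sequentially by blast
    interpret r: rls "\<lambda>t. S t \<omega>" "\<lambda>t. err t \<omega>" "\<lambda>t. regressor t \<omega>" "\<lambda>t. e t \<omega>" P1
      by (rule rls_path[OF \<omega>])
    \<comment> \<open>from round 2 on \<open>A\<close> is positive, so that its inverse is the threshold\<close>
    define t1 where "t1 = max t0 2"
    have bound: "explorations t \<omega> \<le> D * A_rate \<gamma> t + (1 + real t1)" if "t1 \<le> t" for t
      using that
    proof (induction t rule: dec_induct)
      case base
      show ?case using explorations_le[of t1 \<omega>] D A_rate_pos[of t1 \<gamma>] by (simp add: t1_def add_increasing)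
    next
      case (step t)
      have t: "2 \<le> t" "t0 \<le> t" using step.hyps by (auto simp: t1_def)
      have inc: "D * A_rate \<gamma> t \<le> D * A_rate \<gamma> (Suc t)"
        using D t rate by (intro mult_left_mono A_rate_mono) auto
      show ?case
      proof (cases "explored (Suc t) \<omega>")
        case False
        then show ?thesis using explorations_Suc[of t \<omega>] t step.IH inc by simp
      next
        case True
        have pos: "0 < c * explorations t \<omega>" using c t0(1)[OF t(2)] by simp
        have "c * explorations t \<omega> * (norm v)\<^sup>2 \<le> v \<bullet> (r.P t *v v)" for v
          using t0(2)[OF t(2), of v] P1(2)[of v] unfolding r.quadratic_form_P by linarith
        then have "trace (S t \<omega>) \<le> real CARD('m) / (c * explorations t \<omega>)"
          using pos t by (intro r.trace_upper_bound) auto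
        moreover have "\<not> trace (S t \<omega>) \<le> 1 / A_rate \<gamma> t"
          using True not_explores_iff[OF t(1), of \<gamma> "S t \<omega>"] by (simp add: explored_def)
        ultimately have "1 / A_rate \<gamma> t < real CARD('m) / (c * explorations t \<omega>)" by linarith
        then have "explorations t \<omega> < D * A_rate \<gamma> t"
          using pos c A_rate_pos[OF t(1), of \<gamma>] by (simp add: D_def field_simps zero_less_mult_iff)
        then show ?thesis using explorations_Suc[of t \<omega>] t inc by simp
      qed
    qed
    have "eventually (\<lambda>t. (1 + real t1) / D \<le> A_rate \<gamma> t) sequentially"
      using A_rate_at_top[of \<gamma>] rate by (simp add: filterlim_at_top)
    then show "eventually (\<lambda>t. explorations t \<omega> \<le> 2 * D * A_rate \<gamma> t) sequentially"
      using eventually_ge_at_top[of t1]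
    proof eventually_elim
      case (elim t)
      then have "1 + real t1 \<le> D * A_rate \<gamma> t" using D by (simp add: field_simps)
      then show ?case using bound[of t] elim by simp
    qed
  qed
  then show ?thesis using D by (intro exI[of _ "2 * D"]) auto
qed

lemma explored_draws_square_sum:
  "\<exists>C>0. AE \<omega> in M. eventually (\<lambda>t. (\<Sum>s=2..t. if explored s \<omega> then (norm (w s \<omega>))\<^sup>2 else 0) \<le> C * explorations t \<omega>) sequentially"
proof -
  obtain \<beta> K where \<beta>: "0 < \<beta>"
    and K: "(\<integral>\<^sup>+x. ennreal (exp (\<beta> * (norm (x :: real ^ 'n))\<^sup>2 - K)) \<partial>gaussian_law \<sigma>) \<le> 1"
    using gaussian_law_exp_square[OF \<sigma>_pos] by blast
  have "AE \<omega> in M. eventually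
    (\<lambda>t. (\<Sum>s=2..t. if explored s \<omega> then \<beta> * (norm (w s \<omega>))\<^sup>2 - K else 0) \<le> 2 * ln (real t)) sequentially"
    by (rule exploration_selection_growth[OF _ K]) measurable
  then have "AE \<omega> in M. eventually (\<lambda>t. (\<Sum>s=2..t. if explored s \<omega> then (norm (w s \<omega>))\<^sup>2 else 0)
      \<le> (\<bar>K\<bar> + 2) / \<beta> * explorations t \<omega>) sequentially"
  proof (rule AE_mp, intro AE_I2 impI)
    fix \<omega> assume \<omega>: "\<omega> \<in> space M"
    assume "eventually (\<lambda>t. (\<Sum>s=2..t. if explored s \<omega> then \<beta> * (norm (w s \<omega>))\<^sup>2 - K else 0) \<le> 2 * ln (real t)) sequentially"
    then show "eventually (\<lambda>t. (\<Sum>s=2..t. if explored s \<omega> then (norm (w s \<omega>))\<^sup>2 else 0)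
      \<le> (\<bar>K\<bar> + 2) / \<beta> * explorations t \<omega>) sequentially"
      using ln_le_explorations[OF \<omega>, of 1]
    proof eventually_elim
      case (elim t)
      have "(\<Sum>s=2..t. if explored s \<omega> then \<beta> * (norm (w s \<omega>))\<^sup>2 - K else 0)
          = (\<Sum>s=2..t. \<beta> * (if explored s \<omega> then (norm (w s \<omega>))\<^sup>2 else 0) - K * of_bool (explored s \<omega>))"
        by (intro sum.cong) auto
      also have "\<dots> = \<beta> * (\<Sum>s=2..t. if explored s \<omega> then (norm (w s \<omega>))\<^sup>2 else 0) - K * explorations t \<omega>"
        by (simp add: sum_subtractf explorations_def sum_distrib_left)
      finally have "\<beta> * (\<Sum>s=2..t. if explored s \<omega> then (norm (w s \<omega>))\<^sup>2 else 0) \<le> K * explorations t \<omega> + 2 * explorations t \<omega>"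
        using elim by simp
      also have "\<dots> \<le> (\<bar>K\<bar> + 2) * explorations t \<omega>"
        unfolding distrib_right by (intro add_right_mono mult_right_mono) auto
      finally show ?case using \<beta> by (simp add: field_simps)
    qed
  qed
  then show ?thesis using \<beta> by (intro exI[of _ "(\<bar>K\<bar> + 2) / \<beta>"]) auto
qed

end

section \<open>Growth of the noise sum\<close>

context incentive_learning
begin

lemma noise_moments:
  obtains V a K where "0 \<le> V" "2 < a" "0 \<le> K"
    "\<And>t i. 1 \<le> t \<Longrightarrow> integrable M (\<lambda>\<omega>. e t \<omega> $ i)"
    "\<And>t i. 1 \<le> t \<Longrightarrow> (\<integral>\<omega>. e t \<omega> $ i \<partial>M) = 0"
    "\<And>t i. 1 \<le> t \<Longrightarrow> integrable M (\<lambda>\<omega>. (e t \<omega> $ i)\<^sup>2)"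
    "\<And>t i. 1 \<le> t \<Longrightarrow> (\<integral>\<omega>. (e t \<omega> $ i)\<^sup>2 \<partial>M) = V"
    "\<And>t i. 1 \<le> t \<Longrightarrow> (\<integral>\<^sup>+\<omega>. ennreal (\<bar>e t \<omega> $ i\<bar> powr a) \<partial>M) \<le> ennreal K"
proof -
  obtain s where s: "\<And>t. 1 \<le> t \<Longrightarrow> integrable M (\<lambda>\<omega>. outer (e t \<omega>) (e t \<omega>))"
    "\<And>t. 1 \<le> t \<Longrightarrow> (\<integral>\<omega>. outer (e t \<omega>) (e t \<omega>) \<partial>M) = s\<^sup>2 *\<^sub>R mat 1"
    using noise unfolding noise_assumption_def by blast
  obtain a where a: "2 < a" "(SUP t\<in>{1..}. \<integral>\<^sup>+\<omega>. ennreal (infnorm (e t \<omega>) powr a) \<partial>M) < \<infinity>"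
    using noise unfolding noise_assumption_def by blast
  have m: "\<And>t. 1 \<le> t \<Longrightarrow> integrable M (e t)" "\<And>t. 1 \<le> t \<Longrightarrow> (\<integral>\<omega>. e t \<omega> \<partial>M) = 0"
    using noise unfolding noise_assumption_def by auto
  define Q where "Q = (SUP t\<in>{1..}. \<integral>\<^sup>+\<omega>. ennreal (infnorm (e t \<omega>) powr a) \<partial>M)"
  obtain K where K: "0 \<le> K" "Q = ennreal K" using a(2) unfolding Q_def[symmetric] by (cases Q) auto
  have lin: "bounded_linear (\<lambda>A::real^'n^'n. A $ i $ i)" for i
    by (intro bounded_linear_compose[OF bounded_linear_vec_nth bounded_linear_vec_nth])
  show ?thesis
  proof (rule that[of "s\<^sup>2" a K])
    fix t :: nat and i assume t: "1 \<le> t"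
    show "integrable M (\<lambda>\<omega>. e t \<omega> $ i)"
      by (rule integrable_bounded_linear[OF bounded_linear_vec_nth m(1)[OF t]])
    show "(\<integral>\<omega>. e t \<omega> $ i \<partial>M) = 0"
      using integral_bounded_linear[OF bounded_linear_vec_nth m(1)[OF t], of i] m(2)[OF t] by simp
    show "integrable M (\<lambda>\<omega>. (e t \<omega> $ i)\<^sup>2)"
      using integrable_bounded_linear[OF lin s(1)[OF t], of i] by (simp add: outer_def power2_eq_square)
    show "(\<integral>\<omega>. (e t \<omega> $ i)\<^sup>2 \<partial>M) = s\<^sup>2"
      using integral_bounded_linear[OF lin s(1)[OF t], of i] s(2)[OF t]
      by (simp add: outer_def power2_eq_square mat_def)
    have "(\<integral>\<^sup>+\<omega>. ennreal (\<bar>e t \<omega> $ i\<bar> powr a) \<partial>M) \<le> (\<integral>\<^sup>+\<omega>. ennreal (infnorm (e t \<omega>) powr a) \<partial>M)"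
      using a(1) by (intro nn_integral_mono ennreal_leI powr_mono2 component_le_infnorm_cart) auto
    also have "\<dots> \<le> ennreal K" unfolding K(2)[symmetric] Q_def using t by (intro SUP_upper) auto
    finally show "(\<integral>\<^sup>+\<omega>. ennreal (\<bar>e t \<omega> $ i\<bar> powr a) \<partial>M) \<le> ennreal K" .
  qed (use a K in auto)
qed

definition Z :: "nat + nat \<Rightarrow> 'w \<Rightarrow> real ^ 'n" where "Z = case_sum e w"

text \<open>What is known before the noise of round \<open>t\<close>. The draw of round \<open>t\<close> is included because the
  regressor that multiplies this noise depends on it.\<close>

definition known :: "nat \<Rightarrow> (nat + nat) set" where
  "known t = Inl ` {1..<t} \<union> Inr ` {2..t}"

lemma indep_Z: "indep_vars (\<lambda>_. borel) Z ({1..} <+> {2..})"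
  using draws by (simp add: exploration_draws_def Z_def)

lemma known_subset: "known t \<subseteq> {1..} <+> {2..}"
  by (auto simp: known_def)

lemma measurable_known:
  assumes "f \<in> past M w J \<rightarrow>\<^sub>M N" "J \<subseteq> {2..t}"
  shows "f \<in> past M Z (known t) \<rightarrow>\<^sub>M N"
proof (rule measurable_past_transfer[OF assms(1)])
  fix i assume "i \<in> J"
  then have "Inr i \<in> known t" using assms(2) by (auto simp: known_def)
  from measurable_past[OF this, of Z M] show "w i \<in> borel_measurable (past M Z (known t))"
    by (simp add: Z_def)
qed

lemma pred_explored_known: "2 \<le> s \<Longrightarrow> s \<le> t \<Longrightarrow> Measurable.pred (past M Z (known t)) (explored s)"
  by (rule measurable_known[OF pred_explored]) auto

lemma measurable_regressor_known: "2 \<le> t \<Longrightarrow> (\<lambda>\<omega>. regressor t \<omega> $ j) \<in> borel_measurable (past M Z (known t))"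
proof -
  assume t: "2 \<le> t"
  have "(\<lambda>v::real^'m. v $ j) \<in> borel_measurable borel"
    by (intro borel_measurable_continuous_onI continuous_intros)
  from measurable_compose[OF measurable_regressor[OF t] this] show ?thesis
    by (rule measurable_known) auto
qed

lemma measurable_explorations_known: "explorations t \<in> borel_measurable (past M Z (known t))"
  unfolding explorations_def[abs_def]
proof (intro borel_measurable_sum)
  fix s assume "s \<in> {2..t}"
  then have [measurable]: "Measurable.pred (past M Z (known t)) (explored s)"
    by (intro pred_explored_known) auto
  show "(\<lambda>\<omega>. of_bool (explored s \<omega>)) \<in> borel_measurable (past M Z (known t))" by measurable
qed

lemma measurable_M_known: "f \<in> past M Z (known t) \<rightarrow>\<^sub>M N \<Longrightarrow> f \<in> M \<rightarrow>\<^sub>M N"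
  by (rule measurable_from_past[OF indep_Z known_subset])

lemma measurable_component [measurable]: "(\<lambda>v::real^'n. v $ i) \<in> borel_measurable borel"
  by (intro borel_measurable_continuous_onI continuous_intros)

lemma measurable_e: "1 \<le> t \<Longrightarrow> e t \<in> borel_measurable M"
  using noise by (auto simp: noise_assumption_def indep_vars_def)

text \<open>The counter takes each value once along the explored rounds, so the sum runs through the powers of
  \<open>1, 2, 3, \<dots>\<close>.\<close>

lemma sum_inverse_powers_of_count:
  assumes "1 < q"
  shows "(\<Sum>s=2..N. of_bool (explored s \<omega>) * explorations s \<omega> powr - q) \<le> (\<Sum>k. real k powr - q)"
proof -
  define g where "g n = (\<Sum>k=1..n. real k powr - q)" for n
  define n where "n t = (\<Sum>s=2..t. of_bool (explored s \<omega>) :: nat)" for t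
  have explorations: "explorations t \<omega> = real (n t)" for t by (simp add: explorations_def n_def)
  have "(\<Sum>s=2..N. of_bool (explored s \<omega>) * explorations s \<omega> powr - q) = g (n N)"
  proof (induction N)
    case (Suc N)
    show ?case
    proof (cases "2 \<le> Suc N")
      case True
      then have "n (Suc N) = n N + of_bool (explored (Suc N) \<omega>)" by (simp add: n_def)
      then show ?thesis using Suc True by (auto simp: g_def explorations add.commute)
    qed (simp add: n_def g_def)
  qed (simp add: n_def g_def)
  also have "\<dots> \<le> (\<Sum>k. real k powr - q)"
    unfolding g_def using assms by (intro sum_le_suminf) (auto simp: summable_real_powr_iff)
  finally show ?thesis .
qed

text \<open>A moment of order \<open>a > 2\<close> bounds the probability of a large noise value in round \<open>s\<close> by a multiple of \<open>s\<^sup>-\<^sup>a\<^sup>\<gamma>\<^sup>/\<^sup>2\<close>,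
  which need not be summable over all rounds. It is over the explored ones: these have \<open>n \<le> s\<^sup>r\<close> for
  any \<open>r > \<gamma>\<close> eventually, so that the bound is at most \<open>n\<^sup>-\<^sup>q\<close> with \<open>r q = a \<gamma> / 2\<close>, and \<open>q > 1\<close> if \<open>r\<close> is close
  enough to \<open>\<gamma>\<close>.\<close>

lemma explored_noise_tail:
  "AE \<omega> in M. eventually (\<lambda>s. explored s \<omega> \<longrightarrow> \<bar>e s \<omega> $ i\<bar> \<le> real s powr (\<gamma> / 2)) sequentially"
proof -
  obtain a K where a: "2 < a" and K: "0 \<le> K"
    and mom: "\<And>t i. 1 \<le> t \<Longrightarrow> (\<integral>\<^sup>+\<omega>. ennreal (\<bar>e t \<omega> $ i\<bar> powr a) \<partial>M) \<le> ennreal K"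
    using noise_moments by metis
  \<comment> \<open>the midpoint between \<open>\<gamma>\<close> and \<open>a \<gamma> / 2\<close>\<close>
  define r where "r = \<gamma> * (2 + a) / 4"
  define q where "q = 2 * a / (2 + a)"
  have r: "\<gamma> < r" using a rate by (simp add: r_def field_simps)
  have q: "1 < q" using a by (simp add: q_def)
  have rq: "r * q = a * (\<gamma> / 2)" using a by (simp add: r_def q_def field_simps)
  define D where "D s = {\<omega> \<in> space M. (explored s \<omega> \<and> explorations s \<omega> \<le> real s powr r) \<and> real s powr (\<gamma> / 2) < \<bar>e s \<omega> $ i\<bar>}" for s
  define h where "h s \<omega> = of_bool (explored s \<omega>) * explorations s \<omega> powr - q" for s \<omega>
  have prob_D: "prob (D s) \<le> K * (\<integral>\<omega>. h s \<omega> \<partial>M)" and D_meas: "D s \<in> sets M"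
    and h_int: "integrable M (h s)" if s: "2 \<le> s" for s
  proof -
    have ex_k[measurable]: "Measurable.pred (past M Z (known s)) (explored s)"
      using s by (intro pred_explored_known) auto
    note [measurable] = measurable_explorations_known[of s]
    have ex_M[measurable]: "Measurable.pred M (explored s)" "explorations s \<in> borel_measurable M"
      using measurable_M_known[OF ex_k] measurable_M_known[OF measurable_explorations_known] by auto
    have [measurable]: "e s \<in> borel_measurable M" using s by (intro measurable_e) auto
    show "D s \<in> sets M" unfolding D_def by measurable
    have explorations1: "1 \<le> explorations s \<omega>" if "explored s \<omega>" for \<omega>
    proof -
      have "of_bool (explored s \<omega>) \<le> explorations s \<omega>" unfolding explorations_def using s by (intro member_le_sum) auto
      then show ?thesis using that by simp
    qed
    have h_le: "0 \<le> h s \<omega>" "h s \<omega> \<le> 1" for \<omega>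
      using q explorations1[of \<omega>] powr_mono[of "- q" 0 "explorations s \<omega>"] by (auto simp: h_def)
    have [measurable]: "h s \<in> borel_measurable M" unfolding h_def by measurable
    show "integrable M (h s)" using h_le by (intro integrable_const_bound[of _ 1]) auto
    define f where "f \<omega> = (of_bool (explored s \<omega> \<and> explorations s \<omega> \<le> real s powr r) :: real)" for \<omega>
    define g where "g v = (of_bool (real s powr (\<gamma> / 2) < \<bar>v $ i\<bar>) :: real)" for v :: "real ^ 'n"
    have f: "f \<in> borel_measurable (past M Z (known s))" unfolding f_def by measurable
    have g[measurable]: "g \<in> borel_measurable borel" unfolding g_def by measurable
    have [measurable]: "f \<in> borel_measurable M" by (rule measurable_M_known[OF f])
    have int_f: "integrable M f" by (intro integrable_const_bound[of _ 1]) (auto simp: f_def)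
    have int_g: "integrable M (\<lambda>\<omega>. g (e s \<omega>))"
      by (intro integrable_const_bound[of _ 1]) (auto simp: g_def)
    have "indep_var borel f borel (\<lambda>\<omega>. g (Z (Inl s) \<omega>))"
      using s by (intro indep_var_past[OF indep_Z known_subset _ _ f g]) (auto simp: known_def)
    then have ind: "indep_var borel f borel (\<lambda>\<omega>. g (e s \<omega>))" by (simp add: Z_def)
    have "prob (D s) = (\<integral>\<omega>. indicator (D s) \<omega> \<partial>M)"
      using \<open>D s \<in> sets M\<close> by simp
    also have "\<dots> = (\<integral>\<omega>. f \<omega> * g (e s \<omega>) \<partial>M)"
      by (intro Bochner_Integration.integral_cong) (auto simp: D_def f_def g_def indicator_def)
    also have "\<dots> = (\<integral>\<omega>. f \<omega> \<partial>M) * (\<integral>\<omega>. g (e s \<omega>) \<partial>M)"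
      by (rule indep_var_lebesgue_integral[OF ind int_f int_g])
    also have "\<dots> \<le> (\<integral>\<omega>. f \<omega> \<partial>M) * (K * real s powr - (r * q))"
    proof (intro mult_left_mono)
      have pos: "0 < real s powr (r * q)" using s by simp
      have T: "(real s powr (\<gamma> / 2)) powr a = real s powr (r * q)"
        unfolding powr_powr rq by (simp add: mult.commute)
      have g_le: "ennreal (g v) \<le> ennreal (real s powr - (r * q)) * ennreal (\<bar>v $ i\<bar> powr a)" for v
      proof (cases "real s powr (\<gamma> / 2) < \<bar>v $ i\<bar>")
        case True
        then have "real s powr (r * q) \<le> \<bar>v $ i\<bar> powr a"
          unfolding T[symmetric] using a by (intro powr_mono2) auto
        then have "1 \<le> real s powr - (r * q) * \<bar>v $ i\<bar> powr a"
          using pos by (simp add: powr_minus field_simps)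
        then show ?thesis using True by (simp add: g_def flip: ennreal_mult')
      qed (simp add: g_def)
      have "ennreal (\<integral>\<omega>. g (e s \<omega>) \<partial>M) = (\<integral>\<^sup>+\<omega>. ennreal (g (e s \<omega>)) \<partial>M)"
        by (rule nn_integral_eq_integral[symmetric, OF int_g]) (auto simp: g_def)
      also have "\<dots> \<le> (\<integral>\<^sup>+\<omega>. ennreal (real s powr - (r * q)) * ennreal (\<bar>e s \<omega> $ i\<bar> powr a) \<partial>M)"
        by (intro nn_integral_mono g_le)
      also have "\<dots> = ennreal (real s powr - (r * q)) * (\<integral>\<^sup>+\<omega>. ennreal (\<bar>e s \<omega> $ i\<bar> powr a) \<partial>M)"
        by (rule nn_integral_cmult) measurable
      also have "\<dots> \<le> ennreal (real s powr - (r * q)) * ennreal K"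
        using mom s by (intro mult_left_mono) auto
      also have "\<dots> = ennreal (K * real s powr - (r * q))"
        using K by (simp add: ennreal_mult' mult.commute)
      finally show "(\<integral>\<omega>. g (e s \<omega>) \<partial>M) \<le> K * real s powr - (r * q)"
        using K by (simp add: ennreal_le_iff)
    qed (auto simp: f_def)
    also have "\<dots> = K * (\<integral>\<omega>. f \<omega> * real s powr - (r * q) \<partial>M)" by simp
    also have "\<dots> \<le> K * (\<integral>\<omega>. h s \<omega> \<partial>M)"
    proof (intro mult_left_mono integral_mono)
      fix \<omega>
      show "f \<omega> * real s powr - (r * q) \<le> h s \<omega>"
      proof (cases "explored s \<omega> \<and> explorations s \<omega> \<le> real s powr r")
        case True
        then have "(real s powr r) powr - q \<le> explorations s \<omega> powr - q"
          using explorations1[of \<omega>] q by (intro powr_mono2') auto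
        then show ?thesis using True by (simp add: f_def h_def powr_powr)
      qed (use h_le in \<open>auto simp: f_def\<close>)
    qed (use int_f K \<open>integrable M (h s)\<close> in auto)
    finally show "prob (D s) \<le> K * (\<integral>\<omega>. h s \<omega> \<partial>M)" .
  qed
  have "summable (\<lambda>s. prob (D (s + 2)))"
  proof (rule bounded_imp_summable)
    fix n
    have "(\<Sum>s\<le>n. prob (D (s + 2))) \<le> (\<Sum>s\<le>n. K * (\<integral>\<omega>. h (s + 2) \<omega> \<partial>M))"
      using prob_D by (intro sum_mono) auto
    also have "\<dots> = K * (\<integral>\<omega>. (\<Sum>s\<le>n. h (s + 2) \<omega>) \<partial>M)"
      using h_int by (subst Bochner_Integration.integral_sum) (auto simp: sum_distrib_left)
    also have "\<dots> \<le> K * (\<integral>\<omega>. (\<Sum>k. real k powr - q) \<partial>M)"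
    proof (intro mult_left_mono integral_mono K)
      fix \<omega>
      have "(\<Sum>s\<le>n. h (s + 2) \<omega>) = (\<Sum>s=2..n+2. h s \<omega>)"
        by (rule sum.reindex_bij_witness[of _ "\<lambda>s. s - 2" "\<lambda>s. s + 2"]) auto
      then show "(\<Sum>s\<le>n. h (s + 2) \<omega>) \<le> (\<Sum>k. real k powr - q)"
        using sum_inverse_powers_of_count[OF q, of \<omega> "n + 2"] by (simp add: h_def)
    qed (use h_int in auto)
    finally show "(\<Sum>s\<le>n. prob (D (s + 2))) \<le> K * (\<Sum>k. real k powr - q)"
      by (simp add: prob_space)
  qed simp
  then have bc: "AE \<omega> in M. eventually (\<lambda>s. \<omega> \<in> space M - D (s + 2)) sequentially"
    using D_meas by (intro borel_cantelli_AE1) (auto simp: emeasure_eq_measure)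
  obtain C where "0 < C" and up: "AE \<omega> in M. eventually (\<lambda>t. explorations t \<omega> \<le> C * A_rate \<gamma> t) sequentially"
    using explorations_upper by blast
  from bc up show ?thesis
  proof eventually_elim
    case (elim \<omega>)
    have 1: "eventually (\<lambda>s. \<omega> \<in> space M - D s) sequentially"
      using elim(1) eventually_sequentially_seg[of "\<lambda>s. \<omega> \<in> space M - D s" 2] by simp
    have "((\<lambda>t. C * A_rate \<gamma> t / real t powr r) \<longlongrightarrow> 0) sequentially"
      unfolding A_rate_def using r \<open>0 < C\<close> by real_asymp
    then have "eventually (\<lambda>t. C * A_rate \<gamma> t / real t powr r < 1) sequentially"
      by (rule order_tendstoD) simp
    then show ?case using 1 elim(2) eventually_gt_at_top[of 0]
      by eventually_elim (auto simp: D_def field_simps)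
  qed
qed

text \<open>At the truncation level \<open>T = t\<^sup>\<gamma>\<^sup>/\<^sup>2\<close> the scale \<open>\<beta> = 1 / (B T)\<close> is as large as the quadratic bound on the
  exponential permits. The second moment alone bounds the mean of the truncated noise by
  \<open>V / T\<close>, so both parts of the compensator are \<open>V / T\<^sup>2 = V t\<^sup>-\<^sup>\<gamma>\<close>. The sign \<open>sg\<close> serves to bound the sum from
  above and below.\<close>

lemma truncated_noise_sum:
  assumes sg: "\<bar>sg\<bar> = (1 :: real)"
  shows "\<exists>B>0. \<exists>V\<ge>0. AE \<omega> in M. eventually (\<lambda>t.
    (\<Sum>s=2..t. regressor s \<omega> $ j * (sg * (if \<bar>e s \<omega> $ i\<bar> \<le> real t powr (\<gamma> / 2) then e s \<omega> $ i else 0)))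
      \<le> B * real t powr (\<gamma> / 2) * (2 * V * real t powr - \<gamma> * explorations t \<omega> + 2 * ln (real t))) sequentially"
proof -
  obtain B where B: "0 < B" "\<And>v. norm (gated_features v) \<le> B" using gated_features_bounded by blast
  obtain V where V: "0 \<le> V"
    and mean_int: "\<And>t i. 1 \<le> t \<Longrightarrow> integrable M (\<lambda>\<omega>. e t \<omega> $ i)"
    and mean: "\<And>t i. 1 \<le> t \<Longrightarrow> (\<integral>\<omega>. e t \<omega> $ i \<partial>M) = 0"
    and sq_int: "\<And>t i. 1 \<le> t \<Longrightarrow> integrable M (\<lambda>\<omega>. (e t \<omega> $ i)\<^sup>2)"
    and sq: "\<And>t i. 1 \<le> t \<Longrightarrow> (\<integral>\<omega>. (e t \<omega> $ i)\<^sup>2 \<partial>M) = V"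
    using noise_moments by metis
  define T where "T t = real t powr (\<gamma> / 2)" for t
  define y where "y t v = sg * (if \<bar>v $ i\<bar> \<le> T t then v $ i else 0)" for t and v :: "real ^ 'n"
  define \<beta> where "\<beta> t = 1 / (B * T t)" for t
  define U where "U t \<omega> = (\<Sum>s=2..t. \<beta> t * (regressor s \<omega> $ j * y t (Z (Inl s) \<omega>))
      - (\<beta> t * B * (V / T t) + (\<beta> t * B)\<^sup>2 * V) * of_bool (explored s \<omega>))" for t \<omega>
  have U: "U t \<in> borel_measurable (past M Z (known (Suc t)))"
    "(\<integral>\<^sup>+\<omega>. ennreal (exp (U t \<omega>)) \<partial>M) \<le> 1" if t: "1 \<le> t" for t
  proof -
    have T: "0 < T t" using t by (simp add: T_def)
    have y_le: "\<bar>y t v\<bar> \<le> T t" for v using T sg by (auto simp: y_def abs_mult)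
    have [measurable]: "y t \<in> borel_measurable borel" unfolding y_def by measurable
    have bound: "\<bar>regressor s \<omega> $ j\<bar> \<le> B * of_bool (explored s \<omega>)" for s \<omega>
      using component_le_norm_cart[of "gated_features (w s \<omega>)" j] B(2)[of "w s \<omega>"]
      by (auto simp: regressor_def intro: order_trans)
    have small: "B * \<bar>\<beta> t * y t v\<bar> \<le> 1" for v
      using y_le[of v] T B by (simp add: \<beta>_def abs_mult field_simps)
    have y_mean: "\<bar>\<integral>\<omega>. y t (Z (Inl s) \<omega>) \<partial>M\<bar> \<le> V / T t"
      and y_sq: "(\<integral>\<omega>. (y t (Z (Inl s) \<omega>))\<^sup>2 \<partial>M) \<le> V" if s: "2 \<le> s" for s
    proof -
      have s1: "1 \<le> s" using s by simp
      have [measurable]: "e s \<in> borel_measurable M" using s1 by (rule measurable_e)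
      have int_y: "integrable M (\<lambda>\<omega>. y t (e s \<omega>))"
        using y_le by (intro integrable_const_bound[of _ "T t"]) auto
      \<comment> \<open>the truncated part vanishes or is at least \<open>T\<close>, and then it is at most its square over \<open>T\<close>\<close>
      have diff: "\<bar>sg * (v $ i) - y t v\<bar> \<le> (v $ i)\<^sup>2 / T t" for v
      proof (cases "\<bar>v $ i\<bar> \<le> T t")
        case False
        then have "\<bar>v $ i\<bar> * T t \<le> \<bar>v $ i\<bar> * \<bar>v $ i\<bar>" by (intro mult_left_mono) auto
        then show ?thesis using False T sg by (simp add: y_def abs_mult field_simps power2_eq_square)
      qed (use T in \<open>simp add: y_def\<close>)
      have "(\<integral>\<omega>. sg * (e s \<omega> $ i) - y t (e s \<omega>) \<partial>M) = - (\<integral>\<omega>. y t (e s \<omega>) \<partial>M)"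
        using mean_int[OF s1] int_y mean[OF s1] by simp
      then have "\<bar>\<integral>\<omega>. y t (e s \<omega>) \<partial>M\<bar> = \<bar>\<integral>\<omega>. sg * (e s \<omega> $ i) - y t (e s \<omega>) \<partial>M\<bar>" by simp
      also have "\<dots> \<le> (\<integral>\<omega>. \<bar>sg * (e s \<omega> $ i) - y t (e s \<omega>)\<bar> \<partial>M)" by (rule integral_abs_bound)
      also have "\<dots> \<le> (\<integral>\<omega>. (e s \<omega> $ i)\<^sup>2 / T t \<partial>M)"
        using diff mean_int[OF s1] int_y sq_int[OF s1] by (intro integral_mono) auto
      also have "\<dots> = V / T t" using sq[OF s1] by simp
      finally show "\<bar>\<integral>\<omega>. y t (Z (Inl s) \<omega>) \<partial>M\<bar> \<le> V / T t" by (simp add: Z_def)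
      have "(y t v)\<^sup>2 \<le> (v $ i)\<^sup>2" for v
      proof -
        have "sg\<^sup>2 = 1" using sg by (simp add: abs_square_eq_1)
        then show ?thesis by (simp add: y_def power_mult_distrib)
      qed
      moreover have "integrable M (\<lambda>\<omega>. (y t (e s \<omega>))\<^sup>2)"
        using y_le T by (intro integrable_const_bound[of _ "(T t)\<^sup>2"]) (auto simp: abs_le_square_iff[symmetric])
      ultimately have "(\<integral>\<omega>. (y t (e s \<omega>))\<^sup>2 \<partial>M) \<le> (\<integral>\<omega>. (e s \<omega> $ i)\<^sup>2 \<partial>M)"
        using sq_int[OF s1] by (intro integral_mono) auto
      then show "(\<integral>\<omega>. (y t (Z (Inl s) \<omega>))\<^sup>2 \<partial>M) \<le> V" using sq[OF s1] by (simp add: Z_def)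
    qed
    have step: "known t \<subseteq> known (Suc t)" for t by (auto simp: known_def)
    have in_known: "Inl t \<in> known (Suc t)" "Inl t \<notin> known t" if "2 \<le> t" for t
      using that by (auto simp: known_def)
    note moment = predictable_noise_exp_moment[of Z "{1..} <+> {2..}" known "\<lambda>t. Inl t" explored
        "\<lambda>t \<omega>. regressor t \<omega> $ j" B "y t" "\<beta> t" "V / T t" V t, OF indep_Z known_subset step in_known
        pred_explored_known measurable_regressor_known bound _ small y_mean y_sq]
    show "U t \<in> borel_measurable (past M Z (known (Suc t)))"
      unfolding U_def[abs_def] using T B by (intro moment(1)) (auto simp: \<beta>_def)
    show "(\<integral>\<^sup>+\<omega>. ennreal (exp (U t \<omega>)) \<partial>M) \<le> 1"
      unfolding U_def using T B by (intro moment(2)) (auto simp: \<beta>_def)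
  qed
  have "U t \<in> borel_measurable M" for t
  proof (cases "1 \<le> t")
    case True
    then show ?thesis using measurable_M_known[OF U(1)] by blast
  qed (simp add: U_def[abs_def])
  then have "AE \<omega> in M. eventually (\<lambda>t. U t \<omega> \<le> 2 * ln (real t)) sequentially"
    using U(2) by (rule exp_moment_log_growth)
  then have "AE \<omega> in M. eventually (\<lambda>t.
    (\<Sum>s=2..t. regressor s \<omega> $ j * (sg * (if \<bar>e s \<omega> $ i\<bar> \<le> real t powr (\<gamma> / 2) then e s \<omega> $ i else 0)))
      \<le> B * real t powr (\<gamma> / 2) * (2 * V * real t powr - \<gamma> * explorations t \<omega> + 2 * ln (real t))) sequentially"
  proof eventually_elim
    case (elim \<omega>)
    then show ?case using eventually_ge_at_top[of 1]
    proof eventually_elim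
      case (elim t)
      let ?S = "\<Sum>s=2..t. regressor s \<omega> $ j * (sg * (if \<bar>e s \<omega> $ i\<bar> \<le> real t powr (\<gamma> / 2) then e s \<omega> $ i else 0))"
      have T: "0 < T t" using elim by (simp add: T_def)
      have "1 / (T t * T t) = real t powr - \<gamma>"
        using elim by (simp add: T_def powr_add[symmetric] powr_minus_divide)
      then have \<kappa>: "\<beta> t * B * (V / T t) + (\<beta> t * B)\<^sup>2 * V = 2 * V * real t powr - \<gamma>"
        using B T by (simp add: \<beta>_def power2_eq_square field_simps)
      have "U t \<omega> = \<beta> t * ?S - 2 * V * real t powr - \<gamma> * explorations t \<omega>"
        unfolding U_def \<kappa> by (simp add: sum_subtractf explorations_def sum_distrib_left y_def T_def Z_def)
      with elim have "\<beta> t * ?S \<le> 2 * V * real t powr - \<gamma> * explorations t \<omega> + 2 * ln (real t)" by simp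
      then have "B * T t * (\<beta> t * ?S) \<le> B * T t * (2 * V * real t powr - \<gamma> * explorations t \<omega> + 2 * ln (real t))"
        using B T by (intro mult_left_mono) auto
      moreover have "B * T t * (\<beta> t * ?S) = ?S" using B T by (simp add: \<beta>_def)
      ultimately have "?S \<le> B * T t * (2 * V * real t powr - \<gamma> * explorations t \<omega> + 2 * ln (real t))"
        by (simp only:)
      then show ?case unfolding T_def .
    qed
  qed
  then show ?thesis using B V by blast
qed

text \<open>Eventually truncation changes no term: late explored noise values are below their own level, and the
  finitely many earlier ones are below the level \<open>t\<^sup>\<gamma>\<^sup>/\<^sup>2\<close> once \<open>t\<close> is large.\<close>

lemma noise_sum_growth:
  "\<exists>K>0. AE \<omega> in M. eventually (\<lambda>t. \<bar>\<Sum>s=2..t. e s \<omega> $ i * regressor s \<omega> $ j\<bar>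
      \<le> K * (real t powr (\<gamma> / 2) * ln (real t))) sequentially"
proof -
  obtain C where C: "0 < C" and up: "AE \<omega> in M. eventually (\<lambda>t. explorations t \<omega> \<le> C * A_rate \<gamma> t) sequentially"
    using explorations_upper by blast
  have trunc: "\<exists>K>0. AE \<omega> in M. eventually (\<lambda>t.
      sg * (\<Sum>s=2..t. e s \<omega> $ i * regressor s \<omega> $ j) \<le> K * (real t powr (\<gamma> / 2) * ln (real t))) sequentially"
    if sg: "\<bar>sg\<bar> = 1" for sg
  proof -
    obtain B V where B: "0 < B" and V: "0 \<le> V" and bound: "AE \<omega> in M. eventually (\<lambda>t.
      (\<Sum>s=2..t. regressor s \<omega> $ j * (sg * (if \<bar>e s \<omega> $ i\<bar> \<le> real t powr (\<gamma> / 2) then e s \<omega> $ i else 0)))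
      \<le> B * real t powr (\<gamma> / 2) * (2 * V * real t powr - \<gamma> * explorations t \<omega> + 2 * ln (real t))) sequentially"
      using truncated_noise_sum[OF sg] by blast
    define K where "K = B * (2 * V * C + 2)"
    have K: "0 < K" using B V C by (simp add: K_def add_nonneg_pos)
    have "AE \<omega> in M. eventually (\<lambda>t.
      sg * (\<Sum>s=2..t. e s \<omega> $ i * regressor s \<omega> $ j) \<le> K * (real t powr (\<gamma> / 2) * ln (real t))) sequentially"
      using bound up explored_noise_tail[of i]
    proof eventually_elim
      case (elim \<omega>)
      obtain s0 where s0: "\<And>s. s0 \<le> s \<Longrightarrow> explored s \<omega> \<Longrightarrow> \<bar>e s \<omega> $ i\<bar> \<le> real s powr (\<gamma> / 2)"
        using elim(3) unfolding eventually_sequentially by blast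
      define m where "m = (\<Sum>s<s0. \<bar>e s \<omega> $ i\<bar>)"
      have "filterlim (\<lambda>t. real t powr (\<gamma> / 2)) at_top sequentially" using rate by real_asymp
      then have "eventually (\<lambda>t. m \<le> real t powr (\<gamma> / 2)) sequentially" by (simp add: filterlim_at_top)
      then show ?case using elim(1,2) eventually_ge_at_top[of 1]
      proof eventually_elim
        case (elim t)
        have untrunc: "regressor s \<omega> $ j * (sg * (if \<bar>e s \<omega> $ i\<bar> \<le> real t powr (\<gamma> / 2) then e s \<omega> $ i else 0))
            = sg * (e s \<omega> $ i * regressor s \<omega> $ j)" if s: "s \<in> {2..t}" for s
        proof (cases "explored s \<omega>")
          case True
          have "\<bar>e s \<omega> $ i\<bar> \<le> real t powr (\<gamma> / 2)"
          proof (cases "s < s0")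
            case True
            then have "\<bar>e s \<omega> $ i\<bar> \<le> m" unfolding m_def by (intro member_le_sum) auto
            then show ?thesis using elim by linarith
          next
            case False
            then have "\<bar>e s \<omega> $ i\<bar> \<le> real s powr (\<gamma> / 2)" using s0 True by simp
            also have "\<dots> \<le> real t powr (\<gamma> / 2)" using s rate by (intro powr_mono2) auto
            finally show ?thesis .
          qed
          then show ?thesis by simp
        qed (simp add: regressor_def)
        have "sg * (\<Sum>s=2..t. e s \<omega> $ i * regressor s \<omega> $ j)
            = (\<Sum>s=2..t. regressor s \<omega> $ j * (sg * (if \<bar>e s \<omega> $ i\<bar> \<le> real t powr (\<gamma> / 2) then e s \<omega> $ i else 0)))"
          unfolding sum_distrib_left by (intro sum.cong refl untrunc[symmetric])
        also have "\<dots> \<le> B * real t powr (\<gamma> / 2) * (2 * V * real t powr - \<gamma> * explorations t \<omega> + 2 * ln (real t))"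
          by (rule elim)
        also have "\<dots> \<le> B * real t powr (\<gamma> / 2) * (2 * V * real t powr - \<gamma> * (C * A_rate \<gamma> t) + 2 * ln (real t))"
          using elim B V by (intro mult_left_mono add_right_mono) auto
        also have "\<dots> = K * (real t powr (\<gamma> / 2) * ln (real t))"
        proof -
          have "real t powr - \<gamma> * real t powr \<gamma> = 1" using elim by (simp flip: powr_add)
          then have "real t powr - \<gamma> * A_rate \<gamma> t = ln (real t)"
            by (simp add: A_rate_def flip: mult.assoc)
          then have "2 * V * real t powr - \<gamma> * (C * A_rate \<gamma> t) = 2 * V * (C * ln (real t))"
            by (simp add: mult_ac)
          then show ?thesis unfolding K_def by (simp only:) (simp add: algebra_simps)
        qed
        finally show ?case .
      qed
    qed
    with K show ?thesis by blast
  qed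
  obtain K1 where K1: "0 < K1" "AE \<omega> in M. eventually (\<lambda>t.
      1 * (\<Sum>s=2..t. e s \<omega> $ i * regressor s \<omega> $ j) \<le> K1 * (real t powr (\<gamma> / 2) * ln (real t))) sequentially"
    using trunc[of 1] by auto
  obtain K2 where K2: "0 < K2" "AE \<omega> in M. eventually (\<lambda>t.
      (-1) * (\<Sum>s=2..t. e s \<omega> $ i * regressor s \<omega> $ j) \<le> K2 * (real t powr (\<gamma> / 2) * ln (real t))) sequentially"
    using trunc[of "-1"] by auto
  have "AE \<omega> in M. eventually (\<lambda>t. \<bar>\<Sum>s=2..t. e s \<omega> $ i * regressor s \<omega> $ j\<bar>
      \<le> (K1 + K2) * (real t powr (\<gamma> / 2) * ln (real t))) sequentially"
    using K1(2) K2(2)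
  proof eventually_elim
    case (elim \<omega>)
    then show ?case using eventually_ge_at_top[of 1]
    proof eventually_elim
      case (elim t)
      have "0 \<le> real t powr (\<gamma> / 2) * ln (real t)" using elim by simp
      then have "0 \<le> K1 * (real t powr (\<gamma> / 2) * ln (real t))" "0 \<le> K2 * (real t powr (\<gamma> / 2) * ln (real t))"
        using K1(1) K2(1) by simp_all
      then show ?case using elim unfolding distrib_right by linarith
    qed
  qed
  then show ?thesis using K1 K2 by (intro exI[of _ "K1 + K2"]) auto
qed

end

section \<open>Estimation and regret rates\<close>

lemma norm_matrix_vector_le:
  fixes A :: "real ^ 'm::finite ^ 'n::finite"
  shows "norm (A *v x) \<le> norm A * norm x"
proof -
  have "norm (A *v x) \<le> L2_set (\<lambda>i. norm (A $ i) * norm x) UNIV"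
    unfolding norm_vec_def[of "A *v x"]
    by (intro L2_set_mono) (auto simp: matrix_vector_mul_component Cauchy_Schwarz_ineq2)
  also have "\<dots> = norm A * norm x"
    by (subst L2_set_left_distrib[symmetric]) (auto simp: norm_vec_def)
  finally show ?thesis .
qed

lemma norm_matrix_le_sum:
  fixes A :: "real ^ 'm::finite ^ 'n::finite"
  shows "norm A \<le> (\<Sum>i\<in>UNIV. \<Sum>j\<in>UNIV. \<bar>A $ i $ j\<bar>)"
proof -
  have "norm A \<le> (\<Sum>i\<in>UNIV. norm (A $ i))" by (simp add: norm_vec_def L2_set_le_sum)
  also have "\<dots> \<le> (\<Sum>i\<in>UNIV. \<Sum>j\<in>UNIV. \<bar>A $ i $ j\<bar>)"
    by (intro sum_mono norm_le_l1_cart)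
  finally show ?thesis .
qed

lemma norm_incentive_diff_le:
  "norm (incentive xd ud x q - ud) \<le> norm q * norm (x - xd)"
proof -
  have "norm (incentive xd ud x q - ud) \<le> norm (norm q *\<^sub>R (x - xd))"
  proof (rule norm_le_componentwise_cart)
    fix i
    have "(incentive xd ud x q - ud) $ i = q $ i * (x - xd) $ i"
      by (simp add: incentive_def algebra_simps)
    then show "norm ((incentive xd ud x q - ud) $ i) \<le> norm ((norm q *\<^sub>R (x - xd)) $ i)"
      using component_le_norm_cart[of q i] by (simp add: abs_mult mult_right_mono)
  qed
  then show ?thesis by simp
qed

lemma sum_inverse_sqrt: "1 \<le> t \<Longrightarrow> (\<Sum>s=2..t. real (s - 1) powr (-1/2)) \<le> 2 * sqrt (real t - 1)"
proof (induction t rule: dec_induct)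
  case (step t)
  have t: "1 \<le> real t" using step by simp
  have "real t powr (-1/2) = 1 / sqrt (real t)"
    using t by (simp add: powr_minus_divide powr_half_sqrt[symmetric])
  moreover have "2 * sqrt (real t - 1) + 1 / sqrt (real t) \<le> 2 * sqrt (real t)"
  proof -
    have "sqrt ((real t - 1) * real t) \<le> ((real t - 1) + real t) / 2"
      using t by (intro arith_geo_mean_sqrt) auto
    then have *: "2 * sqrt (real t - 1) * sqrt (real t) + 1 \<le> 2 * (sqrt (real t) * sqrt (real t))"
      using t by (simp add: real_sqrt_mult)
    have "2 * sqrt (real t - 1) + 1 / sqrt (real t) = (2 * sqrt (real t - 1) * sqrt (real t) + 1) / sqrt (real t)"
      using t by (simp add: add_divide_distrib)
    also have "\<dots> \<le> 2 * (sqrt (real t) * sqrt (real t)) / sqrt (real t)"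
      using * by (intro divide_right_mono) auto
    also have "\<dots> = 2 * sqrt (real t)" using t real_div_sqrt[of "real t"] by simp
    finally show ?thesis .
  qed
  ultimately show ?case using step by simp
qed simp

context incentive_learning
begin

text \<open>The noise sum is \<open>O(t\<^sup>\<gamma>\<^sup>/\<^sup>2 log t)\<close>, the least eigenvalue of the information matrix at least of order
  \<open>A = t\<^sup>\<gamma> log t\<close>; the logarithms cancel in the quotient.\<close>

lemma err_rate:
  "\<exists>K>0. AE \<omega> in M. eventually (\<lambda>t. norm (err t \<omega>) \<le> K * real t powr (- \<gamma> / 2)) sequentially"
proof -
  obtain c where c: "0 < c" and exc: "AE \<omega> in M. eventually
      (\<lambda>t. \<forall>v. c * explorations t \<omega> * (norm v)\<^sup>2 \<le> (\<Sum>s=2..t. (v \<bullet> regressor s \<omega>)\<^sup>2)) sequentially"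
    using persistent_excitation by blast
  obtain K0 where K0: "0 < K0" and low: "\<And>\<omega>. \<omega> \<in> space M \<Longrightarrow> eventually (\<lambda>t. A_rate \<gamma> t \<le> K0 * explorations t \<omega>) sequentially"
    using rate_le_explorations by blast
  have "\<forall>i j. \<exists>K>0. AE \<omega> in M. eventually (\<lambda>t. \<bar>\<Sum>s=2..t. e s \<omega> $ i * regressor s \<omega> $ j\<bar>
      \<le> K * (real t powr (\<gamma> / 2) * ln (real t))) sequentially"
    using noise_sum_growth by blast
  then obtain k where k: "\<And>i j. 0 < k i j" and growth: "\<And>i j. AE \<omega> in M. eventually (\<lambda>t.
      \<bar>\<Sum>s=2..t. e s \<omega> $ i * regressor s \<omega> $ j\<bar> \<le> k i j * (real t powr (\<gamma> / 2) * ln (real t))) sequentially"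
    unfolding choice_iff by blast
  have growth_all: "AE \<omega> in M. \<forall>i\<in>UNIV. \<forall>j\<in>UNIV. eventually (\<lambda>t.
      \<bar>\<Sum>s=2..t. e s \<omega> $ i * regressor s \<omega> $ j\<bar> \<le> k i j * (real t powr (\<gamma> / 2) * ln (real t))) sequentially"
    using growth by (intro AE_finite_allI) auto
  define n0 where "n0 = norm ((T1 - Theta_star) ** P1)"
  define K where "K = n0 + (\<Sum>i\<in>UNIV. \<Sum>j\<in>UNIV. k i j)"
  have K: "0 \<le> K" using k by (simp add: K_def n0_def sum_nonneg less_imp_le)
  have "AE \<omega> in M. eventually (\<lambda>t. norm (err t \<omega>) \<le> (K * K0 / c + 1) * real t powr (- \<gamma> / 2)) sequentially"
    using exc growth_all AE_space
  proof eventually_elim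
    case (elim \<omega>)
    interpret r: rls "\<lambda>t. S t \<omega>" "\<lambda>t. err t \<omega>" "\<lambda>t. regressor t \<omega>" "\<lambda>t. e t \<omega>" P1
      by (rule rls_path[OF elim(3)])
    have "eventually (\<lambda>t. \<forall>i\<in>UNIV. \<forall>j\<in>UNIV. \<bar>\<Sum>s=2..t. e s \<omega> $ i * regressor s \<omega> $ j\<bar>
        \<le> k i j * (real t powr (\<gamma> / 2) * ln (real t))) sequentially"
      using elim(2) by (intro eventually_ball_finite finite ballI) blast
    moreover have "eventually (\<lambda>t. 1 \<le> real t powr (\<gamma> / 2) * ln (real t)) sequentially"
      using rate by real_asymp
    ultimately show ?case
      using elim(1) low[OF elim(3)] eventually_ge_at_top[of 2]
    proof eventually_elim
      case (elim t)
      let ?g = "real t powr (\<gamma> / 2) * ln (real t)"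
      have A: "0 < A_rate \<gamma> t" using elim by (intro A_rate_pos) auto
      then have explorations: "0 < explorations t \<omega>" using elim K0 by (smt (verit) mult_nonneg_nonpos)
      have comp: "(\<Sum>s=2..t. outer (e s \<omega>) (regressor s \<omega>)) $ i $ j = (\<Sum>s=2..t. e s \<omega> $ i * regressor s \<omega> $ j)" for i j
        by (simp add: outer_def)
      have "norm (r.N t) \<le> n0 + norm (\<Sum>s=2..t. outer (e s \<omega>) (regressor s \<omega>))"
        unfolding r.N_def n0_def path_init(2)[OF \<open>\<omega> \<in> space M\<close>] by (rule norm_triangle_ineq4)
      also have "\<dots> \<le> n0 * ?g + (\<Sum>i\<in>UNIV. \<Sum>j\<in>UNIV. k i j * ?g)"
      proof (rule add_mono)
        have "n0 * 1 \<le> n0 * ?g" using elim by (intro mult_left_mono) (auto simp: n0_def)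
        then show "n0 \<le> n0 * ?g" by simp
        have "norm (\<Sum>s=2..t. outer (e s \<omega>) (regressor s \<omega>))
            \<le> (\<Sum>i\<in>UNIV. \<Sum>j\<in>UNIV. \<bar>\<Sum>s=2..t. e s \<omega> $ i * regressor s \<omega> $ j\<bar>)"
          using norm_matrix_le_sum[of "\<Sum>s=2..t. outer (e s \<omega>) (regressor s \<omega>)"] unfolding comp .
        also have "\<dots> \<le> (\<Sum>i\<in>UNIV. \<Sum>j\<in>UNIV. k i j * ?g)"
          using elim by (intro sum_mono) auto
        finally show "norm (\<Sum>s=2..t. outer (e s \<omega>) (regressor s \<omega>)) \<le> (\<Sum>i\<in>UNIV. \<Sum>j\<in>UNIV. k i j * ?g)" .
      qed
      also have "\<dots> = K * ?g" by (simp add: K_def distrib_right sum_distrib_right)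
      finally have N: "norm (r.N t) \<le> K * ?g" .
      have "c * explorations t \<omega> * (norm v)\<^sup>2 \<le> v \<bullet> (r.P t *v v)" for v
        using elim(3)[rule_format, of v] P1(2)[of v] unfolding r.quadratic_form_P by linarith
      then have "norm (err t \<omega>) \<le> norm (r.N t) / (c * explorations t \<omega>)"
        using c explorations elim by (intro r.error_bound) auto
      also have "\<dots> \<le> K * ?g / (c * (A_rate \<gamma> t / K0))"
        using N c explorations K0 A elim K by (intro frac_le mult_left_mono) (auto simp: field_simps)
      also have "\<dots> = K * K0 / c * (?g / A_rate \<gamma> t)" using c K0 by (simp add: field_simps)
      also have "?g / A_rate \<gamma> t = real t powr (- \<gamma> / 2)"
      proof -
        have "real t powr \<gamma> = real t powr (\<gamma> / 2) * real t powr (\<gamma> / 2)" by (simp flip: powr_add)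
        then show ?thesis using elim by (simp add: A_rate_def powr_minus_divide)
      qed
      finally have "norm (err t \<omega>) \<le> K * K0 / c * real t powr (- \<gamma> / 2)" .
      moreover have "0 \<le> real t powr (- \<gamma> / 2)" by simp
      ultimately show ?case unfolding distrib_right by linarith
    qed
  qed
  moreover have "0 < K * K0 / c + 1" using K K0 c by (simp add: add_nonneg_pos)
  ultimately show ?thesis by blast
qed

theorem estimation_rate:
  "AE \<omega> in M. (\<lambda>t. (norm (Theta t \<omega> - Theta_star))\<^sup>2) \<in> O(\<lambda>t. real t powr (- \<gamma>))"
proof -
  obtain K where K: "0 < K" and "AE \<omega> in M. eventually (\<lambda>t. norm (err t \<omega>) \<le> K * real t powr (- \<gamma> / 2)) sequentially"
    using err_rate by blast
  from this(2) show ?thesis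
  proof eventually_elim
    case (elim \<omega>)
    show ?case
    proof (rule bigoI)
      show "eventually (\<lambda>t. norm ((norm (Theta t \<omega> - Theta_star))\<^sup>2) \<le> K\<^sup>2 * norm (real t powr - \<gamma>)) sequentially"
        using elim
      proof eventually_elim
        case (elim t)
        then have "(norm (err t \<omega>))\<^sup>2 \<le> (K * real t powr (- \<gamma> / 2))\<^sup>2" by (intro power_mono) auto
        also have "\<dots> = K\<^sup>2 * real t powr - \<gamma>"
          by (simp add: power_mult_distrib power2_eq_square[of "real t powr _"] flip: powr_add)
        finally show ?case by (simp add: err_def)
      qed
    qed
  qed
qed

text \<open>The Lipschitz bound leaves the squared distance of response and incentive from the target, where the
  incentive deviates by at most \<open>|p| |x - x\<^sup>\<dagger>|\<close>. An exploring round has a bounded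
  response and \<open>p = w\<close>; an exploiting one has \<open>|x - x\<^sup>\<dagger>|\<close> at most a multiple of the error.\<close>

theorem regret_rate:
  assumes feas: "feasibility_assumption X \<Psi> L xd ud"
  shows "AE \<omega> in M. regret \<Psi> xd ud xs (\<lambda>t. p t \<omega>) \<in> O(\<lambda>t. real t powr \<gamma> * ln (real t))"
proof -
  have lip: "L-lipschitz_on (X \<times> UNIV) \<Psi>" using feas by (simp add: feasibility_assumption_def)
  have L: "0 \<le> L" using lip by (rule lipschitz_on_nonneg)
  define cost where "cost q = (\<Psi> (xs q, incentive xd ud (xs q) q) - \<Psi> (xd, ud))\<^sup>2" for q
  have cost0: "0 \<le> cost q" for q by (simp add: cost_def)
  have cost_le: "cost q \<le> L\<^sup>2 * (1 + (norm q)\<^sup>2) * (norm (xs q - xd))\<^sup>2" for q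
  proof -
    let ?z = "(xs q, incentive xd ud (xs q) q)"
    have "dist (\<Psi> ?z) (\<Psi> (xd, ud)) \<le> L * dist ?z (xd, ud)"
      using lip xs_in_X target_in_X by (auto intro!: lipschitz_onD)
    then have "cost q \<le> (L * dist ?z (xd, ud))\<^sup>2"
      unfolding cost_def by (metis abs_le_square_iff abs_of_nonneg dist_real_def L mult_nonneg_nonneg zero_le_dist)
    also have "\<dots> = L\<^sup>2 * ((norm (xs q - xd))\<^sup>2 + (norm (incentive xd ud (xs q) q - ud))\<^sup>2)"
      by (simp add: power_mult_distrib dist_norm norm_Pair)
    also have "\<dots> \<le> L\<^sup>2 * ((norm (xs q - xd))\<^sup>2 + (norm q * norm (xs q - xd))\<^sup>2)"
      using norm_incentive_diff_le by (intro mult_left_mono add_left_mono power_mono) auto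
    also have "\<dots> = L\<^sup>2 * (1 + (norm q)\<^sup>2) * (norm (xs q - xd))\<^sup>2"
      by (simp add: power_mult_distrib algebra_simps)
    finally show ?thesis .
  qed
  obtain D where D: "0 \<le> D" "\<And>q. norm (xs q - xd) \<le> D"
  proof -
    obtain b where b: "\<And>x. x \<in> X \<Longrightarrow> norm x \<le> b"
      using compact_imp_bounded[OF compact_X] unfolding bounded_iff by blast
    have "norm (xs q - xd) \<le> 2 * b" for q
      using norm_triangle_ineq4[of "xs q" xd] b[OF xs_in_X[of q]] b[OF target_in_X] by linarith
    moreover have "0 \<le> 2 * b" using b[OF target_in_X] norm_ge_zero[of xd] by linarith
    ultimately show ?thesis using that by blast
  qed
  define a where "a = L\<^sup>2 * D\<^sup>2"
  have a: "0 \<le> a" by (simp add: a_def)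
  have explore_cost: "cost q \<le> a * (1 + (norm q)\<^sup>2)" for q
  proof -
    have "L\<^sup>2 * (1 + (norm q)\<^sup>2) * (norm (xs q - xd))\<^sup>2 \<le> L\<^sup>2 * (1 + (norm q)\<^sup>2) * D\<^sup>2"
      using D by (intro mult_left_mono power_mono) auto
    with cost_le[of q] show ?thesis by (simp add: a_def mult_ac)
  qed
  obtain \<Lambda> where \<Lambda>: "0 \<le> \<Lambda>" "\<And>q r. norm (xs q - xs r) \<le> \<Lambda> * norm (q - r)"
    using xs_lipschitz by blast
  obtain K where K: "0 < K" and err: "AE \<omega> in M. eventually (\<lambda>t. norm (err t \<omega>) \<le> K * real t powr (- \<gamma> / 2)) sequentially"
    using err_rate by blast
  obtain C where C: "0 < C" and up: "AE \<omega> in M. eventually (\<lambda>t. explorations t \<omega> \<le> C * A_rate \<gamma> t) sequentially"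
    using explorations_upper by blast
  obtain C' where C': "0 < C'" and sq: "AE \<omega> in M. eventually
      (\<lambda>t. (\<Sum>s=2..t. if explored s \<omega> then (norm (w s \<omega>))\<^sup>2 else 0) \<le> C' * explorations t \<omega>) sequentially"
    using explored_draws_square_sum by blast
  let ?\<phi> = "features mon xd"
  define pd where "pd = - F xd"
  define k where "k = K * norm ?\<phi>"
  define b where "b = L\<^sup>2 * (1 + (norm pd + k)\<^sup>2) * (\<Lambda> * k)\<^sup>2"
  have k: "0 \<le> k" using K by (simp add: k_def)
  have b: "0 \<le> b" by (simp add: b_def)
  have xs_pd: "xs pd = xd" unfolding pd_def by (rule xs_implementation[OF target_in_X])
  \<comment> \<open>the rate \<open>t\<^sup>-\<^sup>\<gamma>\<close> is weakened to \<open>t\<^sup>-\<^sup>1\<^sup>/\<^sup>2\<close>, which sums to order \<open>\<surd>t\<close>\<close>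
  have exploit_cost: "cost (- (Theta t \<omega> *v ?\<phi>)) \<le> b * real t powr (-1/2)"
    if t: "1 \<le> t" and e: "norm (err t \<omega>) \<le> K * real t powr (- \<gamma> / 2)" for t \<omega>
  proof -
    let ?q = "- (Theta t \<omega> *v ?\<phi>)"
    have "?q - pd = - (err t \<omega> *v ?\<phi>)"
      by (simp add: pd_def err_def matrix_vector_mult_diff_rdistrib)
    then have "norm (?q - pd) \<le> norm (err t \<omega>) * norm ?\<phi>"
      using norm_matrix_vector_le[of "err t \<omega>" ?\<phi>] by simp
    also have "\<dots> \<le> K * real t powr (- \<gamma> / 2) * norm ?\<phi>" using e by (intro mult_right_mono) auto
    finally have q: "norm (?q - pd) \<le> k * real t powr (- \<gamma> / 2)" by (simp add: k_def mult_ac)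
    have "real t powr (- \<gamma> / 2) \<le> real t powr 0" using t rate by (intro powr_mono) auto
    then have "k * real t powr (- \<gamma> / 2) \<le> k" using t k by (simp add: mult_left_le)
    then have "norm ?q \<le> norm pd + k" using q norm_triangle_ineq[of pd "?q - pd"] by simp
    then have n: "(norm ?q)\<^sup>2 \<le> (norm pd + k)\<^sup>2" by (intro power_mono) auto
    have "norm (xs ?q - xd) \<le> \<Lambda> * norm (?q - pd)" using \<Lambda>(2)[of ?q pd] by (simp add: xs_pd)
    also have "\<dots> \<le> \<Lambda> * (k * real t powr (- \<gamma> / 2))" using q \<Lambda> by (intro mult_left_mono) auto
    finally have "(norm (xs ?q - xd))\<^sup>2 \<le> (\<Lambda> * (k * real t powr (- \<gamma> / 2)))\<^sup>2"
      by (intro power_mono) auto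
    also have "\<dots> = (\<Lambda> * k)\<^sup>2 * real t powr - \<gamma>"
      by (simp add: power_mult_distrib power2_eq_square[of "real t powr _"] flip: powr_add)
    also have "\<dots> \<le> (\<Lambda> * k)\<^sup>2 * real t powr (-1/2)"
      using t rate by (intro mult_left_mono powr_mono) auto
    finally have x: "(norm (xs ?q - xd))\<^sup>2 \<le> (\<Lambda> * k)\<^sup>2 * real t powr (-1/2)" .
    have "L\<^sup>2 * (1 + (norm ?q)\<^sup>2) * (norm (xs ?q - xd))\<^sup>2
        \<le> L\<^sup>2 * (1 + (norm pd + k)\<^sup>2) * ((\<Lambda> * k)\<^sup>2 * real t powr (-1/2))"
      using n x by (intro mult_mono mult_left_mono add_left_mono) auto
    with cost_le[of ?q] show ?thesis by (simp add: b_def mult_ac)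
  qed
  from err up sq AE_space show ?thesis
  proof eventually_elim
    case (elim \<omega>)
    note \<omega> = elim(4)
    obtain t1 where t1: "\<And>t. t1 \<le> t \<Longrightarrow> norm (err t \<omega>) \<le> K * real t powr (- \<gamma> / 2)"
      using elim(1) unfolding eventually_sequentially by blast
    \<comment> \<open>round \<open>s\<close> exploits the estimate of round \<open>s - 1\<close>, hence \<open>Suc t1\<close>; the recursion starts at 2\<close>
    define t0 where "t0 = max (Suc t1) 2"
    define R0 where "R0 = (\<Sum>s=1..t0. cost (p s \<omega>))"
    have R0: "0 \<le> R0" by (simp add: R0_def sum_nonneg cost0)
    have step_cost: "cost (p s \<omega>) \<le> a * (of_bool (explored s \<omega>) + (if explored s \<omega> then (norm (w s \<omega>))\<^sup>2 else 0))
        + b * real (s - 1) powr (-1/2)" if s: "t0 \<le> s" for s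
    proof (cases "explored s \<omega>")
      case True
      then have "cost (p s \<omega>) \<le> a * (1 + (norm (w s \<omega>))\<^sup>2)"
        using explore_cost path_step(3)[OF \<omega>, of s] s by (simp add: t0_def)
      then show ?thesis using True b by (simp add: add_increasing2)
    next
      case False
      then have "p s \<omega> = - (Theta (s - 1) \<omega> *v ?\<phi>)"
        using path_step(4)[OF \<omega>, of s] s by (simp add: t0_def)
      moreover have "cost (- (Theta (s - 1) \<omega> *v ?\<phi>)) \<le> b * real (s - 1) powr (-1/2)"
        using s by (intro exploit_cost t1) (auto simp: t0_def)
      ultimately show ?thesis using False by simp
    qed
    have total: "regret \<Psi> xd ud xs (\<lambda>t. p t \<omega>) t
        \<le> R0 + a * (explorations t \<omega> + (\<Sum>s=2..t. if explored s \<omega> then (norm (w s \<omega>))\<^sup>2 else 0)) + b * (2 * sqrt (real t))"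
      if t: "t0 \<le> t" for t
    proof -
      let ?h = "\<lambda>s. a * (of_bool (explored s \<omega>) + (if explored s \<omega> then (norm (w s \<omega>))\<^sup>2 else 0))
        + b * real (s - 1) powr (-1/2)"
      have h0: "0 \<le> ?h s" for s using a b by simp
      have "regret \<Psi> xd ud xs (\<lambda>t. p t \<omega>) t = (\<Sum>s=1..t. cost (p s \<omega>))"
        by (simp add: regret_def cost_def)
      also have "\<dots> = R0 + (\<Sum>s=Suc t0..t. cost (p s \<omega>))"
        using t sum.ub_add_nat[of 1 t0 "\<lambda>s. cost (p s \<omega>)" "t - t0"] by (simp add: R0_def t0_def)
      also have "\<dots> \<le> R0 + (\<Sum>s=Suc t0..t. ?h s)"
        by (intro add_left_mono sum_mono step_cost) simp
      also have "\<dots> \<le> R0 + (\<Sum>s=2..t. ?h s)"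
        by (intro add_left_mono sum_mono2 h0) (auto simp: t0_def)
      also have "(\<Sum>s=2..t. ?h s) = a * (explorations t \<omega> + (\<Sum>s=2..t. if explored s \<omega> then (norm (w s \<omega>))\<^sup>2 else 0))
          + b * (\<Sum>s=2..t. real (s - 1) powr (-1/2))"
        by (simp only: sum.distrib sum_distrib_left[symmetric] explorations_def)
      also have "(\<Sum>s=2..t. real (s - 1) powr (-1/2)) \<le> 2 * sqrt (real t)"
      proof -
        have "sqrt (real t - 1) \<le> sqrt (real t)" by simp
        moreover have "1 \<le> t" using t by (simp add: t0_def)
        ultimately show ?thesis using sum_inverse_sqrt[of t] by linarith
      qed
      finally show ?thesis using b by (simp add: mult_left_mono)
    qed
    show ?case
    proof (rule bigoI)
      have "filterlim (A_rate \<gamma>) at_top sequentially" using rate by (intro A_rate_at_top) auto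
      then have "eventually (\<lambda>t. R0 \<le> A_rate \<gamma> t) sequentially" by (simp add: filterlim_at_top)
      moreover have "eventually (\<lambda>t. 1 \<le> ln (real t)) sequentially" by real_asymp
      ultimately show "eventually (\<lambda>t. norm (regret \<Psi> xd ud xs (\<lambda>t. p t \<omega>) t)
          \<le> (1 + a * (C + C' * C) + 2 * b) * norm (real t powr \<gamma> * ln (real t))) sequentially"
        using elim(2,3) eventually_ge_at_top[of t0] eventually_ge_at_top[of 1]
      proof eventually_elim
        case (elim t)
        have "sqrt (real t) = real t powr (1 / 2)" by (simp add: powr_half_sqrt)
        also have "\<dots> \<le> real t powr \<gamma>" using elim rate by (intro powr_mono) auto
        also have "\<dots> \<le> A_rate \<gamma> t" unfolding A_rate_def using elim by (simp add: mult_le_cancel_left1)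
        finally have s: "b * (2 * sqrt (real t)) \<le> b * (2 * A_rate \<gamma> t)" using b by (intro mult_left_mono) auto
        have "(\<Sum>s=2..t. if explored s \<omega> then (norm (w s \<omega>))\<^sup>2 else 0) \<le> C' * (C * A_rate \<gamma> t)"
          using elim C' by (meson mult_left_mono less_imp_le order_trans)
        then have "a * (explorations t \<omega> + (\<Sum>s=2..t. if explored s \<omega> then (norm (w s \<omega>))\<^sup>2 else 0))
            \<le> a * (C * A_rate \<gamma> t + C' * (C * A_rate \<gamma> t))"
          using elim a by (intro mult_left_mono add_mono) auto
        then have "regret \<Psi> xd ud xs (\<lambda>t. p t \<omega>) t
            \<le> A_rate \<gamma> t + a * (C * A_rate \<gamma> t + C' * (C * A_rate \<gamma> t)) + b * (2 * A_rate \<gamma> t)"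
          using total[of t] elim s by linarith
        also have "\<dots> = (1 + a * (C + C' * C) + 2 * b) * A_rate \<gamma> t" by (simp add: algebra_simps)
        finally have "regret \<Psi> xd ud xs (\<lambda>t. p t \<omega>) t \<le> (1 + a * (C + C' * C) + 2 * b) * A_rate \<gamma> t" .
        moreover have "0 \<le> regret \<Psi> xd ud xs (\<lambda>t. p t \<omega>) t" by (simp add: regret_def sum_nonneg)
        moreover have "0 \<le> real t powr \<gamma> * ln (real t)" using elim by simp
        ultimately show ?case by (simp add: A_rate_def)
      qed
    qed
  qed
qed

end

theorem theorem2:
  fixes Xs :: "'n::finite \<Rightarrow> real set"
    and d :: nat
    and mon :: "'m::finite \<Rightarrow> 'n \<Rightarrow> nat"
    and l :: "'n \<Rightarrow> real ^ 'n \<Rightarrow> real"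
    and Theta_star :: "real ^ 'm ^ 'n"
    and \<Psi> :: "(real ^ 'n) \<times> (real ^ 'n) \<Rightarrow> real"
    and L\<^sub>\<Psi> :: real
    and xd ud :: "real ^ 'n"
    and M :: "'w measure"
    and e w :: "nat \<Rightarrow> 'w \<Rightarrow> real ^ 'n"
    and \<gamma> \<sigma>\<^sub>p :: real
    and S1 :: "real ^ 'm ^ 'm"
    and p1 :: "real ^ 'n"
    and T1 :: "real ^ 'm ^ 'n"
    and p :: "nat \<Rightarrow> 'w \<Rightarrow> real ^ 'n"
    and S :: "nat \<Rightarrow> 'w \<Rightarrow> real ^ 'm ^ 'm"
    and Theta :: "nat \<Rightarrow> 'w \<Rightarrow> real ^ 'm ^ 'n"
  defines "X \<equiv> action_profiles Xs"
    and "xs \<equiv> nash_response Xs l xd ud"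
  assumes actions: "\<And>i. compact (Xs i)" "\<And>i. convex (Xs i)"
    and monomials: "enumerates_exponents d mon"
    and nominal_costs: "has_marginal_costs Xs l mon Theta_star"
    and feasibility: "feasibility_assumption X \<Psi> L\<^sub>\<Psi> xd ud"
    and types: "type_assumption X mon Theta_star"
    and prob: "prob_space M"
    and noise: "noise_assumption M e"
    and parameters: "1 / 2 \<le> \<gamma>" "\<gamma> < 1" "0 < \<sigma>\<^sub>p"
    and draws: "exploration_draws M e \<sigma>\<^sub>p w"
    and init: "sym_pos_def S1"
    and algorithm: "\<And>\<omega>. \<omega> \<in> space M \<Longrightarrow>
        algorithm_path X mon xs xd \<gamma> S1 p1 T1 (\<lambda>t. e t \<omega>) (\<lambda>t. w t \<omega>)
          (\<lambda>t. p t \<omega>) (\<lambda>t. S t \<omega>) (\<lambda>t. Theta t \<omega>)"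
  shows "(AE \<omega> in M. (\<lambda>t. (norm (Theta t \<omega> - Theta_star))\<^sup>2) \<in> O(\<lambda>t. real t powr (- \<gamma>))) \<and>
         (AE \<omega> in M. regret \<Psi> xd ud xs (\<lambda>t. p t \<omega>) \<in> O(\<lambda>t. real t powr \<gamma> * ln (real t)))"
proof -
  have "inj mon"
    using monomials by (simp add: enumerates_exponents_def bij_betw_def)
  moreover have "xd \<in> interior X"
    using feasibility by (simp add: feasibility_assumption_def)
  moreover have "prob_space M" by (rule prob)
  ultimately interpret incentive_learning Xs l mon Theta_star xd ud M e w \<gamma> \<sigma>\<^sub>p S1 p1 T1 p S Theta
    using assms unfolding incentive_learning_def polynomial_game_def incentive_learning_axioms_def
    by auto
  show ?thesis
    using estimation_rate regret_rate feasibility unfolding X_def xs_def by blast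
qed

end
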